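(* Let $n\geq 1$ and $k\geq 1$ be integers, and let $p_k:\mathbb{R}^n\to\mathbb{R}$ be a polynomial such that $p_k(\xi)>0$ for all $\xi\neq 0$ and $p_k(\lambda\xi)=|\lambda|^k p_k(\xi)$ for all $\lambda\in\mathbb{R}$, $\xi\in\mathbb{R}^n$ (so $k$ is necessarily even). Let $P=P(D_x)$ be the constant coefficient differential operator with symbol $p_k$. (i) If $k<n$, then the distribution $\mathfrak{S}\in\mathcal{S}'(\mathbb{R}^n)$ defined for $f\in\mathcal{S}(\mathbb{R}^n)$ by $$\langle \mathfrak{S},f\rangle=\frac{1}{(2\pi)^n}\int_{\mathbb{R}_+\times\mathbb{S}^{n-1}} p_k(\theta)^{-1}\,\hat f(r\theta)\,r^{n-1-k}\,dr\,d\theta$$ is a fundamental solution for $P$, i.e. $P\mathfrak{S}=\delta$. (ii) If $k\geq n$, then the distribution $\mathfrak{S}\in\mathcal{S}'(\mathbb{R}^n)$ defined for $f\in\mathcal{S}(\mathbb{R}^n)$ by $$\langle \mathfrak{S},f\rangle=-C_{k,n}\,\frac{\partial^{k-1}A(\hat f)}{\partial r^{k-1}}(0)+D_{k,n}\int_{\mathbb{R}_+}\log(u)\,\frac{\partial^{k}A(\hat f)}{\partial r^{k}}(u)\,du$$ is a fundamental solution for $P$, i.e. $P\mathfrak{S}=\delta$, where $$C_{k,n}=\frac{(-1)^{k+1}}{(2\pi)^n}\,\frac{\gamma+\psi(k)}{\Gamma(k)},\qquad D_{k,n}=\frac{1}{(2\pi)^n}\,\frac{(-1)^{k-1}}{(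k-1)!}.$$
   Context: $\mathcal{S}(\mathbb{R}^n)$ is the Schwartz space and $\mathcal{S}'(\mathbb{R}^n)$ the space of tempered distributions. The Fourier transform is $\hat f(\xi)=\int_{\mathbb{R}^n}e^{-i\langle y,\xi\rangle}f(y)\,dy$. The operator with symbol $p_k$ is $$Pf(x)=\frac{1}{(2\pi)^n}\int_{\mathbb{R}^n}e^{i\langle\xi,x\rangle}p_k(\xi)\hat f(\xi)\,d\xi ,$$ extended to $\mathcal{S}'(\mathbb{R}^n)$ in the usual way. A fundamental solution for $P$ is a distribution $\mathfrak{S}\in\mathcal{S}'(\mathbb{R}^n)$ with $P\mathfrak{S}=\delta$, the Dirac mass at the origin. $d\theta$ is the standard surface measure on the unit sphere $\mathbb{S}^{n-1}$ (counting measure on $\{\pm1\}$ when $n=1$), and $p_k(\theta)$ denotes the restriction of $p_k$ to $\mathbb{S}^{n-1}$. For $g\in\mathcal{S}(\mathbb{R}^n)$ the spherical average with respect to the symbol is the function on $\mathbb{R}_+=[0,\infty)$ $$A(g)(r)=r^{n-1}\int_{\mathbb{S}^{n-1}}g(r\theta)\,p_k(\theta)^{-1}\,d\theta ,$$ which is smooth and rapidly decreasing on $[0,\infty)$; its derivatives at $r=0$ are one-sided (from $r>0$), and the derivatives in the integral are taken on $r>0$. $\gamma$ is Euler's constant, $\Gamma$ the Gamma function, and $\psi=\Gamma'/\Gamma$. *)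

theory Defs
  imports "HOL-Analysis.Analysis"
begin

fun partials :: "'n list \<Rightarrow> (real^'n::finite \<Rightarrow> complex) \<Rightarrow> real^'n \<Rightarrow> complex" where
  "partials [] f = f"
| "partials (i # js) f = (\<lambda>x. frechet_derivative (partials js f) (at x) (axis i 1))"

definition schwartz :: "(real^'n::finite \<Rightarrow> complex) set" where
  "schwartz = {f. \<forall>js. (\<forall>x. partials js f differentiable (at x)) \<and>
     (\<forall>N. bdd_above (range (\<lambda>x. (1 + norm x) ^ N * norm (partials js f x))))}"

definition schwartz_seminorm :: "nat \<Rightarrow> 'n list \<Rightarrow> (real^'n::finite \<Rightarrow> complex) \<Rightarrow> real" where
  "schwartz_seminorm N js f = (SUP x. (1 + norm x) ^ N * norm (partials js f x))"

definition schwartz_topology :: "(real^'n::finite \<Rightarrow> complex) topology" where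
  "schwartz_topology = topology_generated_by
     {{g \<in> schwartz. schwartz_seminorm N js (\<lambda>x. g x - f x) < e} | f N js e. f \<in> schwartz \<and> e > 0}"

text \<open>A functional is represented by a total function on all \<open>f\<close>; only its values on
  \<^const>\<open>schwartz\<close> are meaningful.\<close>

definition tempered_distribution :: "((real^'n::finite \<Rightarrow> complex) \<Rightarrow> complex) \<Rightarrow> bool" where
  "tempered_distribution T \<longleftrightarrow>
     (\<forall>f\<in>schwartz. \<forall>g\<in>schwartz. T (\<lambda>x. f x + g x) = T f + T g) \<and>
     (\<forall>c. \<forall>f\<in>schwartz. T (\<lambda>x. c * f x) = c * T f) \<and>
     continuous_map schwartz_topology euclidean T"

definition dirac :: "(real^'n::finite \<Rightarrow> complex) \<Rightarrow> complex" where
  "dirac f = f 0"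

definition fourier :: "(real^'n::finite \<Rightarrow> complex) \<Rightarrow> real^'n \<Rightarrow> complex" where
  "fourier f \<xi> = (LINT y|lborel. exp (- \<i> * complex_of_real (y \<bullet> \<xi>)) * f y)"

definition symbol_op :: "(real^'n::finite \<Rightarrow> real) \<Rightarrow> (real^'n \<Rightarrow> complex) \<Rightarrow> real^'n \<Rightarrow> complex" where
  "symbol_op p f x = complex_of_real (1 / (2 * pi) ^ CARD('n)) *
     (LINT \<xi>|lborel. exp (\<i> * complex_of_real (\<xi> \<bullet> x)) * complex_of_real (p \<xi>) * fourier f \<xi>)"

text \<open>The extension to tempered distributions is by duality. The transpose of the operator with
  symbol \<open>p(\<xi>)\<close> with respect to the bilinear pairing \<open>\<integral> f g\<close> has symbol \<open>p(-\<xi>)\<close>.\<close>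

definition symbol_op_dist ::
  "(real^'n::finite \<Rightarrow> real) \<Rightarrow> ((real^'n \<Rightarrow> complex) \<Rightarrow> complex) \<Rightarrow> (real^'n \<Rightarrow> complex) \<Rightarrow> complex" where
  "symbol_op_dist p T f = T (symbol_op (\<lambda>\<xi>. p (- \<xi>)) f)"

definition fundamental_solution ::
  "(real^'n::finite \<Rightarrow> real) \<Rightarrow> ((real^'n \<Rightarrow> complex) \<Rightarrow> complex) \<Rightarrow> bool" where
  "fundamental_solution p T \<longleftrightarrow>
     tempered_distribution T \<and> (\<forall>f\<in>schwartz. symbol_op_dist p T f = dirac f)"

text \<open>The surface measure is realised as the cone measure
  \<open>\<sigma>(E) = n \<cdot> vol {r\<theta> | 0 < r \<le> 1, \<theta> \<in> E}\<close>, the normalisation for which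
  \<open>dx = r\<^sup>n\<^sup>-\<^sup>1 dr d\<sigma>(\<theta>)\<close>. For \<open>n = 1\<close> both points of \<open>{-1, 1}\<close> have mass \<open>1\<close>.\<close>

definition sphere_measure :: "(real^'n::finite) measure" where
  "sphere_measure = scale_measure (of_nat CARD('n))
     (distr (restrict_space lborel (cball 0 1 - {0})) (restrict_space borel (sphere 0 1))
        (\<lambda>x. x /\<^sub>R norm x))"

definition spherical_average ::
  "(real^'n::finite \<Rightarrow> real) \<Rightarrow> (real^'n \<Rightarrow> complex) \<Rightarrow> real \<Rightarrow> complex" where
  "spherical_average p g r = complex_of_real (r ^ (CARD('n) - 1)) *
     (LINT \<theta>|sphere_measure. g (r *\<^sub>R \<theta>) * complex_of_real (inverse (p \<theta>)))"

text \<open>The \<open>j\<close>-th derivative on \<open>[0, \<infinity>)\<close>: one-sided at \<open>0\<close> and the ordinary derivative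
  at every \<open>r > 0\<close>.\<close>

definition halfline_deriv :: "nat \<Rightarrow> (real \<Rightarrow> complex) \<Rightarrow> real \<Rightarrow> complex" where
  "halfline_deriv j = (\<lambda>h r. vector_derivative h (at r within {0..})) ^^ j"

definition C_const :: "nat \<Rightarrow> nat \<Rightarrow> real" where
  "C_const k n = (-1) ^ (k + 1) / (2 * pi) ^ n *
     ((euler_mascheroni + Digamma (real k)) / Gamma (real k))"

definition D_const :: "nat \<Rightarrow> nat \<Rightarrow> real" where
  "D_const k n = 1 / (2 * pi) ^ n * ((-1) ^ (k - 1) / fact (k - 1))"

end

theory Submission
  imports Defs "HOL-Probability.Characteristic_Functions" "HOL-Real_Asymp.Real_Asymp"
begin

text \<open>
Write \<open>F\<close> for the Fourier transform.  Since the symbol is even, a tempered distribution \<open>T\<close> is a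
fundamental solution when \<open>T (P f) = f(0)\<close> for all Schwartz functions \<open>f\<close>, and
\<open>F (P f) = p F f\<close>.  Both distributions in the theorem have the form \<open>T f = S (F f)\<close>, where \<open>S\<close> is a
regularisation of integration against \<open>(2 \<pi>)\<^sup>-\<^sup>n / p\<close>.  The point is that \<open>S (p g)\<close> is
\<open>(2 \<pi>)\<^sup>-\<^sup>n \<integral> g\<close>; for \<open>g = F f\<close> this is \<open>f(0)\<close> by Fourier inversion.

If \<open>k < n\<close>, the function \<open>1 / p\<close> is locally integrable, and the identity is the polar coordinate
formula together with homogeneity (\<open>fundamental_solution_low_degree\<close>).

If \<open>k \<ge> n\<close>, the integral of \<open>u\<^sup>-\<^sup>k A(g)(u)\<close> diverges at \<open>0\<close> in general.  It is replaced by the expression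
that \<open>k\<close> formal integrations by parts produce, in which \<open>u\<^sup>-\<^sup>k\<close> has become a logarithm.  For
\<open>p g\<close> instead of \<open>g\<close> the spherical average is \<open>u\<^sup>n\<^sup>-\<^sup>1\<^sup>+\<^sup>k\<close> times a smooth function, because homogeneity
contributes \<open>u\<^sup>k\<close> on all of the line once \<open>k\<close> is known to be even (\<open>symbol_degree_even\<close>).  So the
integrations by parts are legitimate, without boundary terms (\<open>integral_ln_derivative\<close>), and the
derivative of order \<open>k - 1\<close> at \<open>0\<close> vanishes.

Three ingredients carry the analysis.  The polar coordinate formula for the cone measure on the
sphere is \<open>lborel_polar\<close>.  Fourier inversion is proved with Gaussians (\<open>fourier_inversion_zero\<close>).
Continuity is always obtained from bounds by finitely many seminorms (\<open>tempered_distributionI\<close>): the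
Fourier transform preserves such bounds (\<open>schwartz_op_fourier\<close>), and so do the radial derivatives of
spherical averages, which form a class closed under differentiation
(\<open>radial_family_derivative\<close>, \<open>radial_family_decay\<close>).
\<close>

section \<open>Schwartz functions and seminorm bounds\<close>

lemma partials_append: "partials (ks @ js) f = partials ks (partials js f)"
  by (induction ks) auto

lemma schwartz_differentiable:
  "f \<in> schwartz \<Longrightarrow> partials js f differentiable (at x)"
  by (auto simp: schwartz_def)

lemma schwartz_seminorm_upper:
  "f \<in> schwartz \<Longrightarrow> (1 + norm x) ^ N * norm (partials js f x) \<le> schwartz_seminorm N js f"
  unfolding schwartz_seminorm_def by (rule cSUP_upper) (auto simp: schwartz_def)

lemma schwartz_seminorm_nonneg: "f \<in> schwartz \<Longrightarrow> 0 \<le> schwartz_seminorm N js f"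
  by (rule order_trans[OF _ schwartz_seminorm_upper[where x=0]]) auto

lemma schwartz_seminorm_le:
  "(\<And>x. (1 + norm x) ^ N * norm (partials js f x) \<le> B) \<Longrightarrow> schwartz_seminorm N js f \<le> B"
  unfolding schwartz_seminorm_def by (rule cSUP_least) auto

lemma schwartz_seminorm_partials:
  "schwartz_seminorm N ks (partials js f) = schwartz_seminorm N (ks @ js) f"
  by (simp add: schwartz_seminorm_def partials_append)

lemma schwartz_partials: "f \<in> schwartz \<Longrightarrow> partials js f \<in> schwartz"
  unfolding schwartz_def by (simp flip: partials_append)

lemma schwartz_has_derivative:
  assumes "f \<in> schwartz"
  shows "(f has_derivative (\<lambda>h. \<Sum>i\<in>UNIV. h $ i *\<^sub>R partials [i] f x)) (at x)"
proof -
  have d: "f differentiable (at x)"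
    using schwartz_differentiable[OF assms, of "[]"] by simp
  let ?D = "frechet_derivative f (at x)"
  have lin: "linear ?D" using d by (rule linear_frechet_derivative)
  have "?D h = (\<Sum>i\<in>UNIV. h $ i *\<^sub>R partials [i] f x)" for h
  proof -
    have "?D h = ?D (\<Sum>i\<in>UNIV. h $ i *\<^sub>R axis i 1)"
      using basis_expansion[of h] by (simp add: scalar_mult_eq_scaleR)
    also have "\<dots> = (\<Sum>i\<in>UNIV. h $ i *\<^sub>R ?D (axis i 1))"
      by (simp add: linear_sum[OF lin] linear_scale[OF lin])
    finally show ?thesis by simp
  qed
  then have "?D = (\<lambda>h. \<Sum>i\<in>UNIV. h $ i *\<^sub>R partials [i] f x)" by (rule ext)
  then show ?thesis using d unfolding frechet_derivative_works by (simp only:)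
qed

lemma partials_single_eqI:
  assumes "(f has_derivative D) (at x)"
  shows "partials [i] f x = D (axis i 1)"
  using frechet_derivative_at[OF assms] by simp

lemma schwartz_continuous: "f \<in> schwartz \<Longrightarrow> continuous_on UNIV f"
  by (intro continuous_at_imp_continuous_on ballI has_derivative_continuous[OF schwartz_has_derivative])

lemma schwartz_borel [measurable]: "f \<in> schwartz \<Longrightarrow> f \<in> borel_measurable borel"
  by (intro borel_measurable_continuous_onI schwartz_continuous)

text \<open>A linear functional on the Schwartz space is continuous once its modulus is bounded by finitely
many seminorms.  The notion below is stated for an arbitrary real quantity \<open>q\<close>, so that
suprema, values at a point and integrals can all be estimated with the same algebra of bounds.\<close>

definition seminorm_bounded :: "((real^'n::finite \<Rightarrow> complex) \<Rightarrow> real) \<Rightarrow> bool" where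
  "seminorm_bounded q \<longleftrightarrow> (\<exists>A C. finite A \<and> 0 \<le> C \<and>
     (\<forall>f\<in>schwartz. q f \<le> C * (\<Sum>(N,js)\<in>A. schwartz_seminorm N js f)))"

lemma seminorm_bounded_seminorm: "seminorm_bounded (schwartz_seminorm N js)"
  unfolding seminorm_bounded_def
  by (rule exI[of _ "{(N,js)}"], rule exI[of _ 1]) auto

lemma seminorm_bounded_mono:
  "seminorm_bounded q \<Longrightarrow> (\<And>f. f \<in> schwartz \<Longrightarrow> r f \<le> q f) \<Longrightarrow> seminorm_bounded r"
  unfolding seminorm_bounded_def by (meson order_trans)

lemma seminorm_bounded_mult:
  assumes "seminorm_bounded q" "0 \<le> c"
  shows "seminorm_bounded (\<lambda>f. c * q f)"
proof -
  obtain A C where "finite A" "0 \<le> C"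
    and *: "\<And>f. f\<in>schwartz \<Longrightarrow> q f \<le> C * (\<Sum>(N,js)\<in>A. schwartz_seminorm N js f)"
    using assms(1) unfolding seminorm_bounded_def by blast
  have "f\<in>schwartz \<Longrightarrow> c * q f \<le> (c * C) * (\<Sum>(N,js)\<in>A. schwartz_seminorm N js f)" for f
    using mult_left_mono[OF * assms(2)] by (simp add: mult.assoc)
  then show ?thesis
    unfolding seminorm_bounded_def using \<open>finite A\<close> \<open>0 \<le> C\<close> assms(2)
    by (intro exI[of _ A] exI[of _ "c * C"]) auto
qed

lemma seminorm_bounded_add:
  assumes "seminorm_bounded q" "seminorm_bounded r"
  shows "seminorm_bounded (\<lambda>f. q f + r f)"
proof -
  obtain A C where A: "finite A" "0 \<le> C"
    and q: "\<And>f. f\<in>schwartz \<Longrightarrow> q f \<le> C * (\<Sum>(N,js)\<in>A. schwartz_seminorm N js f)"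
    using assms(1) unfolding seminorm_bounded_def by blast
  obtain B D where B: "finite B" "0 \<le> D"
    and r: "\<And>f. f\<in>schwartz \<Longrightarrow> r f \<le> D * (\<Sum>(N,js)\<in>B. schwartz_seminorm N js f)"
    using assms(2) unfolding seminorm_bounded_def by blast
  have "q f + r f \<le> (C + D) * (\<Sum>(N,js)\<in>A \<union> B. schwartz_seminorm N js f)" if f: "f\<in>schwartz" for f
  proof -
    have "q f \<le> C * (\<Sum>(N,js)\<in>A \<union> B. schwartz_seminorm N js f)"
      by (rule order_trans[OF q[OF f]])
        (use A B f in \<open>auto intro!: mult_left_mono sum_mono2 schwartz_seminorm_nonneg\<close>)
    moreover have "r f \<le> D * (\<Sum>(N,js)\<in>A \<union> B. schwartz_seminorm N js f)"
      by (rule order_trans[OF r[OF f]])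
        (use A B f in \<open>auto intro!: mult_left_mono sum_mono2 schwartz_seminorm_nonneg\<close>)
    ultimately show ?thesis by (simp add: distrib_right)
  qed
  then show ?thesis
    unfolding seminorm_bounded_def using A B
    by (intro exI[of _ "A \<union> B"] exI[of _ "C + D"]) auto
qed

lemma seminorm_bounded_zero: "seminorm_bounded (\<lambda>f. 0)"
  by (rule seminorm_bounded_mono[OF seminorm_bounded_mult[OF seminorm_bounded_seminorm, of 0]]) auto

lemma seminorm_bounded_sum:
  "finite I \<Longrightarrow> (\<And>i. i \<in> I \<Longrightarrow> seminorm_bounded (q i)) \<Longrightarrow> seminorm_bounded (\<lambda>f. \<Sum>i\<in>I. q i f)"
  by (induction I rule: finite_induct) (auto intro: seminorm_bounded_add seminorm_bounded_zero)

text \<open>The maps along which seminorm bounds can be pulled back.  The main examples are multiplication by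
polynomials, partial derivatives and the Fourier transform.\<close>

definition schwartz_op :: "((real^'n::finite \<Rightarrow> complex) \<Rightarrow> real^'n \<Rightarrow> complex) \<Rightarrow> bool" where
  "schwartz_op L \<longleftrightarrow> (\<forall>f\<in>schwartz. L f \<in> schwartz) \<and>
     (\<forall>N js. seminorm_bounded (\<lambda>f. schwartz_seminorm N js (L f)))"

lemma schwartz_opD: "schwartz_op L \<Longrightarrow> f \<in> schwartz \<Longrightarrow> L f \<in> schwartz"
  by (auto simp: schwartz_op_def)

lemma seminorm_bounded_compose:
  assumes "seminorm_bounded q" "schwartz_op L"
  shows "seminorm_bounded (\<lambda>f. q (L f))"
proof -
  obtain A C where A: "finite A" "0 \<le> C"
    and q: "\<And>f. f\<in>schwartz \<Longrightarrow> q f \<le> C * (\<Sum>(N,js)\<in>A. schwartz_seminorm N js f)"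
    using assms(1) unfolding seminorm_bounded_def by blast
  have "seminorm_bounded (\<lambda>f. C * (\<Sum>a\<in>A. (case a of (N,js) \<Rightarrow> schwartz_seminorm N js (L f))))"
    using A assms(2)
    by (intro seminorm_bounded_mult seminorm_bounded_sum) (auto simp: schwartz_op_def split: prod.split)
  then show ?thesis
    by (rule seminorm_bounded_mono) (use q assms(2) in \<open>auto simp: schwartz_op_def\<close>)
qed

lemma schwartz_op_compose: "schwartz_op K \<Longrightarrow> schwartz_op L \<Longrightarrow> schwartz_op (\<lambda>f. K (L f))"
  unfolding schwartz_op_def[of "\<lambda>f. K (L f)"]
  using seminorm_bounded_compose[where L=L and q="\<lambda>f. schwartz_seminorm _ _ (K f)"]
  by (auto simp: schwartz_opD) (simp add: schwartz_op_def)

lemma schwartz_op_partials: "schwartz_op (partials js)"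
  unfolding schwartz_op_def
  by (auto simp: schwartz_partials schwartz_seminorm_partials seminorm_bounded_seminorm)

lemma schwartz_op_id: "schwartz_op (\<lambda>f. f)"
  unfolding schwartz_op_def by (auto simp: seminorm_bounded_seminorm)

text \<open>If a set \<open>X\<close> of maps is closed under partial derivatives, then every iterated partial
derivative of \<open>L f\<close> is again \<open>L' f\<close> for some \<open>L'\<close> in \<open>X\<close>.  Hence bounds on the
functions \<open>L f\<close> themselves give bounds on all seminorms.\<close>

lemma schwartz_op_coinduct:
  fixes X :: "((real^'n::finite \<Rightarrow> complex) \<Rightarrow> real^'n \<Rightarrow> complex) set"
  assumes "L \<in> X"
    and diff: "\<And>L f x. L \<in> X \<Longrightarrow> f \<in> schwartz \<Longrightarrow> L f differentiable (at x)"
    and step: "\<And>L i. L \<in> X \<Longrightarrow> \<exists>L'\<in>X. \<forall>f\<in>schwartz. partials [i] (L f) = L' f"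
    and bound: "\<And>L N. L \<in> X \<Longrightarrow> \<exists>q. seminorm_bounded q \<and>
      (\<forall>f\<in>schwartz. \<forall>x. (1 + norm x) ^ N * norm (L f x) \<le> q f)"
  shows "schwartz_op L"
proof -
  have ex: "\<exists>L'\<in>X. \<forall>f\<in>schwartz. partials js (L f) = L' f" for js
  proof (induction js)
    case Nil
    show ?case using assms(1) by auto
  next
    case (Cons i js)
    then obtain L' where L': "L' \<in> X" "\<forall>f\<in>schwartz. partials js (L f) = L' f" by blast
    obtain L'' where "L'' \<in> X" "\<forall>f\<in>schwartz. partials [i] (L' f) = L'' f"
      using step[OF L'(1)] by blast
    moreover have "partials (i # js) (L f) = partials [i] (partials js (L f))" for f
      by simp
    ultimately show ?case using L'(2) by (intro bexI[of _ L'']) (auto simp del: partials.simps)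
  qed
  have "L f \<in> schwartz" if f: "f \<in> schwartz" for f
    unfolding schwartz_def
  proof (intro CollectI allI conjI)
    fix js x
    obtain L' where L': "L' \<in> X" "\<forall>f\<in>schwartz. partials js (L f) = L' f" using ex by blast
    show "partials js (L f) differentiable (at x)" using L' f diff by simp
    fix N
    obtain q where "\<forall>x. (1 + norm x) ^ N * norm (L' f x) \<le> q f"
      using bound[OF L'(1)] f by blast
    then show "bdd_above (range (\<lambda>x. (1 + norm x) ^ N * norm (partials js (L f) x)))"
      using L'(2) f by (intro bdd_aboveI[of _ "q f"]) auto
  qed
  moreover have "seminorm_bounded (\<lambda>f. schwartz_seminorm N js (L f))" for N js
  proof -
    obtain L' where L': "L' \<in> X" "\<forall>f\<in>schwartz. partials js (L f) = L' f" using ex by blast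
    obtain q where "seminorm_bounded q" "\<forall>f\<in>schwartz. \<forall>x. (1 + norm x) ^ N * norm (L' f x) \<le> q f"
      using bound[OF L'(1)] by blast
    then show ?thesis
      using L'(2) by (elim seminorm_bounded_mono) (auto intro: schwartz_seminorm_le)
  qed
  ultimately show ?thesis by (auto simp: schwartz_op_def)
qed

lemma schwartz_op_decay:
  assumes "schwartz_op L"
  shows "\<exists>q. seminorm_bounded q \<and> (\<forall>f\<in>schwartz. \<forall>x. (1 + norm x) ^ N * norm (L f x) \<le> q f)"
proof (intro exI conjI ballI allI)
  show "seminorm_bounded (\<lambda>f. schwartz_seminorm N [] (L f))"
    using assms by (auto simp: schwartz_op_def)
  show "(1 + norm x) ^ N * norm (L f x) \<le> schwartz_seminorm N [] (L f)" if "f \<in> schwartz" for f x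
    using schwartz_seminorm_upper[OF schwartz_opD[OF assms that], of x N "[]"] by simp
qed

lemma schwartz_op_add:
  fixes L K :: "(real^'n::finite \<Rightarrow> complex) \<Rightarrow> real^'n \<Rightarrow> complex"
  assumes "schwartz_op L" "schwartz_op K"
  shows "schwartz_op (\<lambda>f x. L f x + K f x)"
proof -
  define X where "X = {\<lambda>f x. L f x + K f x |L K. schwartz_op (L :: (real^'n \<Rightarrow> complex) \<Rightarrow> real^'n \<Rightarrow> complex) \<and>
      schwartz_op K}"
  have XE: thesis if "M \<in> X" "\<And>L K. M = (\<lambda>f x. L f x + K f x) \<Longrightarrow> schwartz_op L \<Longrightarrow> schwartz_op K \<Longrightarrow> thesis" for M thesis
    using that unfolding X_def by blast
  have XI: "(\<lambda>f x. L f x + K f x) \<in> X" if "schwartz_op L" "schwartz_op K" for L K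
    using that unfolding X_def by blast
  show ?thesis
  proof (rule schwartz_op_coinduct[OF XI[OF assms]]; (erule XE, hypsubst))
    fix L K :: "(real^'n \<Rightarrow> complex) \<Rightarrow> real^'n \<Rightarrow> complex"
    assume LK: "schwartz_op L" "schwartz_op K"
    have der: "((\<lambda>x. L f x + K f x) has_derivative
       (\<lambda>h. (\<Sum>i\<in>UNIV. h $ i *\<^sub>R partials [i] (L f) x) + (\<Sum>i\<in>UNIV. h $ i *\<^sub>R partials [i] (K f) x))) (at x)"
      if "f \<in> schwartz" for f x
      using LK that by (intro has_derivative_add schwartz_has_derivative) (auto simp: schwartz_opD)
    show "(\<lambda>x. L f x + K f x) differentiable (at x)" if "f \<in> schwartz" for f x
      using der[OF that] by (auto simp: differentiable_def)
    show "\<exists>L'\<in>X. \<forall>f\<in>schwartz. partials [i] (\<lambda>x. L f x + K f x) = L' f" for i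
    proof (intro bexI ballI ext)
      show "partials [i] (\<lambda>x. L f x + K f x) x = partials [i] (L f) x + partials [i] (K f) x"
        if "f \<in> schwartz" for f x
        unfolding partials_single_eqI[OF der[OF that]]
        by (simp add: axis_def if_distrib if_distribR sum.delta cong: if_cong del: partials.simps)
      show "(\<lambda>f x. partials [i] (L f) x + partials [i] (K f) x) \<in> X"
        using LK by (intro XI schwartz_op_compose[OF schwartz_op_partials])
    qed
    show "\<exists>q. seminorm_bounded q \<and> (\<forall>f\<in>schwartz. \<forall>x. (1 + norm x) ^ N * norm (L f x + K f x) \<le> q f)" for N
    proof -
      obtain q r where "seminorm_bounded q" "\<And>f x. f\<in>schwartz \<Longrightarrow> (1 + norm x) ^ N * norm (L f x) \<le> q f"
         "seminorm_bounded r" "\<And>f x. f\<in>schwartz \<Longrightarrow> (1 + norm x) ^ N * norm (K f x) \<le> r f"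
        using LK[THEN schwartz_op_decay[where N=N]] by blast
      then show ?thesis
        by (intro exI[of _ "\<lambda>f. q f + r f"])
          (auto intro!: seminorm_bounded_add order_trans[OF mult_left_mono[OF norm_triangle_ineq]]
           add_mono simp: distrib_left)
    qed
  qed
qed

lemma schwartz_op_cmult:
  fixes L :: "(real^'n::finite \<Rightarrow> complex) \<Rightarrow> real^'n \<Rightarrow> complex"
  assumes "schwartz_op L"
  shows "schwartz_op (\<lambda>f x. c * L f x)"
proof -
  define X where "X = {\<lambda>f x. c * L f x |L. schwartz_op (L :: (real^'n \<Rightarrow> complex) \<Rightarrow> real^'n \<Rightarrow> complex)}"
  have XE: thesis if "M \<in> X" "\<And>L. M = (\<lambda>f x. c * L f x) \<Longrightarrow> schwartz_op L \<Longrightarrow> thesis" for M thesis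
    using that unfolding X_def by blast
  have XI: "(\<lambda>f x. c * L f x) \<in> X" if "schwartz_op L" for L
    using that unfolding X_def by blast
  show ?thesis
  proof (rule schwartz_op_coinduct[OF XI[OF assms]]; (erule XE, hypsubst))
    fix L :: "(real^'n \<Rightarrow> complex) \<Rightarrow> real^'n \<Rightarrow> complex"
    assume L: "schwartz_op L"
    have der: "((\<lambda>x. c * L f x) has_derivative
       (\<lambda>h. c * (\<Sum>i\<in>UNIV. h $ i *\<^sub>R partials [i] (L f) x))) (at x)"
      if "f \<in> schwartz" for f x
      using L that by (intro has_derivative_mult_right schwartz_has_derivative) (auto simp: schwartz_opD)
    show "(\<lambda>x. c * L f x) differentiable (at x)" if "f \<in> schwartz" for f x
      using der[OF that] by (auto simp: differentiable_def)
    show "\<exists>L'\<in>X. \<forall>f\<in>schwartz. partials [i] (\<lambda>x. c * L f x) = L' f" for i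
    proof (intro bexI ballI ext)
      show "partials [i] (\<lambda>x. c * L f x) x = c * partials [i] (L f) x"
        if "f \<in> schwartz" for f x
        unfolding partials_single_eqI[OF der[OF that]]
        by (simp add: axis_def if_distrib if_distribR sum.delta cong: if_cong del: partials.simps)
      show "(\<lambda>f x. c * partials [i] (L f) x) \<in> X"
        using L by (intro XI schwartz_op_compose[OF schwartz_op_partials])
    qed
    show "\<exists>q. seminorm_bounded q \<and> (\<forall>f\<in>schwartz. \<forall>x. (1 + norm x) ^ N * norm (c * L f x) \<le> q f)" for N
    proof -
      obtain q where q: "seminorm_bounded q" "\<And>f x. f\<in>schwartz \<Longrightarrow> (1 + norm x) ^ N * norm (L f x) \<le> q f"
        using L[THEN schwartz_op_decay[where N=N]] by blast
      have "(1 + norm x) ^ N * norm (c * L f x) \<le> norm c * q f" if "f \<in> schwartz" for f x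
        using mult_left_mono[OF q(2)[OF that], of "norm c"] by (simp add: norm_mult mult.left_commute)
      then show ?thesis
        using q by (intro exI[of _ "\<lambda>f. norm c * q f"]) (auto intro!: seminorm_bounded_mult)
    qed
  qed
qed

text \<open>One derivative of \<open>x\<^sub>j L f\<close> produces \<open>x\<^sub>j \<partial>\<^sub>i(L f) + \<delta>\<^sub>i\<^sub>j L f\<close>, so the maps \<open>x\<^sub>j L + K\<close> form a set
that is closed under derivatives.\<close>

lemma schwartz_op_coordinate:
  fixes L :: "(real^'n::finite \<Rightarrow> complex) \<Rightarrow> real^'n \<Rightarrow> complex" and j :: 'n
  assumes "schwartz_op L"
  shows "schwartz_op (\<lambda>f x. complex_of_real (x $ j) * L f x)"
proof -
  define X where "X = {\<lambda>f x. complex_of_real (x $ j) * L f x +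
      K f x |L K. schwartz_op (L :: (real^'n \<Rightarrow> complex) \<Rightarrow> real^'n \<Rightarrow> complex) \<and> schwartz_op K}"
  have XE: thesis if "M \<in> X" "\<And>L K. M = (\<lambda>f x. complex_of_real (x $ j) * L f x + K f x) \<Longrightarrow> schwartz_op L \<Longrightarrow>
      schwartz_op K \<Longrightarrow> thesis" for M thesis
    using that unfolding X_def by blast
  have XI: "(\<lambda>f x. complex_of_real (x $ j) * L f x + K f x) \<in> X" if "schwartz_op L" "schwartz_op K" for L K
    using that unfolding X_def by blast
  have zero: "schwartz_op (\<lambda>f (x::real^'n). 0)"
    using schwartz_op_cmult[OF schwartz_op_id, of 0] by simp
  have start: "(\<lambda>f x. complex_of_real (x $ j) * L f x) \<in> X"
    using XI[OF assms zero] by simp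
  show ?thesis
  proof (rule schwartz_op_coinduct[OF start]; (erule XE, hypsubst))
    fix L K :: "(real^'n \<Rightarrow> complex) \<Rightarrow> real^'n \<Rightarrow> complex"
    assume LK: "schwartz_op L" "schwartz_op K"
    have bl: "bounded_linear (\<lambda>x::real^'n. complex_of_real (x $ j))"
      by (intro bounded_linear_compose[OF bounded_linear_of_real] bounded_linear_vec_nth)
    have der: "((\<lambda>x. complex_of_real (x $ j) * L f x + K f x) has_derivative
       (\<lambda>h. (complex_of_real (x $ j) * (\<Sum>i\<in>UNIV. h $ i *\<^sub>R partials [i] (L f) x) + complex_of_real (h $ j) * L f x)
         + (\<Sum>i\<in>UNIV. h $ i *\<^sub>R partials [i] (K f) x))) (at x)"
      if "f \<in> schwartz" for f x
      using LK that
      by (intro has_derivative_add has_derivative_mult schwartz_has_derivative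
         bounded_linear_imp_has_derivative bl) (auto simp: schwartz_opD)
    show "(\<lambda>x. complex_of_real (x $ j) * L f x + K f x) differentiable (at x)" if "f \<in> schwartz" for f x
      using der[OF that] by (auto simp: differentiable_def)
    show "\<exists>L'\<in>X. \<forall>f\<in>schwartz. partials [i] (\<lambda>x. complex_of_real (x $ j) * L f x + K f x) = L' f" for i
    proof (intro bexI ballI ext)
      show "partials [i] (\<lambda>x. complex_of_real (x $ j) * L f x + K f x) x =
         complex_of_real (x $ j) * partials [i] (L f) x +
           ((if i = j then 1 else 0) * L f x + partials [i] (K f) x)"
        if "f \<in> schwartz" for f x
        unfolding partials_single_eqI[OF der[OF that]]
        by (auto simp add: axis_def if_distrib if_distribR sum.delta cong: if_cong simp del: partials.simps)
      show "(\<lambda>f x. complex_of_real (x $ j) * partials [i] (L f) x +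
           ((if i = j then 1 else 0) * L f x + partials [i] (K f) x)) \<in> X"
        using LK by (intro XI schwartz_op_add schwartz_op_cmult schwartz_op_compose[OF schwartz_op_partials])
    qed
    show "\<exists>q. seminorm_bounded q \<and> (\<forall>f\<in>schwartz. \<forall>x. (1 + norm x) ^ N * norm (complex_of_real (x $ j) * L f x +
        K f x) \<le> q f)" for N
    proof -
      obtain q r where q: "seminorm_bounded q" "\<And>f x. f\<in>schwartz \<Longrightarrow> (1 + norm x) ^ Suc N * norm (L f x) \<le> q f"
        and r: "seminorm_bounded r" "\<And>f x. f\<in>schwartz \<Longrightarrow> (1 + norm x) ^ N * norm (K f x) \<le> r f"
        using schwartz_op_decay[OF LK(1), of "Suc N"] schwartz_op_decay[OF LK(2), of N] by metis
      have "(1 + norm x) ^ N * norm (complex_of_real (x $ j) * L f x + K f x) \<le> q f + r f"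
        if f: "f \<in> schwartz" for f x
      proof -
        have "norm (complex_of_real (x $ j) * L f x + K f x) \<le> (1 + norm x) * norm (L f x) + norm (K f x)"
          by (rule order_trans[OF norm_triangle_ineq])
            (auto simp: norm_mult intro!: mult_right_mono order_trans[OF component_le_norm_cart])
        then have "(1 + norm x) ^ N * norm (complex_of_real (x $ j) * L f x + K f x)
          \<le> (1 + norm x) ^ N * ((1 + norm x) * norm (L f x) + norm (K f x))"
          by (rule mult_left_mono) auto
        also have "\<dots> = (1 + norm x) ^ Suc N * norm (L f x) + (1 + norm x) ^ N * norm (K f x)"
          by (simp add: algebra_simps)
        also have "\<dots> \<le> q f + r f" using q r f by (intro add_mono) auto
        finally show ?thesis .
      qed
      then show ?thesis
        using q r by (intro exI[of _ "\<lambda>f. q f + r f"]) (auto intro!: seminorm_bounded_add)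
    qed
  qed
qed

lemma schwartz_op_sum:
  "finite I \<Longrightarrow> (\<And>i. i \<in> I \<Longrightarrow> schwartz_op (L i)) \<Longrightarrow> schwartz_op (\<lambda>f x. \<Sum>i\<in>I. L i f x)"
proof (induction I rule: finite_induct)
  case empty
  show ?case using schwartz_op_cmult[OF schwartz_op_id, of 0] by simp
next
  case (insert i I)
  then show ?case by (simp add: schwartz_op_add)
qed

lemma schwartz_op_polynomial:
  fixes p :: "real^'n::finite \<Rightarrow> real"
  assumes "real_polynomial_function p"
  shows "schwartz_op L \<Longrightarrow> schwartz_op (\<lambda>f x. complex_of_real (p x) * L f x)"
  using assms
proof (induction p arbitrary: L)
  case (linear p)
  have p_eq: "p x = (\<Sum>i\<in>UNIV. x $ i * p (axis i 1))" for x
  proof -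
    interpret bounded_linear p by fact
    have "p x = p (\<Sum>i\<in>UNIV. x $ i *\<^sub>R axis i 1)"
      using basis_expansion[of x] by (simp add: scalar_mult_eq_scaleR)
    then show ?thesis by (simp add: sum scaleR)
  qed
  have "(\<lambda>f x. complex_of_real (p x) * L f x) =
     (\<lambda>f x. \<Sum>i\<in>UNIV. complex_of_real (p (axis i 1)) * (complex_of_real (x $ i) * L f x))"
    by (intro ext, subst p_eq) (simp add: sum_distrib_right sum_distrib_left mult_ac)
  then show ?case
    using linear by (auto intro!: schwartz_op_sum schwartz_op_cmult schwartz_op_coordinate)
next
  case (const c)
  then show ?case by (rule schwartz_op_cmult)
next
  case (add f g)
  show ?case using schwartz_op_add[OF add(3)[OF add(5)] add(4)[OF add(5)]]
    by (simp add: distrib_right)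
next
  case (mult f g)
  show ?case using mult(3)[OF mult(4)[OF mult(5)]] by (simp add: mult.assoc)
qed

lemma partials_add:
  assumes "f \<in> schwartz" "g \<in> schwartz"
  shows "partials js (\<lambda>x. f x + g x) = (\<lambda>x. partials js f x + partials js g x)"
proof (induction js)
  case (Cons i js)
  have "frechet_derivative (\<lambda>x. partials js f x + partials js g x) (at x) =
    (\<lambda>h. frechet_derivative (partials js f) (at x) h + frechet_derivative (partials js g) (at x) h)" for x
    using assms[THEN schwartz_differentiable]
    by (intro frechet_derivative_at[symmetric] has_derivative_add) (auto simp: frechet_derivative_works)
  then show ?case using Cons by simp
qed simp

lemma partials_cmult:
  assumes "f \<in> schwartz"
  shows "partials js (\<lambda>x. c * f x) = (\<lambda>x. c * partials js f x)"
proof (induction js)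
  case (Cons i js)
  have "frechet_derivative (\<lambda>x. c * partials js f x) (at x) =
    (\<lambda>h. c * frechet_derivative (partials js f) (at x) h)" for x
    using schwartz_differentiable[OF assms]
    by (intro frechet_derivative_at[symmetric] has_derivative_mult_right) (auto simp: frechet_derivative_works)
  then show ?case using Cons by simp
qed simp

lemma schwartz_add:
  assumes "f \<in> schwartz" "g \<in> schwartz"
  shows "(\<lambda>x. f x + g x) \<in> schwartz"
proof -
  have "(1 + norm x) ^ N * norm (partials js f x + partials js g x)
      \<le> schwartz_seminorm N js f + schwartz_seminorm N js g" for N js x
    using schwartz_seminorm_upper[OF assms(1), of x N js] schwartz_seminorm_upper[OF assms(2), of x N js]
      mult_left_mono[OF norm_triangle_ineq[of "partials js f x" "partials js g x"], of "(1 + norm x) ^ N"]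
    by (simp add: distrib_left)
  then show ?thesis
    using assms[THEN schwartz_differentiable] unfolding schwartz_def
    by (auto simp: partials_add[OF assms] intro!: bdd_aboveI)
qed

lemma schwartz_cmult: "f \<in> schwartz \<Longrightarrow> (\<lambda>x. c * f x) \<in> schwartz"
  using schwartz_opD[OF schwartz_op_cmult[OF schwartz_op_id, of c]] .

text \<open>The preimage of an open set contains, around each of its points, the intersection of the finitely
many subbasic seminorm balls that occur in the bound, with a radius small enough to absorb the
constant and the number of seminorms.\<close>

lemma tempered_distributionI:
  fixes T :: "(real^'n::finite \<Rightarrow> complex) \<Rightarrow> complex"
  assumes add: "\<And>f g. f \<in> schwartz \<Longrightarrow> g \<in> schwartz \<Longrightarrow> T (\<lambda>x. f x + g x) = T f + T g"
    and scale: "\<And>c f. f \<in> schwartz \<Longrightarrow> T (\<lambda>x. c * f x) = c * T f"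
    and bound: "seminorm_bounded (\<lambda>f. norm (T f))"
  shows "tempered_distribution T"
proof -
  obtain A C where A: "finite A" "0 \<le> C"
    and q: "\<And>f. f\<in>schwartz \<Longrightarrow> norm (T f) \<le> C * (\<Sum>(N,js)\<in>A. schwartz_seminorm N js f)"
    using bound unfolding seminorm_bounded_def by blast
  let ?B = "{{g \<in> schwartz. schwartz_seminorm N js (\<lambda>x. g x - f x) < e} | f N js e. (f::real^'n\<Rightarrow>complex) \<in>
      schwartz \<and> e > 0}"
  have diff: "(\<lambda>x. g x - f x) \<in> schwartz" "T (\<lambda>x. g x - f x) = T g - T f"
    if "f \<in> schwartz" "g \<in> schwartz" for f g
    using schwartz_add[OF that(2) schwartz_cmult[OF that(1)], of "-1"]
      add[OF that(2) schwartz_cmult[OF that(1)], of "-1"] scale[OF that(1), of "-1"] by auto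
  have zero: "schwartz_seminorm N js (\<lambda>x. f x - f x) = 0" if "f \<in> schwartz" for N js and f :: "real^'n \<Rightarrow> complex"
  proof -
    have "partials js (\<lambda>x::real^'n. 0::complex) = (\<lambda>x. 0)" for js
      by (induction js) (auto simp: frechet_derivative_const)
    then show ?thesis by (simp add: schwartz_seminorm_def)
  qed
  have top: "topspace (schwartz_topology :: (real^'n \<Rightarrow> complex) topology) = schwartz"
  proof -
    have "f \<in> \<Union>?B" if "f \<in> schwartz" for f
    proof (rule UnionI)
      show "{g \<in> schwartz. schwartz_seminorm 0 [] (\<lambda>x. g x - f x) < 1} \<in> ?B"
        using that by (intro CollectI exI[of _ f] exI[of _ "0::nat"] exI[of _ "[]"] exI[of _ "1::real"]) auto
      show "f \<in> {g \<in> schwartz. schwartz_seminorm 0 [] (\<lambda>x. g x - f x) < 1}"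
        using that zero[OF that] by simp
    qed
    then show ?thesis unfolding schwartz_topology_def topology_generated_by_topspace by blast
  qed
  have basic: "openin schwartz_topology {g \<in> schwartz. schwartz_seminorm N js (\<lambda>x. g x - f x) < e}"
    if "f \<in> schwartz" "e > 0" for f :: "real^'n \<Rightarrow> complex" and N js e
    unfolding schwartz_topology_def by (rule topology_generated_by_Basis) (use that in blast)
  have "continuous_map schwartz_topology euclidean T"
    unfolding continuous_map_def top
  proof (intro conjI allI impI)
    fix U :: "complex set" assume "openin euclidean U"
    then have U: "open U" by simp
    show "openin schwartz_topology {f \<in> schwartz. T f \<in> U}"
    proof (subst openin_subopen, intro ballI)
      fix f assume f: "f \<in> {f \<in> schwartz. T f \<in> U}"
      then obtain e where e: "e > 0" "ball (T f) e \<subseteq> U"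
        using U openE by (metis (mono_tags, lifting) mem_Collect_eq)
      \<comment> \<open>The radius leaves room for the \<open>card A\<close> seminorms and the constant \<open>C\<close>; adding \<open>1\<close> to both
      keeps it positive when they are \<open>0\<close>.\<close>
      define d where "d = e / ((C + 1) * (real (card A) + 1))"
      have d: "d > 0" using e A by (auto simp: d_def intro!: divide_pos_pos mult_pos_pos)
      \<comment> \<open>The factor \<open>topspace\<close> covers an empty set of seminorms, whose intersection is everything.\<close>
      define V where "V = topspace (schwartz_topology :: (real^'n \<Rightarrow> complex) topology) \<inter>
         (\<Inter>(N,js)\<in>A. {g \<in> schwartz. schwartz_seminorm N js (\<lambda>x. g x - f x) < d})"
      have "openin schwartz_topology V"
      proof (cases "A = {}")
        case True
        then show ?thesis by (simp add: V_def)
      next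
        case False
        then show ?thesis
          using A f d unfolding V_def by (intro openin_Int openin_topspace openin_Inter) (auto intro: basic)
      qed
      moreover have "f \<in> V" using f d zero unfolding V_def top by auto
      moreover have "V \<subseteq> {f \<in> schwartz. T f \<in> U}"
      proof
        fix g assume g: "g \<in> V"
        then have gs: "g \<in> schwartz" by (simp add: V_def top)
        have "norm (T g - T f) \<le> C * (\<Sum>(N,js)\<in>A. schwartz_seminorm N js (\<lambda>x. g x - f x))"
          using q[of "\<lambda>x. g x - f x"] diff[of f g] f gs by auto
        also have "\<dots> \<le> C * (\<Sum>a\<in>A. d)"
          using A g by (intro mult_left_mono sum_mono) (auto simp: V_def split: prod.split intro!: less_imp_le)
        also have "\<dots> = C * (card A * d)" by simp
        also have "\<dots> < C * (card A * d) + (C * d + card A * d + d)"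
          using A(2) d by (intro less_add_same_cancel1[THEN iffD2] add_nonneg_pos add_nonneg_nonneg
              mult_nonneg_nonneg) auto
        also have "\<dots> = (C + 1) * (real (card A) + 1) * d" by (simp add: algebra_simps)
        also have "\<dots> = e"
        proof -
          have "C + 1 \<noteq> 0" using A(2) by auto
          then show ?thesis by (simp add: d_def)
        qed
        finally have "T g \<in> ball (T f) e" by (simp add: dist_norm norm_minus_commute)
        then show "g \<in> {f \<in> schwartz. T f \<in> U}" using e gs by auto
      qed
      ultimately show "\<exists>T'. openin schwartz_topology T' \<and> f \<in> T' \<and> T' \<subseteq> {f \<in> schwartz. T f \<in> U}"
        by blast
    qed
  qed auto
  then show ?thesis using add scale by (auto simp: tempered_distribution_def)
qed

section \<open>Polar coordinates\<close>

lemma nn_integral_lborel_scaleR: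
  fixes G :: "'a::euclidean_space \<Rightarrow> ennreal"
  assumes [measurable]: "G \<in> borel_measurable borel" and "0 < c"
  shows "(\<integral>\<^sup>+x. G (c *\<^sub>R x) \<partial>lborel) = ennreal (1 / c ^ DIM('a)) * (\<integral>\<^sup>+x. G x \<partial>lborel)"
proof -
  have "(\<integral>\<^sup>+x. G x \<partial>lborel) = ennreal (c ^ DIM('a)) * (\<integral>\<^sup>+x. G (c *\<^sub>R x) \<partial>lborel)"
    using assms(2)
    by (subst lborel_affine[of c 0])
      (simp_all add: nn_integral_density nn_integral_distr nn_integral_cmult)
  then have "ennreal (1 / c ^ DIM('a)) * (\<integral>\<^sup>+x. G x \<partial>lborel)
    = (ennreal (1 / c ^ DIM('a)) * ennreal (c ^ DIM('a))) * (\<integral>\<^sup>+x. G (c *\<^sub>R x) \<partial>lborel)"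
    by (simp add: mult.assoc)
  also have "ennreal (1 / c ^ DIM('a)) * ennreal (c ^ DIM('a)) = 1"
    using assms(2) by (simp flip: ennreal_mult)
  finally show ?thesis by simp
qed

lemma space_sphere_measure [simp]: "space sphere_measure = sphere 0 1"
  by (simp add: sphere_measure_def space_scale_measure)

lemma sets_sphere_measure [measurable_cong]: "sets sphere_measure = sets (restrict_space borel (sphere 0 1))"
  by (simp add: sphere_measure_def)

lemma borel_measurable_sphere_measure:
  "f \<in> borel_measurable borel \<Longrightarrow> f \<in> borel_measurable sphere_measure"
  by (simp add: measurable_cong_sets[OF sets_sphere_measure refl] measurable_restrict_space1)

lemma measurable_sphere_measure_ident: "(\<lambda>x. x) \<in> borel_measurable sphere_measure"
  by (rule borel_measurable_sphere_measure) simp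

lemma nn_integral_sphere_measure:
  fixes F :: "real^'n::finite \<Rightarrow> ennreal"
  assumes [measurable]: "F \<in> borel_measurable borel"
  shows "(\<integral>\<^sup>+\<theta>. F \<theta> \<partial>sphere_measure) =
    of_nat CARD('n) * (\<integral>\<^sup>+x. F (x /\<^sub>R norm x) * indicator (cball 0 1 - {0}) x \<partial>lborel)"
proof -
  have m: "(\<lambda>x::real^'n. x /\<^sub>R norm x) \<in> restrict_space lborel (cball 0 1 - {0}) \<rightarrow>\<^sub>M restrict_space borel
      (sphere 0 1)"
    by (intro measurable_restrict_space2 measurable_restrict_space1) (auto simp: space_restrict_space)
  have F: "F \<in> borel_measurable (restrict_space borel (sphere 0 1))"
    by (intro measurable_restrict_space1) simp
  show ?thesis
    unfolding sphere_measure_def using F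
    by (subst nn_integral_scale_measure; simp add: nn_integral_distr[OF m] nn_integral_restrict_space)
qed

lemma finite_measure_sphere_measure: "finite_measure (sphere_measure :: (real^'n::finite) measure)"
proof
  have "emeasure sphere_measure (space (sphere_measure :: (real^'n) measure)) =
      (\<integral>\<^sup>+\<theta>. 1 \<partial>(sphere_measure :: (real^'n) measure))"
    by simp
  also have "\<dots> = of_nat CARD('n) * emeasure lborel (cball 0 1 - {0::real^'n})"
    by (subst nn_integral_sphere_measure) auto
  also have "\<dots> \<noteq> \<infinity>"
    using emeasure_bounded_finite[OF bounded_diff[OF bounded_cball], of "0::real^'n" 1 "{0}"]
    by (auto simp: ennreal_mult_eq_top_iff)
  finally show "emeasure sphere_measure (space (sphere_measure :: (real^'n) measure)) \<noteq> \<infinity>" .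
qed

interpretation sphere_measure: finite_measure "sphere_measure :: (real^'n::finite) measure"
  by (rule finite_measure_sphere_measure)

lemma nn_integral_power_tail:
  assumes "0 < a" "0 < n"
  shows "(\<integral>\<^sup>+s. ennreal (1 / s ^ Suc n) * indicator {a..} s \<partial>lborel) = ennreal (1 / (real n * a ^ n))"
proof -
  have "(\<integral>\<^sup>+s. ennreal (1 / s ^ Suc n) * indicator {a..} s \<partial>lborel) = ennreal (0 - (- (1 / real n) * inverse a ^ n))"
  proof (rule nn_integral_FTC_atLeast[where F = "\<lambda>s. - (1 / real n) * inverse s ^ n"])
    show "DERIV (\<lambda>s. - (1 / real n) * inverse s ^ n) s :> 1 / s ^ Suc n" if "a \<le> s" for s
    proof -
      obtain m where m: "n = Suc m" using assms(2) by (cases n) auto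
      have "DERIV (\<lambda>s. - (1 / real n) * inverse s ^ n) s :>
          - (1 / real n) * (real n * (- (inverse s * 1 * inverse s) * inverse s ^ (n - Suc 0)))"
        using that assms by (intro DERIV_cmult DERIV_power DERIV_inverse' DERIV_ident) auto
      also have "- (1 / real n) * (real n * (- (inverse s * 1 * inverse s) * inverse s ^ (n - Suc 0))) =
          1 / s ^ Suc n"
        using that assms unfolding m by (simp add: field_simps)
      finally show ?thesis .
    qed
    show "((\<lambda>s. - (1 / real n) * inverse s ^ n) \<longlongrightarrow> 0) at_top"
      using assms(2) tendsto_power[OF tendsto_inverse_0_at_top[OF filterlim_ident], of n]
      by (intro tendsto_mult_right_zero) (simp add: power_0_left)
  qed (use assms in auto)
  then show ?thesis by (simp add: field_simps)
qed

text \<open>The surface measure is a cone measure, so the integral over the sphere is itself an integral over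
the unit ball, and the formula is a Tonelli computation.  For fixed \<open>x\<close> in the ball one substitutes
\<open>r = s |x|\<close>, which turns \<open>G (r x / |x|)\<close> into \<open>G (s x)\<close>; then for fixed \<open>s\<close> one substitutes \<open>y = s x\<close>.
What remains in front of \<open>G y\<close> is \<open>n |y|\<^sup>n\<close> times the integral of \<open>s\<^sup>-\<^sup>n\<^sup>-\<^sup>1\<close> over \<open>s \<ge> |y|\<close>, and this
product is \<open>1\<close>.\<close>

lemma nn_integral_polar:
  fixes G :: "real^'n::finite \<Rightarrow> ennreal"
  assumes [measurable]: "G \<in> borel_measurable borel"
  shows "(\<integral>\<^sup>+r. ennreal (r ^ (CARD('n) - 1)) * (\<integral>\<^sup>+\<theta>. G (r *\<^sub>R \<theta>) \<partial>sphere_measure)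
      \<partial>restrict_space lborel {0..}) = (\<integral>\<^sup>+x. G x \<partial>lborel)"
proof -
  define n where "n = CARD('n)"
  have n: "n > 0" by (simp add: n_def)
  define B where "B = cball 0 1 - {0::real^'n}"
  have [measurable]: "B \<in> sets borel" by (simp add: B_def)
  let ?w = "\<lambda>r::real. ennreal (r ^ (n - 1)) * indicator {0<..} r"
  let ?i = "\<lambda>x r. of_nat n * (?w r * (G (r *\<^sub>R (x /\<^sub>R norm x)) * indicator B x))"
  let ?j = "\<lambda>x s. of_nat n * (?w s * (ennreal (norm x ^ n) * indicator B x * G (s *\<^sub>R x)))"
  let ?k = "\<lambda>y s. of_nat n * (indicator {0<..} s * (ennreal
      (1 / s ^ Suc n) * (ennreal (norm y ^ n) * indicator B (y /\<^sub>R s) * G y)))"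
  have "(\<integral>\<^sup>+r. ennreal (r ^ (n - 1)) * (\<integral>\<^sup>+\<theta>. G (r *\<^sub>R \<theta>) \<partial>sphere_measure) \<partial>restrict_space lborel {0..})
    = (\<integral>\<^sup>+r. ennreal (r ^ (n - 1)) * (\<integral>\<^sup>+\<theta>. G (r *\<^sub>R \<theta>) \<partial>sphere_measure) * indicator {0..} r \<partial>lborel)"
    by (rule nn_integral_restrict_space) auto
  \<comment> \<open>The origin is removed so that \<open>s\<close> can be inverted below.\<close>
  also have "\<dots> = (\<integral>\<^sup>+r. ?w r * (\<integral>\<^sup>+\<theta>. G (r *\<^sub>R \<theta>) \<partial>sphere_measure) \<partial>lborel)"
    by (intro nn_integral_cong_AE AE_I[where N="{0}"]) (auto simp: indicator_def split: if_splits)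
  also have "\<dots> = (\<integral>\<^sup>+r. (\<integral>\<^sup>+x. ?i x r \<partial>lborel) \<partial>lborel)"
  proof (rule nn_integral_cong)
    fix r :: real
    let ?K = "\<lambda>x. G (r *\<^sub>R (x /\<^sub>R norm x)) * indicator B x"
    have "(\<integral>\<^sup>+\<theta>. G (r *\<^sub>R \<theta>) \<partial>sphere_measure) = of_nat n * (\<integral>\<^sup>+x. ?K x \<partial>lborel)"
      unfolding n_def B_def by (rule nn_integral_sphere_measure) simp
    moreover have "(\<integral>\<^sup>+x. of_nat n * (?w r * ?K x) \<partial>lborel) = of_nat n * (?w r * (\<integral>\<^sup>+x. ?K x \<partial>lborel))"
      by (subst nn_integral_cmult, simp, subst nn_integral_cmult, simp_all)
    ultimately show "?w r * (\<integral>\<^sup>+\<theta>. G (r *\<^sub>R \<theta>) \<partial>sphere_measure) = (\<integral>\<^sup>+x. of_nat n * (?w r * ?K x) \<partial>lborel)"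
      by (simp only: mult_ac)
  qed
  also have "\<dots> = (\<integral>\<^sup>+x. (\<integral>\<^sup>+r. ?i x r \<partial>lborel) \<partial>lborel)"
    by (rule lborel_pair.Fubini') (simp add: split_beta')
  also have "\<dots> = (\<integral>\<^sup>+x. (\<integral>\<^sup>+s. ?j x s \<partial>lborel) \<partial>lborel)"
  proof (rule nn_integral_cong)
    fix x :: "real^'n"
    show "(\<integral>\<^sup>+r. ?i x r \<partial>lborel) = (\<integral>\<^sup>+s. ?j x s \<partial>lborel)"
    proof (cases "x = 0")
      case True
      then show ?thesis by (simp add: B_def)
    next
      case False
      then have "(\<integral>\<^sup>+r. ?i x r \<partial>lborel)
        = ennreal (norm x) * (\<integral>\<^sup>+s. of_nat n * (?w (norm x * s) * (G ((norm x * s) *\<^sub>R (x /\<^sub>R norm x)) * indicator B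
            x)) \<partial>lborel)"
        \<comment> \<open>substitution \<open>r = |x| s\<close>\<close>
        by (subst nn_integral_real_affine[where c="norm x" and t=0]) auto
      also have "\<dots> = (\<integral>\<^sup>+s. ennreal (norm x) * (of_nat n * (?w
          (norm x * s) * (G ((norm x * s) *\<^sub>R (x /\<^sub>R norm x)) * indicator B x))) \<partial>lborel)"
        by (rule nn_integral_cmult[symmetric]) simp
      also have "\<dots> = (\<integral>\<^sup>+s. ?j x s \<partial>lborel)"
      proof (rule nn_integral_cong)
        fix s :: real
        have e1: "?w (norm x * s) = ennreal (norm x ^ (n - 1)) * ?w s"
          using False by (auto simp: indicator_def zero_less_mult_iff power_mult_distrib ennreal_mult)
        have e2: "ennreal (norm x) * ennreal (norm x ^ (n - 1)) = ennreal (norm x ^ n)"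
          using n by (simp flip: ennreal_mult power_Suc)
        have e3: "(norm x * s) *\<^sub>R (x /\<^sub>R norm x) = s *\<^sub>R x" using False by simp
        show "ennreal (norm x) * (of_nat n * (?w (norm x * s) * (G ((norm x * s) *\<^sub>R (x /\<^sub>R norm x)) * indicator B
            x)))
          = ?j x s"
          unfolding e1 e3 e2[symmetric] by (simp only: mult_ac)
      qed
      finally show ?thesis .
    qed
  qed
  also have "\<dots> = (\<integral>\<^sup>+s. (\<integral>\<^sup>+x. ?j x s \<partial>lborel) \<partial>lborel)"
    by (rule lborel_pair.Fubini') (simp add: split_beta')
  also have "\<dots> = (\<integral>\<^sup>+s. (\<integral>\<^sup>+y. ?k y s \<partial>lborel) \<partial>lborel)"
  proof (rule nn_integral_cong)
    fix s :: real
    show "(\<integral>\<^sup>+x. ?j x s \<partial>lborel) = (\<integral>\<^sup>+y. ?k y s \<partial>lborel)"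
    proof (cases "s > 0")
      case True
      let ?H = "\<lambda>y. of_nat n * (ennreal (s ^ (n - 1)) * (ennreal (norm (y /\<^sub>R s) ^ n) * indicator B (y /\<^sub>R s) * G y))"
      have "(\<integral>\<^sup>+x. ?j x s \<partial>lborel) = (\<integral>\<^sup>+x. ?H (s *\<^sub>R x) \<partial>lborel)"
        using True by (intro nn_integral_cong) simp
      \<comment> \<open>substitution \<open>y = s x\<close>\<close>
      also have "\<dots> = (\<integral>\<^sup>+y. ennreal (1 / s ^ n) * ?H y \<partial>lborel)"
        using True by (subst nn_integral_lborel_scaleR) (auto simp: nn_integral_cmult n_def)
      also have "\<dots> = (\<integral>\<^sup>+y. ?k y s \<partial>lborel)"
      proof (rule nn_integral_cong)
        fix y :: "real^'n"
        have "ennreal (1 / s ^ n) * (ennreal (s ^ (n - 1)) * ennreal (norm (y /\<^sub>R s) ^ n)) =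
            ennreal (1 / s ^ Suc n) * ennreal (norm y ^ n)"
        proof -
          obtain m where m: "n = Suc m" using n by (cases n) auto
          show ?thesis using True unfolding m
            by (simp flip: ennreal_mult) (simp add: field_simps)
        qed
        then have "ennreal (1 / s ^ n) * (ennreal (s ^ (n - 1)) * ennreal (norm (y /\<^sub>R s) ^ n)) * (of_nat
            n * (indicator B (y /\<^sub>R s) * G y))
           = ennreal (1 / s ^ Suc n) * ennreal (norm y ^ n) * (of_nat n * (indicator B (y /\<^sub>R s) * G y))"
          by simp
        then show "ennreal (1 / s ^ n) * ?H y = ?k y s"
          using True by (simp add: mult_ac)
      qed
      finally show ?thesis .
    qed simp
  qed
  also have "\<dots> = (\<integral>\<^sup>+y. (\<integral>\<^sup>+s. ?k y s \<partial>lborel) \<partial>lborel)"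
    by (rule lborel_pair.Fubini') (simp add: split_beta')
  also have "\<dots> = (\<integral>\<^sup>+y. G y \<partial>lborel)"
  proof (rule nn_integral_cong_AE, use AE_lborel_singleton[of "0::real^'n"] in eventually_elim)
    fix y :: "real^'n" assume y0: "y \<noteq> 0"
    have "(\<integral>\<^sup>+s. ?k y s \<partial>lborel)
       = (\<integral>\<^sup>+s. of_nat n * ennreal (norm y ^ n) * G y * (ennreal (1 / s ^ Suc n) * indicator {norm y..} s) \<partial>lborel)"
    proof (rule nn_integral_cong)
      fix s :: real
      have "indicator {0<..} s * indicator B (y /\<^sub>R s) = (indicator {norm y..} s :: ennreal)"
      proof (cases "0 < s")
        case True
        then have "y /\<^sub>R s \<in> B \<longleftrightarrow> norm y \<le> s"
          using y0 by (simp add: B_def field_simps)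
        then show ?thesis using True by (simp add: indicator_def)
      next
        case False
        moreover have "0 < norm y" using y0 by simp
        ultimately have "\<not> norm y \<le> s" by linarith
        then show ?thesis using False by simp
      qed
      then have "of_nat n * (ennreal (1 / s ^ Suc n) * (ennreal (norm y ^ n) * G y)) * (indicator {0<..}
          s * indicator B (y /\<^sub>R s))
        = of_nat n * (ennreal (1 / s ^ Suc n) * (ennreal (norm y ^ n) * G y)) * indicator {norm y..} s"
        by simp
      then show "?k y s
        = of_nat n * ennreal (norm y ^ n) * G y * (ennreal (1 / s ^ Suc n) * indicator {norm y..} s)"
        by (simp only: mult_ac)
    qed
    also have "\<dots> = of_nat n * ennreal (norm y ^ n) * G y * ennreal (1 / (real n * norm y ^ n))"
      using y0 n nn_integral_power_tail[of "norm y" n] by (subst nn_integral_cmult) (auto simp del: power_Suc)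
    also have "\<dots> = (ennreal (real n) * ennreal (norm y ^ n) * ennreal (1 / (real n * norm y ^ n))) * G y"
      by (simp add: mult_ac flip: ennreal_of_nat_eq_real_of_nat)
    also have "ennreal (real n) * ennreal (norm y ^ n) * ennreal (1 / (real n * norm y ^ n)) = 1"
      using y0 n by (simp flip: ennreal_mult)
    finally show "(\<integral>\<^sup>+s. ?k y s \<partial>lborel) = G y"
      by simp
  qed
  finally show ?thesis by (simp add: n_def)
qed

abbreviation polar_measure :: "(real \<times> (real^'n::finite)) measure" where
  "polar_measure \<equiv> restrict_space lborel {0..} \<Otimes>\<^sub>M sphere_measure"

lemma sigma_finite_halfline: "sigma_finite_measure (restrict_space lborel {0::real..})"
  by (rule sigma_finite_measure_restrict_space) (auto intro: lborel.sigma_finite_measure_axioms)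

interpretation polar: pair_sigma_finite "restrict_space lborel {0::real..}"
    "sphere_measure :: (real^'n::finite) measure"
  by (intro pair_sigma_finite.intro sigma_finite_halfline sphere_measure.sigma_finite_measure_axioms)

lemma measurable_polar_map [measurable]:
  "(\<lambda>(r, \<theta>). r *\<^sub>R \<theta>) \<in> borel_measurable (polar_measure :: (real \<times> (real^'n::finite)) measure)"
proof -
  have [measurable]: "fst \<in> borel_measurable (polar_measure :: (real \<times> (real^'n)) measure)"
    "snd \<in> borel_measurable (polar_measure :: (real \<times> (real^'n)) measure)"
    using measurable_compose[OF measurable_fst measurable_restrict_space1[OF measurable_ident_sets[OF sets_lborel]]]
      measurable_compose[OF measurable_snd measurable_sphere_measure_ident] by auto
  show ?thesis by (simp add: split_beta')
qed

lemma measurable_polar_fst [measurable]: "fst \<in> borel_measurable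
    (polar_measure :: (real \<times> (real^'n::finite)) measure)"
  by (rule measurable_compose[OF measurable_fst measurable_restrict_space1[OF measurable_ident_sets[OF sets_lborel]]])

text \<open>As an identity of measures the polar formula transfers at once from nonnegative functions to
vector-valued integrable ones.\<close>

lemma lborel_polar:
  "lborel = distr (density polar_measure (\<lambda>(r, \<theta>). ennreal (r ^ (CARD('n) - 1))))
     borel (\<lambda>(r, \<theta>). r *\<^sub>R \<theta> :: real^'n::finite)" (is "_ = ?D")
proof (rule measure_eqI)
  fix A :: "(real^'n) set" assume "A \<in> sets lborel"
  then have [measurable]: "A \<in> sets borel" by simp
  have "emeasure ?D A = (\<integral>\<^sup>+x. indicator A x \<partial>?D)"
    by (subst nn_integral_indicator) auto
  also have "\<dots> = (\<integral>\<^sup>+z. ennreal (fst z ^ (CARD('n) - 1)) * indicator A (fst z *\<^sub>R snd z) \<partial>polar_measure)"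
    by (subst nn_integral_distr; simp add: split_beta' nn_integral_density)
  also have "\<dots> = (\<integral>\<^sup>+r. (\<integral>\<^sup>+\<theta>. ennreal (r ^ (CARD('n) - 1)) * indicator A (r *\<^sub>R \<theta>) \<partial>sphere_measure) \<partial>restrict_space
      lborel {0..})"
    by (subst sphere_measure.nn_integral_fst[symmetric]) auto
  also have "\<dots> = (\<integral>\<^sup>+r. ennreal (r ^ (CARD('n) - 1)) * (\<integral>\<^sup>+\<theta>. indicator A (r *\<^sub>R \<theta>) \<partial>sphere_measure) \<partial>restrict_space
      lborel {0..})"
    by (intro nn_integral_cong nn_integral_cmult borel_measurable_sphere_measure) auto
  also have "\<dots> = emeasure lborel A" by (subst nn_integral_polar) auto
  finally show "emeasure lborel A = emeasure ?D A" by simp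
qed simp

lemma
  fixes G :: "real^'n::finite \<Rightarrow> 'b::{banach, second_countable_topology}"
  assumes "integrable lborel G"
  shows integrable_polar: "integrable polar_measure (\<lambda>(r, \<theta>). (r ^ (CARD('n) - 1)) *\<^sub>R G (r *\<^sub>R \<theta>))"
    and integral_polar: "(LINT (r, \<theta>)|polar_measure. (r ^ (CARD('n) - 1)) *\<^sub>R G (r *\<^sub>R \<theta>)) = (LINT x|lborel. G x)"
proof -
  have [measurable]: "G \<in> borel_measurable borel" using assms by auto
  have ae: "AE z in (polar_measure :: (real \<times> (real^'n)) measure). 0 \<le> fst z ^ (CARD('n) - 1)"
    by (rule AE_I2) (auto simp: space_pair_measure space_restrict_space)
  have m: "(\<lambda>z. fst z *\<^sub>R snd z) \<in> density polar_measure (\<lambda>z. ennreal (fst z ^ (CARD('n) - 1))) \<rightarrow>\<^sub>M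
      (borel :: (real^'n) measure)"
    using measurable_polar_map by (simp add: split_beta')
  have m': "(\<lambda>z. G (fst z *\<^sub>R snd z)) \<in> borel_measurable polar_measure"
    using measurable_compose[OF measurable_polar_map, of G] by (simp add: split_beta')
  show "integrable polar_measure (\<lambda>(r, \<theta>). (r ^ (CARD('n) - 1)) *\<^sub>R G (r *\<^sub>R \<theta>))"
    using assms unfolding lborel_polar split_beta'
    by (subst (asm) integrable_distr_eq[OF m], simp, subst (asm) integrable_density[OF m' _ ae]) simp_all
  show "(LINT (r, \<theta>)|polar_measure. (r ^ (CARD('n) - 1)) *\<^sub>R G (r *\<^sub>R \<theta>)) = (LINT x|lborel. G x)"
    unfolding lborel_polar split_beta'
    by (subst integral_distr[OF m], simp, subst integral_density[OF m' _ ae]) simp_all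
qed

section \<open>Integrability of powers of the norm\<close>

lemma nn_integral_inverse_square_tail:
  "(\<integral>\<^sup>+r. ennreal (1 / (1 + r)\<^sup>2) * indicator {0..} r \<partial>lborel) = 1"
proof -
  have "(\<integral>\<^sup>+r. ennreal (1 / (1 + r)\<^sup>2) * indicator {0..} r \<partial>lborel) = ennreal (0 - (- 1 / (1 + 0)))"
  proof (rule nn_integral_FTC_atLeast[where F = "\<lambda>s. - 1 / (1 + s)"])
    show "DERIV (\<lambda>s. - 1 / (1 + s)) s :> 1 / (1 + s)\<^sup>2" if "0 \<le> s" for s :: real
      using that by (auto intro!: derivative_eq_intros simp: power2_eq_square)
    show "((\<lambda>s::real. - 1 / (1 + s)) \<longlongrightarrow> 0) at_top"
      by (intro tendsto_divide_0[OF tendsto_const] filterlim_at_top_imp_at_infinity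
        filterlim_tendsto_add_at_top[OF tendsto_const] filterlim_ident)
  qed auto
  then show ?thesis by simp
qed

lemma integrable_halfline_inverse_square: "integrable (restrict_space lborel {0..}) (\<lambda>r::real. 1 / (1 + r)\<^sup>2)"
proof (rule integrableI_bounded)
  have "(\<integral>\<^sup>+r. ennreal (norm (1 / (1 + r)\<^sup>2)) \<partial>restrict_space lborel {0::real..}) = 1"
    by (subst nn_integral_restrict_space) (auto simp: nn_integral_inverse_square_tail)
  then show "(\<integral>\<^sup>+r. ennreal (norm (1 / (1 + r)\<^sup>2)) \<partial>restrict_space lborel {0::real..}) < \<infinity>" by simp
qed (intro measurable_restrict_space1, simp)

lemma integrable_polar_inverse_square:
  "integrable polar_measure (\<lambda>z::real \<times> (real^'n::finite). 1 / (1 + fst z)\<^sup>2)"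
proof (rule integrableI_bounded)
  let ?h = "\<lambda>r::real. ennreal (1 / (1 + r)\<^sup>2)"
  have h: "?h \<in> borel_measurable (restrict_space lborel {0..})"
    by (intro measurable_restrict_space1) simp
  have "(\<integral>\<^sup>+z. ennreal (norm (1 / (1 + fst z)\<^sup>2)) \<partial>(polar_measure :: (real \<times> (real^'n)) measure))
    = (\<integral>\<^sup>+r. (\<integral>\<^sup>+\<theta>. ?h r \<partial>(sphere_measure :: (real^'n) measure)) \<partial>restrict_space lborel {0..})"
    by (subst sphere_measure.nn_integral_fst[symmetric]) auto
  also have "\<dots> = (\<integral>\<^sup>+r. ?h r \<partial>restrict_space lborel {0..}) * emeasure sphere_measure (sphere 0 1 :: (real^'n) set)"
    using h by (simp add: nn_integral_multc)
  also have "(\<integral>\<^sup>+r. ?h r \<partial>restrict_space lborel {0..}) = 1"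
    by (subst nn_integral_restrict_space) (auto simp: nn_integral_inverse_square_tail)
  also have "1 * emeasure sphere_measure (sphere 0 1 :: (real^'n) set) < \<infinity>"
    using sphere_measure.emeasure_finite[where 'n='n] by (simp flip: less_top)
  finally show "(\<integral>\<^sup>+z. ennreal (norm (1 / (1 + fst z)\<^sup>2)) \<partial>(polar_measure :: (real \<times> (real^'n)) measure)) < \<infinity>" .
qed simp

text \<open>The weight with which Schwartz decay is turned into integrability: in polar coordinates
\<open>r\<^sup>n\<^sup>-\<^sup>1\<close> cancels all but two of the powers of \<open>1 + r\<close>.\<close>

lemma integrable_inverse_power_norm:
  "integrable lborel (\<lambda>x::real^'n::finite. 1 / (1 + norm x) ^ (CARD('n) + 1))"
proof (rule integrableI_bounded)
  let ?M = "\<lambda>r::real. \<integral>\<^sup>+\<theta>. ennreal (1 / (1 + r)\<^sup>2) \<partial>(sphere_measure :: (real^'n) measure)"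
  let ?L = "\<lambda>r. \<integral>\<^sup>+\<theta>. ennreal (norm (1 / (1 + norm (r *\<^sub>R \<theta> :: real^'n)) ^ (CARD('n) + 1))) \<partial>sphere_measure"
  have "(\<integral>\<^sup>+(x::real^'n). ennreal (norm (1 / (1 + norm x) ^ (CARD('n) + 1))) \<partial>lborel)
    = (\<integral>\<^sup>+r. ennreal (r ^ (CARD('n) - 1)) * ?L r
      \<partial>restrict_space lborel {0..})"
    by (rule nn_integral_polar[symmetric]) simp
  also have "\<dots> \<le> (\<integral>\<^sup>+r. ?M r \<partial>restrict_space lborel {0..})"
  proof (rule nn_integral_mono)
    fix r :: real assume "r \<in> space (restrict_space lborel {0..})"
    then have r: "0 \<le> r" by (simp add: space_restrict_space)
    have "ennreal (r ^ (CARD('n) - 1)) * ?L r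
      = ennreal (r ^ (CARD('n) - 1)) * (\<integral>\<^sup>+\<theta>. ennreal (1 / (1 + r) ^ (CARD('n) + 1))
          \<partial>(sphere_measure :: (real^'n) measure))"
      using r by (intro arg_cong2[where f="(*)"] nn_integral_cong) auto
    also have "\<dots> = (\<integral>\<^sup>+\<theta>. ennreal (r ^ (CARD('n) - 1)) * ennreal (1 / (1 + r) ^ (CARD('n) + 1))
        \<partial>(sphere_measure :: (real^'n) measure))"
      by (rule nn_integral_cmult[symmetric]) simp
    also have "\<dots> \<le> ?M r"
    proof (rule nn_integral_mono)
      have "r ^ (CARD('n) - 1) \<le> (1 + r) ^ (CARD('n) - 1)" using r by (intro power_mono) auto
      moreover have "(1 + r) ^ (CARD('n) + 1) = (1 + r) ^ (CARD('n) - 1) * (1 + r)\<^sup>2"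
        by (simp flip: power_add)
      ultimately have "r ^ (CARD('n) - 1) * (1 / (1 + r) ^ (CARD('n) + 1)) \<le> 1 / (1 + r)\<^sup>2"
        using r by (simp add: divide_simps mult_right_mono)
      then show "ennreal (r ^ (CARD('n) - 1)) * ennreal (1 / (1 + r) ^ (CARD('n) + 1)) \<le> ennreal (1 / (1 + r)\<^sup>2)"
        using r by (simp flip: ennreal_mult)
    qed
    finally show "ennreal (r ^ (CARD('n) - 1)) * ?L r
      \<le> ?M r" .
  qed
  also have "\<dots> = (\<integral>\<^sup>+z. ennreal (norm (1 / (1 + fst z)\<^sup>2)) \<partial>(polar_measure :: (real \<times> (real^'n)) measure))"
    by (subst sphere_measure.nn_integral_fst[symmetric]) auto
  also have "\<dots> < \<infinity>"
    using integrable_polar_inverse_square by (simp add: integrable_iff_bounded)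
  finally show "(\<integral>\<^sup>+(x::real^'n). ennreal (norm (1 / (1 + norm x) ^ (CARD('n) + 1))) \<partial>lborel) < \<infinity>" .
qed simp

section \<open>Differentiation under the integral sign\<close>

text \<open>The difference quotients converge pointwise by differentiability and are dominated by \<open>2 g\<close> by the
mean value inequality, so dominated convergence applies along every sequence.\<close>

lemma has_derivative_integral:
  fixes f :: "'a::euclidean_space \<Rightarrow> 'b \<Rightarrow> 'c::{banach, second_countable_topology}"
  assumes int: "\<And>x. integrable M (f x)"
    and der: "\<And>x y. y \<in> space M \<Longrightarrow> ((\<lambda>x. f x y) has_derivative f' x y) (at x)"
    and bound: "\<And>x y h. y \<in> space M \<Longrightarrow> norm (f' x y h) \<le> g y * norm h"
    and g: "integrable M g"
    and meas: "\<And>x h. (\<lambda>y. f' x y h) \<in> borel_measurable M"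
  shows "((\<lambda>x. LINT y|M. f x y) has_derivative (\<lambda>h. LINT y|M. f' x y h)) (at x)"
proof -
  let ?R = "\<lambda>z. (LINT y|M. f z y) - (LINT y|M. f x y) - (LINT y|M. f' x y (z - x))"
  have int': "integrable M (\<lambda>y. f' x y h)" for x h
    by (rule Bochner_Integration.integrable_bound[OF integrable_mult_left[OF g, of "norm h"]])
      (use meas bound in \<open>auto intro!: AE_I2 order_trans[OF _ abs_ge_self]\<close>)
  have lin: "linear (f' x y)" if "y \<in> space M" for x y
    using der[OF that] by (rule has_derivative_linear)
  have g0: "0 \<le> g y" if "y \<in> space M" for y
  proof -
    obtain b :: 'a where "b \<in> Basis" using nonempty_Basis by blast
    then show ?thesis using order_trans[OF norm_ge_zero bound[OF that, of x b]] by simp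
  qed
  \<comment> \<open>This is where the bound has to hold for all \<open>x\<close>: the mean value inequality compares distant
  points.\<close>
  have lip: "norm (f z y - f x y) \<le> g y * norm (z - x)" if "y \<in> space M" for z y
    using bound[OF that] g0[OF that]
    by (intro differentiable_bound[where S=UNIV and f'="\<lambda>x. f' x y"] der[OF that, THEN has_derivative_at_withinI]
        onorm_bound) auto
  show ?thesis
    unfolding has_derivative_iff_norm
  proof (intro conjI)
    show "bounded_linear (\<lambda>h. LINT y|M. f' x y h)"
    proof (rule bounded_linear_intro)
      show "(LINT y|M. f' x y (h + k)) = (LINT y|M. f' x y h) + (LINT y|M. f' x y k)" for h k
        by (subst Bochner_Integration.integral_add[symmetric, OF int' int'])
          (auto intro!: Bochner_Integration.integral_cong simp: linear_add[OF lin])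
      show "(LINT y|M. f' x y (c *\<^sub>R h)) = c *\<^sub>R (LINT y|M. f' x y h)" for c h
      proof -
        have "(LINT y|M. f' x y (c *\<^sub>R h)) = (LINT y|M. c *\<^sub>R f' x y h)"
          by (intro Bochner_Integration.integral_cong) (auto simp: linear_scale[OF lin])
        then show ?thesis by simp
      qed
      show "norm (LINT y|M. f' x y h) \<le> norm h * (LINT y|M. g y)" for h
      proof -
        have "norm (LINT y|M. f' x y h) \<le> (LINT y|M. norm (f' x y h))" by (rule integral_norm_bound)
        also have "\<dots> \<le> (LINT y|M. norm h * g y)"
          using bound by (intro integral_mono integrable_norm int' integrable_mult_right g) (auto simp: mult.commute)
        finally show ?thesis by simp
      qed
    qed
    show "((\<lambda>z. norm (?R z) / norm (z - x)) \<longlongrightarrow> 0) (at x)"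
      unfolding tendsto_at_iff_sequentially o_def
    proof (intro allI impI)
      fix X :: "nat \<Rightarrow> 'a" assume X: "\<forall>i. X i \<in> UNIV - {x}" "X \<longlonglongrightarrow> x"
      let ?q = "\<lambda>i y. norm (f (X i) y - f x y - f' x y (X i - x)) / norm (X i - x)"
      have qint: "integrable M (?q i)" for i
        using int int' by (intro integrable_divide_zero integrable_norm Bochner_Integration.integrable_diff) auto
      have lim: "(\<lambda>i. LINT y|M. ?q i y) \<longlonglongrightarrow> (LINT y|M. 0)"
      proof (rule integral_dominated_convergence[where w="\<lambda>y. 2 * g y"])
        show "AE y in M. (\<lambda>i. ?q i y) \<longlonglongrightarrow> 0"
        proof (rule AE_I2)
          fix y assume "y \<in> space M"
          then have "((\<lambda>z. norm (f z y - f x y - f' x y (z - x)) / norm (z - x)) \<longlongrightarrow> 0) (at x)"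
            using der unfolding has_derivative_iff_norm by blast
          then show "(\<lambda>i. ?q i y) \<longlonglongrightarrow> 0"
            using X unfolding tendsto_at_iff_sequentially o_def by blast
        qed
        show "AE y in M. norm (?q i y) \<le> 2 * g y" for i
        proof (rule AE_I2)
          fix y assume y: "y \<in> space M"
          have "norm (f (X i) y - f x y - f' x y (X i - x)) \<le> 2 * g y * norm (X i - x)"
            using norm_triangle_ineq4[of "f (X i) y - f x y" "f' x y (X i - x)"] lip[OF y, of "X i"]
                bound[OF y, of x "X i - x"] by linarith
          then show "norm (?q i y) \<le> 2 * g y"
            using X(1) by (simp add: divide_le_eq)
        qed
      qed (use g qint in auto)
      show "(\<lambda>i. norm (?R (X i)) / norm (X i - x)) \<longlonglongrightarrow> 0"
      proof (rule Lim_null_comparison)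
        show "(\<lambda>i. LINT y|M. ?q i y) \<longlonglongrightarrow> 0" using lim by simp
        show "\<forall>\<^sub>F i in sequentially. norm (norm (?R (X i)) / norm (X i - x)) \<le> (LINT y|M. ?q i y)"
        proof (rule always_eventually, rule allI)
          fix i
          have "?R (X i) = (LINT y|M. f (X i) y - f x y - f' x y (X i - x))"
            using int int' by simp
          then show "norm (norm (?R (X i)) / norm (X i - x)) \<le> (LINT y|M. ?q i y)"
            by (simp add: divide_right_mono integral_norm_bound)
        qed
      qed
    qed
  qed
qed

lemma has_vector_derivative_integral:
  fixes f :: "real \<Rightarrow> 'b \<Rightarrow> 'c::{banach, second_countable_topology}"
  assumes int: "\<And>x. integrable M (f x)"
    and der: "\<And>x y. y \<in> space M \<Longrightarrow> ((\<lambda>x. f x y) has_vector_derivative f' x y) (at x)"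
    and bound: "\<And>x y. y \<in> space M \<Longrightarrow> norm (f' x y) \<le> g y"
    and g: "integrable M g"
    and meas: "\<And>x. f' x \<in> borel_measurable M"
  shows "((\<lambda>x. LINT y|M. f x y) has_vector_derivative (LINT y|M. f' x y)) (at x)"
proof -
  have "((\<lambda>x. LINT y|M. f x y) has_derivative (\<lambda>h. LINT y|M. h *\<^sub>R f' x y)) (at x)"
    using assms by (intro has_derivative_integral[where g=g])
      (auto simp: has_vector_derivative_def mult.commute intro: mult_left_mono)
  then show ?thesis by (simp add: has_vector_derivative_def)
qed

section \<open>Gaussian integrals\<close>

lemma schwartz_norm_le:
  fixes f :: "real^'n::finite \<Rightarrow> complex"
  assumes "f \<in> schwartz"
  shows "norm (f x) \<le> schwartz_seminorm N [] f * (1 / (1 + norm x) ^ N)"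
proof -
  have "0 < (1 + norm x) ^ N" by (intro zero_less_power add_pos_nonneg) auto
  then show ?thesis
    using schwartz_seminorm_upper[OF assms, of x N "[]"] by (simp add: field_simps)
qed

lemma schwartz_integrable:
  fixes f :: "real^'n::finite \<Rightarrow> complex"
  assumes "f \<in> schwartz"
  shows "integrable lborel f"
proof (rule Bochner_Integration.integrable_bound)
  show "integrable lborel (\<lambda>x::real^'n. schwartz_seminorm (CARD('n) + 1) [] f * (1 / (1 + norm x) ^ (CARD('n) + 1)))"
    by (intro integrable_mult_right integrable_inverse_power_norm)
  show "AE x in lborel. norm (f x) \<le> norm (schwartz_seminorm (CARD('n) + 1) []
      f * (1 / (1 + norm x) ^ (CARD('n) + 1)))"
    by (rule AE_I2, rule order_trans[OF schwartz_norm_le[OF assms, of _ "CARD('n) + 1"]])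
        (simp only: real_norm_def abs_ge_self)
qed (use schwartz_borel[OF assms] in simp)

lemma schwartz_integral_norm_le:
  fixes f :: "real^'n::finite \<Rightarrow> complex"
  assumes "f \<in> schwartz"
  shows "(LINT x|lborel. norm (f x)) \<le>
    schwartz_seminorm (CARD('n) + 1) [] f * (LINT x::real^'n|lborel. 1 / (1 + norm x) ^ (CARD('n) + 1))"
proof -
  have "(LINT x|lborel. norm (f x)) \<le> (LINT x|lborel. schwartz_seminorm (CARD('n) + 1) []
      f * (1 / (1 + norm (x::real^'n)) ^ (CARD('n) + 1)))"
    by (intro integral_mono schwartz_norm_le integrable_norm schwartz_integrable assms
      integrable_mult_right integrable_inverse_power_norm)
  also have "\<dots> = schwartz_seminorm (CARD('n) + 1) [] f * (LINT x::real^'n|lborel. 1 / (1 + norm x) ^ (CARD('n) + 1))"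
    by (rule integral_mult_right_zero)
  finally show ?thesis .
qed

lemma integral_lborel_scaleR:
  fixes f :: "'a::euclidean_space \<Rightarrow> 'b::{banach, second_countable_topology}"
  assumes "f \<in> borel_measurable borel" "c \<noteq> 0"
  shows "(LINT x|lborel. f (c *\<^sub>R x)) = (1 / \<bar>c\<bar> ^ DIM('a)) *\<^sub>R (LINT x|lborel. f x)"
proof -
  have "(LINT x|lborel. f x) = \<bar>c\<bar> ^ DIM('a) *\<^sub>R (LINT x|lborel. f (c *\<^sub>R x))"
    using assms
    by (subst lborel_affine[of c 0]) (simp_all add: integral_density integral_distr)
  then show ?thesis using assms(2) by simp
qed

lemma
  fixes f :: "'a::euclidean_space \<Rightarrow> 'b::{banach, second_countable_topology}"
  assumes "integrable lborel f"
  shows integrable_lborel_translate: "integrable lborel (\<lambda>x. f (x + a))"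
    and integral_lborel_translate: "(LINT x|lborel. f (x + a)) = (LINT x|lborel. f x)"
proof -
  have [measurable]: "f \<in> borel_measurable borel" using assms by auto
  have eq: "lborel = distr lborel borel (\<lambda>x. x + a)"
  proof -
    have "(\<lambda>x. x + a) = (+) a" by (auto simp: add.commute)
    then show ?thesis by (simp add: lborel_distr_plus)
  qed
  show "integrable lborel (\<lambda>x. f (x + a))"
    using assms by (subst (asm) eq) (simp add: integrable_distr_eq)
  show "(LINT x|lborel. f (x + a)) = (LINT x|lborel. f x)"
    by (subst (2) eq) (simp add: integral_distr)
qed

lemma integral_lborel_prod_Basis:
  fixes \<phi> :: "'a::euclidean_space \<Rightarrow> real \<Rightarrow> complex"
  assumes int: "\<And>b. b \<in> Basis \<Longrightarrow> integrable lborel (\<phi> b)"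
  shows "integrable lborel (\<lambda>x::'a. \<Prod>b\<in>Basis. \<phi> b (x \<bullet> b))"
    and "(LINT x|lborel. (\<Prod>b\<in>Basis. \<phi> b (x \<bullet> b))) = (\<Prod>b\<in>(Basis::'a set). (LINT t|lborel. \<phi> b t))"
proof -
  interpret product_sigma_finite "\<lambda>_::'a. lborel :: real measure" by standard
  have [measurable]: "b \<in> Basis \<Longrightarrow> \<phi> b \<in> borel_measurable borel" for b using int[of b] by auto
  have m: "(\<lambda>f::'a \<Rightarrow> real. \<Sum>b\<in>Basis. f b *\<^sub>R b) \<in> Pi\<^sub>M Basis (\<lambda>_. lborel) \<rightarrow>\<^sub>M borel" by measurable
  have m2: "(\<lambda>x::'a. \<Prod>b\<in>Basis. \<phi> b (x \<bullet> b)) \<in> borel_measurable borel" by measurable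
  have eq: "(\<Prod>b\<in>Basis. \<phi> b ((\<Sum>b\<in>Basis. f b *\<^sub>R b) \<bullet> b)) = (\<Prod>b\<in>Basis. \<phi> b (f b))" for f
    by (intro prod.cong) (auto simp: inner_sum_left inner_Basis if_distrib sum.delta cong: if_cong)
  show "integrable lborel (\<lambda>x::'a. \<Prod>b\<in>Basis. \<phi> b (x \<bullet> b))"
    by (subst lborel_eq, subst integrable_distr_eq[OF m m2], unfold eq, intro product_integrable_prod)
        (auto intro: int)
  show "(LINT x|lborel. (\<Prod>b\<in>Basis. \<phi> b (x \<bullet> b))) = (\<Prod>b\<in>(Basis::'a set). (LINT t|lborel. \<phi> b t))"
    by (subst lborel_eq, subst integral_distr[OF m m2], unfold eq, intro product_integral_prod) (auto intro: int)
qed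

text \<open>Up to normalisation, this is the characteristic function of the standard normal distribution.\<close>

lemma gaussian_fourier_real:
  fixes s :: real
  shows "integrable lborel (\<lambda>t. exp (- \<i> * complex_of_real (t * s)) * complex_of_real (exp (- t\<^sup>2 / 2)))" (is ?A)
    and "(LINT t|lborel. exp (- \<i> * complex_of_real (t * s)) * complex_of_real (exp (- t\<^sup>2 / 2))) =
      complex_of_real (sqrt (2 * pi) * exp (- s\<^sup>2 / 2))" (is ?B)
proof -
  let ?f = "\<lambda>t. exp (- \<i> * complex_of_real (t * s)) * complex_of_real (exp (- t\<^sup>2 / 2))"
  have "integrable lborel (\<lambda>t. sqrt (2 * pi) * std_normal_density t)"
    by (intro integrable_mult_right integrable_normal_density) auto
  then have e: "integrable lborel (\<lambda>t::real. exp (- t\<^sup>2 / 2))"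
    by (simp add: std_normal_density_def)
  show ?A
    by (rule Bochner_Integration.integrable_bound[OF e]) (auto simp: norm_mult)
  have "complex_of_real (exp (- (s\<^sup>2) / 2)) = char std_normal_distribution (- s)"
    by (simp add: char_std_normal_distribution)
  also have "\<dots> = (LINT t|lborel. std_normal_density t *\<^sub>R iexp (- s * t))"
    unfolding char_def by (subst integral_density) (auto simp: normal_density_nonneg)
  also have "\<dots> = (LINT t|lborel. complex_of_real (1 / sqrt (2 * pi)) * ?f t)"
    by (intro Bochner_Integration.integral_cong)
      (auto simp: std_normal_density_def scaleR_conv_of_real mult_ac)
  also have "\<dots> = complex_of_real (1 / sqrt (2 * pi)) * (LINT t|lborel. ?f t)"
    by (rule integral_mult_right_zero)
  finally have "complex_of_real (sqrt (2 * pi)) * complex_of_real (exp (- (s\<^sup>2) / 2)) =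
      complex_of_real (sqrt (2 * pi) * (1 / sqrt (2 * pi))) * (LINT t|lborel. ?f t)"
    by simp
  then show ?B by simp
qed

definition gaussian :: "real^'n::finite \<Rightarrow> complex" where
  "gaussian x = complex_of_real (exp (- (x \<bullet> x) / 2))"

lemma norm_gaussian_le: "norm (gaussian x) \<le> 1"
  by (simp add: gaussian_def)

lemma continuous_gaussian: "continuous_on UNIV gaussian"
  unfolding gaussian_def by (intro continuous_intros) auto

lemma borel_measurable_gaussian [measurable]: "gaussian \<in> borel_measurable borel"
  by (rule borel_measurable_continuous_onI[OF continuous_gaussian])

lemma gaussian_prod:
  "exp (- \<i> * complex_of_real (x \<bullet> y)) * gaussian x =
     (\<Prod>b\<in>Basis. exp (- \<i> * complex_of_real ((x \<bullet> b) * (y \<bullet> b))) * complex_of_real (exp (- (x \<bullet> b)\<^sup>2 / 2)))"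
proof -
  have "gaussian x = (\<Prod>b\<in>Basis. complex_of_real (exp (- (x \<bullet> b)\<^sup>2 / 2)))"
    unfolding gaussian_def euclidean_inner[of x x]
    by (simp add: power2_eq_square sum_divide_distrib sum_negf flip: of_real_prod exp_sum)
  moreover have "exp (- \<i> * complex_of_real (x \<bullet> y)) = (\<Prod>b\<in>Basis. exp (- \<i> * complex_of_real ((x \<bullet> b) * (y \<bullet> b))))"
    unfolding euclidean_inner[of x y] by (simp add: sum_distrib_left flip: exp_sum)
  ultimately show ?thesis by (simp add: prod.distrib)
qed

lemma integrable_gaussian: "integrable lborel (gaussian :: real^'n::finite \<Rightarrow> complex)"
proof -
  have "integrable lborel (\<lambda>x::real^'n. exp (- \<i> * complex_of_real (x \<bullet> 0)) * gaussian x)"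
    unfolding gaussian_prod
    by (rule integral_lborel_prod_Basis(1)[where \<phi>="\<lambda>b t. exp
        (- \<i> * complex_of_real (t * ((0::real^'n) \<bullet> b))) * complex_of_real (exp (- t\<^sup>2 / 2))"])
      (rule gaussian_fourier_real)
  then show ?thesis by simp
qed

lemma fourier_gaussian:
  fixes y :: "real^'n::finite"
  shows "fourier gaussian y = complex_of_real (sqrt (2 * pi) ^ CARD('n)) * gaussian y"
proof -
  have "fourier gaussian y = (\<Prod>b\<in>(Basis::(real^'n) set). complex_of_real (sqrt (2 * pi) * exp (- (y \<bullet> b)\<^sup>2 / 2)))"
    unfolding fourier_def gaussian_prod
    by (subst integral_lborel_prod_Basis(2)) (simp_all only: gaussian_fourier_real)
  also have "\<dots> = complex_of_real (sqrt (2 * pi) ^ CARD('n)) * (\<Prod>b\<in>Basis. complex_of_real (exp (- (y \<bullet> b)\<^sup>2 / 2)))"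
    by (simp add: prod.distrib)
  also have "(\<Prod>b\<in>Basis. complex_of_real (exp (- (y \<bullet> b)\<^sup>2 / 2))) = gaussian y"
    using gaussian_prod[of y 0] by simp
  finally show ?thesis .
qed

section \<open>Fourier inversion\<close>

lemma fourier_integrable:
  fixes f :: "real^'n::finite \<Rightarrow> complex"
  assumes "integrable lborel f"
  shows "integrable lborel (\<lambda>y. exp (- \<i> * complex_of_real (y \<bullet> \<xi>)) * f y)"
proof -
  have [measurable]: "f \<in> borel_measurable borel" using assms by auto
  show ?thesis
    by (rule Bochner_Integration.integrable_bound[OF assms]) (auto simp: norm_mult)
qed

lemma norm_fourier_le: "norm (fourier f \<xi>) \<le> (LINT y|lborel. norm (f y))"
  unfolding fourier_def by (rule order_trans[OF integral_norm_bound]) (simp add: norm_mult)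

lemma fourier_add:
  assumes "integrable lborel f" "integrable lborel g"
  shows "fourier (\<lambda>x. f x + g x) \<xi> = fourier f \<xi> + fourier g \<xi>"
  unfolding fourier_def using assms[THEN fourier_integrable, of \<xi>]
  by (simp add: distrib_left)

lemma fourier_cmult: "fourier (\<lambda>x. c * f x) \<xi> = c * fourier f \<xi>"
  unfolding fourier_def by (subst integral_mult_right_zero[symmetric]) (simp add: mult_ac)

lemma fourier_translate:
  assumes "integrable lborel f"
  shows "fourier (\<lambda>y. f (y - a)) \<xi> = exp (- \<i> * complex_of_real (a \<bullet> \<xi>)) * fourier f \<xi>"
proof -
  have "fourier f \<xi> = (LINT y|lborel. exp (- \<i> * complex_of_real ((y + - a) \<bullet> \<xi>)) * f (y + - a))"
    unfolding fourier_def by (rule integral_lborel_translate[symmetric, OF fourier_integrable[OF assms]])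
  also have "\<dots> = (LINT y|lborel. exp (\<i> * complex_of_real (a \<bullet> \<xi>)) * (exp (- \<i> * complex_of_real (y \<bullet> \<xi>)) * f
      (y - a)))"
    by (intro Bochner_Integration.integral_cong) (auto simp: inner_diff_left algebra_simps simp flip: exp_add)
  also have "\<dots> = exp (\<i> * complex_of_real (a \<bullet> \<xi>)) * fourier (\<lambda>y. f (y - a)) \<xi>"
    unfolding fourier_def by (rule integral_mult_right_zero)
  finally show ?thesis by (simp flip: exp_add mult.assoc)
qed

lemma fourier_scale:
  fixes f :: "real^'n::finite \<Rightarrow> complex"
  assumes [measurable]: "f \<in> borel_measurable borel" and "0 < c"
  shows "fourier (\<lambda>y. f (c *\<^sub>R y)) \<xi> = complex_of_real (1 / c ^ CARD('n)) * fourier f (\<xi> /\<^sub>R c)"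
proof -
  have "fourier (\<lambda>y. f (c *\<^sub>R y)) \<xi> = (LINT y|lborel. exp (- \<i> * complex_of_real ((c *\<^sub>R y) \<bullet> (\<xi> /\<^sub>R c))) * f
      (c *\<^sub>R y))"
  proof -
    have "(c *\<^sub>R y) \<bullet> (\<xi> /\<^sub>R c) = y \<bullet> \<xi>" for y using assms(2) by simp
    then show ?thesis by (simp only: fourier_def)
  qed
  also have "\<dots> = (1 / \<bar>c\<bar> ^ DIM(real^'n)) *\<^sub>R (LINT y|lborel. exp (- \<i> * complex_of_real (y \<bullet> (\<xi> /\<^sub>R c))) * f y)"
    using assms(2) by (subst integral_lborel_scaleR[symmetric]) auto
  finally show ?thesis using assms(2) by (simp add: fourier_def scaleR_conv_of_real)
qed

lemma fourier_duality:
  fixes f g :: "real^'n::finite \<Rightarrow> complex"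
  assumes "integrable lborel f" "integrable lborel g"
  shows "(LINT \<xi>|lborel. fourier f \<xi> * g \<xi>) = (LINT y|lborel. f y * fourier g y)"
proof -
  have [measurable]: "f \<in> borel_measurable borel" "g \<in> borel_measurable borel" using assms by auto
  let ?k = "\<lambda>y \<xi>. exp (- \<i> * complex_of_real (y \<bullet> \<xi>)) * f y * g \<xi>"
  have int: "integrable (lborel \<Otimes>\<^sub>M lborel) (case_prod ?k)"
  proof (rule lborel_pair.Fubini_integrable)
    show "integrable lborel (\<lambda>y. LINT \<xi>|lborel. norm (case (y, \<xi>) of (y, \<xi>) \<Rightarrow> ?k y \<xi>))"
      using assms by (auto simp: norm_mult mult.assoc intro!: integrable_mult_left)
    show "AE y in lborel. integrable lborel (\<lambda>\<xi>. case (y, \<xi>) of (y, \<xi>) \<Rightarrow> ?k y \<xi>)"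
    proof (rule AE_I2)
      fix y
      have "integrable lborel (\<lambda>\<xi>. f y * (exp (- \<i> * complex_of_real (\<xi> \<bullet> y)) * g \<xi>))"
        by (intro integrable_mult_right fourier_integrable assms)
      then show "integrable lborel (\<lambda>\<xi>. case (y, \<xi>) of (y, \<xi>) \<Rightarrow> ?k y \<xi>)"
        by (simp add: mult_ac inner_commute)
    qed
  qed simp
  have "(LINT \<xi>|lborel. fourier f \<xi> * g \<xi>) = (LINT \<xi>|lborel. LINT y|lborel. ?k y \<xi>)"
    unfolding fourier_def by (simp flip: integral_mult_left_zero)
  also have "\<dots> = (LINT y|lborel. LINT \<xi>|lborel. ?k y \<xi>)"
    by (rule lborel_pair.Fubini_integral[OF int])
  also have "\<dots> = (LINT y|lborel. f y * fourier g y)"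
    unfolding fourier_def by (simp add: mult_ac inner_commute flip: integral_mult_right_zero)
  finally show ?thesis .
qed

text \<open>The Gaussian \<open>G\<close> is its own Fourier transform up to a factor.  By duality, the integral of
\<open>F g(\<xi>) G(\<epsilon>\<xi>)\<close> is a multiple of the integral of \<open>g(\<epsilon>z) G(z)\<close>; as \<open>\<epsilon>\<close> tends to \<open>0\<close> the
former tends to the integral of \<open>F g\<close> and the latter to \<open>g(0)\<close> times the mass of \<open>G\<close>.\<close>

lemma fourier_inversion_zero:
  fixes g :: "real^'n::finite \<Rightarrow> complex"
  assumes g: "integrable lborel g" and Fg: "integrable lborel (fourier g)"
    and cont: "continuous_on UNIV g" and bound: "\<And>x. norm (g x) \<le> B"
  shows "(LINT \<xi>|lborel. fourier g \<xi>) = complex_of_real ((2 * pi) ^ CARD('n)) * g 0"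
proof (rule LIMSEQ_unique)
  \<comment> \<open>\<open>e m\<close> plays the role of \<open>\<epsilon>\<close>.\<close>
  define e where "e m = inverse (real (Suc m))" for m
  have e: "e m > 0" for m by (simp add: e_def)
  have e0: "e \<longlonglongrightarrow> 0" unfolding e_def by (rule LIMSEQ_inverse_real_of_nat)
  let ?J = "\<lambda>m. LINT z|lborel. g (e m *\<^sub>R z) * gaussian z"
  let ?I = "\<lambda>m. LINT \<xi>|lborel. fourier g \<xi> * gaussian (e m *\<^sub>R \<xi>)"
  have conv: "(\<lambda>m. h (e m *\<^sub>R x)) \<longlonglongrightarrow> h 0" if "continuous_on UNIV h" for h :: "real^'n \<Rightarrow> complex" and x
  proof -
    have "(\<lambda>m. e m *\<^sub>R x) \<longlonglongrightarrow> 0 *\<^sub>R x" by (intro tendsto_intros e0)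
    then show ?thesis using continuous_on_tendsto_compose[OF that, of "\<lambda>m. e m *\<^sub>R x" 0 sequentially] by simp
  qed
  let ?s = "complex_of_real (sqrt (2 * pi) ^ CARD('n))"
  have [measurable]: "g \<in> borel_measurable borel" "fourier g \<in> borel_measurable borel" using g Fg by auto
  show "?I \<longlonglongrightarrow> (LINT \<xi>|lborel. fourier g \<xi>)"
  proof (rule integral_dominated_convergence[where w="\<lambda>\<xi>. norm (fourier g \<xi>)"])
    show "AE \<xi> in lborel. (\<lambda>m. fourier g \<xi> * gaussian (e m *\<^sub>R \<xi>)) \<longlonglongrightarrow> fourier g \<xi>"
      using tendsto_mult[OF tendsto_const conv[OF continuous_gaussian]] by (auto simp: gaussian_def)
    show "AE \<xi> in lborel. norm (fourier g \<xi> * gaussian (e m *\<^sub>R \<xi>)) \<le> norm (fourier g \<xi>)" for m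
      by (auto simp: norm_mult intro!: mult_right_le_one_le norm_gaussian_le)
  qed (use Fg in auto)
  have eq: "?I m = ?s * ?J m" for m
  proof -
    have gi: "integrable lborel (\<lambda>\<xi>::real^'n. gaussian (e m *\<^sub>R \<xi>))"
    proof -
      have "integrable (density (distr lborel borel (\<lambda>x::real^'n. 0 + e m *\<^sub>R x))
          (\<lambda>_. ennreal (\<bar>e m\<bar> ^ DIM(real^'n)))) gaussian"
        using e[of m] integrable_gaussian by (subst lborel_affine[symmetric]) auto
      then have "integrable lborel (\<lambda>x::real^'n. e m ^ CARD('n) *\<^sub>R gaussian (e m *\<^sub>R x))"
        using e[of m] by (simp add: integrable_density integrable_distr_eq)
      then have "integrable lborel (\<lambda>x::real^'n. inverse (e m ^ CARD('n)) *\<^sub>R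
          (e m ^ CARD('n) *\<^sub>R gaussian (e m *\<^sub>R x)))"
        by (rule integrable_scaleR_right)
      then show ?thesis using e[of m] by simp
    qed
    have "?I m = (LINT y|lborel. g y * fourier (\<lambda>\<xi>. gaussian (e m *\<^sub>R \<xi>)) y)"
      by (rule fourier_duality[OF g gi])
    also have "\<dots> = (LINT y|lborel. ?s * (complex_of_real (1 / e m ^ CARD('n)) * (g y * gaussian (y /\<^sub>R e m))))"
      using e[of m] by (intro Bochner_Integration.integral_cong) (auto simp: fourier_scale fourier_gaussian mult_ac)
    also have "\<dots> = ?s * (complex_of_real (1 / e m ^ CARD('n)) * (LINT y|lborel. g y * gaussian (y /\<^sub>R e m)))"
      by (simp only: integral_mult_right_zero)
    also have "complex_of_real (1 / e m ^ CARD('n)) * (LINT y|lborel. g y * gaussian (y /\<^sub>R e m)) = ?J m"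
    proof -
      have "?J m = (LINT z|lborel. g (e m *\<^sub>R z) * gaussian ((e m *\<^sub>R z) /\<^sub>R e m))"
        using e[of m] by simp
      also have "\<dots> = (1 / \<bar>e m\<bar> ^ DIM(real^'n)) *\<^sub>R (LINT y|lborel. g y * gaussian (y /\<^sub>R e m))"
        using e[of m] by (intro integral_lborel_scaleR) auto
      finally show ?thesis using e[of m] by (simp add: scaleR_conv_of_real[where 'a=complex])
    qed
    finally show ?thesis .
  qed
  have "?J \<longlonglongrightarrow> (LINT z|lborel. g 0 * gaussian (z::real^'n))"
  proof (rule integral_dominated_convergence[where w="\<lambda>z. B * norm (gaussian z)"])
    show "AE z in lborel. (\<lambda>m. g (e m *\<^sub>R z) * gaussian z) \<longlonglongrightarrow> g 0 * gaussian z"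
      by (intro AE_I2 tendsto_mult conv cont tendsto_const)
    show "AE z in lborel. norm (g (e m *\<^sub>R z) * gaussian z) \<le> B * norm (gaussian z)" for m
      by (auto simp: norm_mult intro!: mult_right_mono bound)
  qed (use integrable_gaussian in auto)
  moreover have "(LINT z|lborel. g 0 * gaussian (z::real^'n)) = g 0 * ?s"
    using fourier_gaussian[of "0::real^'n"] by (simp add: fourier_def gaussian_def)
  ultimately have "?I \<longlonglongrightarrow> ?s * (g 0 * ?s)"
    unfolding eq by (intro tendsto_mult tendsto_const) auto
  also have "?s * (g 0 * ?s) = complex_of_real ((sqrt (2 * pi) * sqrt (2 * pi)) ^ CARD('n)) * g 0"
    by (simp only: power_mult_distrib of_real_mult mult_ac)
  finally show "?I \<longlonglongrightarrow> complex_of_real ((2 * pi) ^ CARD('n)) * g 0"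
    by simp
qed

text \<open>Translating \<open>g\<close> multiplies its Fourier transform by a character, so that inversion at an arbitrary
point is inversion at \<open>0\<close> for a translate.\<close>

lemma fourier_fourier:
  fixes g :: "real^'n::finite \<Rightarrow> complex"
  assumes g: "integrable lborel g" and Fg: "integrable lborel (fourier g)"
    and cont: "continuous_on UNIV g" and bound: "\<And>x. norm (g x) \<le> B"
  shows "fourier (fourier g) x = complex_of_real ((2 * pi) ^ CARD('n)) * g (- x)"
proof -
  have "fourier (fourier g) x = (LINT \<xi>|lborel. fourier (\<lambda>y. g (y - x)) \<xi>)"
    unfolding fourier_translate[OF g] by (simp add: fourier_def inner_commute)
  also have "\<dots> = complex_of_real ((2 * pi) ^ CARD('n)) * g (0 - x)"
  proof (rule fourier_inversion_zero)
    show "integrable lborel (\<lambda>y. g (y - x))" using integrable_lborel_translate[OF g, of "- x"] by simp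
    show "integrable lborel (fourier (\<lambda>y. g (y - x)))"
    proof -
      have "fourier (\<lambda>y. g (y - x)) = (\<lambda>\<xi>. exp (- \<i> * complex_of_real (\<xi> \<bullet> x)) * fourier g \<xi>)"
        by (rule ext) (simp add: fourier_translate[OF g] inner_commute)
      then show ?thesis using fourier_integrable[OF Fg, of x] by simp
    qed
    show "continuous_on UNIV (\<lambda>y. g (y - x))"
      by (intro continuous_on_compose2[OF cont] continuous_intros) auto
  qed (use bound in auto)
  finally show ?thesis by simp
qed

section \<open>The Fourier transform on the Schwartz space\<close>

lemma schwartz_coordinate: "f \<in> schwartz \<Longrightarrow> (\<lambda>x. complex_of_real (x $ j) * f x) \<in> schwartz"
  using schwartz_opD[OF schwartz_op_coordinate[OF schwartz_op_id]] by auto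

lemma character_has_derivative:
  "((\<lambda>x. exp (- \<i> * complex_of_real (y \<bullet> x))) has_derivative
     (\<lambda>h. exp (- \<i> * complex_of_real (y \<bullet> x)) * (- \<i> * complex_of_real (y \<bullet> h)))) (at x)"
proof -
  have "((\<lambda>x. - \<i> * complex_of_real (y \<bullet> x)) has_derivative (\<lambda>h. - \<i> * complex_of_real (y \<bullet> h))) (at x)"
    by (intro has_derivative_mult_right has_derivative_of_real has_derivative_inner_right has_derivative_ident)
  from diff_chain_at[OF this DERIV_exp[unfolded has_field_derivative_def]] show ?thesis
    by (simp add: o_def)
qed

lemma fourier_has_derivative:
  fixes f :: "real^'n::finite \<Rightarrow> complex"
  assumes f: "f \<in> schwartz"
  shows "(fourier f has_derivative
    (\<lambda>h. LINT y|lborel. (- \<i> * complex_of_real (y \<bullet> h)) * (exp (- \<i> * complex_of_real (y \<bullet> \<xi>)) * f y))) (at \<xi>)"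
  unfolding fourier_def[abs_def]
proof (rule has_derivative_integral[where g="\<lambda>y. norm y * norm (f y)"])
  have [measurable]: "f \<in> borel_measurable borel" using f by (rule schwartz_borel)
  show "integrable lborel (\<lambda>y. exp (- \<i> * complex_of_real (y \<bullet> x)) * f y)" for x
    by (intro fourier_integrable schwartz_integrable f)
  show "((\<lambda>x. exp (- \<i> * complex_of_real (y \<bullet> x)) * f y) has_derivative
     (\<lambda>h. - \<i> * complex_of_real (y \<bullet> h) * (exp (- \<i> * complex_of_real (y \<bullet> x)) * f y))) (at x)" for x y
  proof -
    from has_derivative_mult_left[OF character_has_derivative[of y x], of "f y"] show ?thesis
      by (simp add: mult_ac)
  qed
  show "norm (- \<i> * complex_of_real (y \<bullet> h) * (exp (- \<i> * complex_of_real (y \<bullet> x)) * f y)) \<le>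
      norm y * norm (f y) * norm h" for x y h
  proof -
    have "\<bar>y \<bullet> h\<bar> * norm (f y) \<le> (norm y * norm h) * norm (f y)"
      by (intro mult_right_mono Cauchy_Schwarz_ineq2) auto
    then show ?thesis by (simp add: norm_mult mult_ac)
  qed
  show "integrable lborel (\<lambda>y. norm y * norm (f y))"
  proof (rule Bochner_Integration.integrable_bound)
    show "integrable lborel (\<lambda>y. \<Sum>j\<in>UNIV. norm (complex_of_real (y $ j) * f y))"
      using f by (intro Bochner_Integration.integrable_sum integrable_norm schwartz_integrable schwartz_coordinate)
    have "norm y * norm (f y) \<le> (\<Sum>j\<in>UNIV. norm (complex_of_real (y $ j) * f y))" for y :: "real^'n"
      using mult_right_mono[OF norm_le_l1_cart[of y], of "norm (f y)"]
      by (simp add: norm_mult sum_distrib_right)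
    then show "AE y in lborel. norm (norm y * norm (f y)) \<le> norm (\<Sum>j\<in>UNIV. norm (complex_of_real (y $ j) * f y))"
      by (intro AE_I2) (auto intro: order_trans[OF _ abs_ge_self])
  qed simp
  show "(\<lambda>y. - \<i> * complex_of_real (y \<bullet> h) * (exp (- \<i> * complex_of_real (y \<bullet> x)) * f y)) \<in> borel_measurable lborel"
      for x h
    unfolding measurable_lborel2
    by (intro borel_measurable_continuous_onI continuous_intros schwartz_continuous f)
qed

lemma partials_fourier:
  assumes "f \<in> schwartz"
  shows "partials [i] (fourier f) = fourier (\<lambda>y. - \<i> * (complex_of_real (y $ i) * f y))"
proof
  fix \<xi>
  show "partials [i] (fourier f) \<xi> = fourier (\<lambda>y. - \<i> * (complex_of_real (y $ i) * f y)) \<xi>"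
    unfolding partials_single_eqI[OF fourier_has_derivative[OF assms]] fourier_def
    by (simp add: inner_axis mult_ac)
qed

text \<open>The integral of \<open>f (x + t e\<^sub>i)\<close> over \<open>x\<close> does not depend on \<open>t\<close>, and its derivative at \<open>t = 0\<close> is the
integral of the partial derivative.  The shift is taken to be \<open>sin t\<close>: it has derivative \<open>1\<close> at
\<open>t = 0\<close> and stays bounded, hence one integrable function dominates the derivatives for all \<open>t\<close>.\<close>

lemma integral_partial_zero:
  fixes f :: "real^'n::finite \<Rightarrow> complex"
  assumes int: "integrable lborel f"
    and der: "\<And>x. (f has_derivative f' x) (at x)"
    and meas: "(\<lambda>x. f' x (axis i 1)) \<in> borel_measurable borel"
    and bound: "\<And>x. norm (f' x (axis i 1)) \<le> B * (1 / (1 + norm x) ^ (CARD('n) + 1))"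
  shows "(LINT x|lborel. f' x (axis i 1)) = 0"
proof -
  let ?e = "axis i 1 :: real^'n"
  define h where "h t x = f (x + sin t *\<^sub>R ?e)" for t x
  define h' where "h' t x = cos t *\<^sub>R f' (x + sin t *\<^sub>R ?e) ?e" for t x
  have [measurable]: "(\<lambda>x. f' x ?e) \<in> borel_measurable borel" by (rule meas)
  have B: "0 \<le> B"
    using order_trans[OF norm_ge_zero bound[of 0]] by simp
  have "((\<lambda>t. LINT x|lborel. h t x) has_vector_derivative (LINT x|lborel. h' 0 x)) (at 0)"
  proof (rule has_vector_derivative_integral[where g="\<lambda>x. 2 ^ (CARD('n) +
      1) * B * (1 / (1 + norm x) ^ (CARD('n) + 1))"])
    show "integrable lborel (h t)" for t
      unfolding h_def by (rule integrable_lborel_translate[OF int])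
    show "((\<lambda>t. h t x) has_vector_derivative h' t x) (at t)" for t x
    proof -
      have "((\<lambda>t. x + sin t *\<^sub>R ?e) has_derivative (\<lambda>s. s *\<^sub>R (cos t *\<^sub>R ?e))) (at t)"
        by (auto intro!: derivative_eq_intros)
      from diff_chain_at[OF this der] show ?thesis
        using linear_scale[OF has_derivative_linear[OF der]]
        by (simp add: h_def h'_def o_def has_vector_derivative_def)
    qed
    show "norm (h' t x) \<le> 2 ^ (CARD('n) + 1) * B * (1 / (1 + norm x) ^ (CARD('n) + 1))" for t x
    proof -
      let ?y = "x + sin t *\<^sub>R ?e"
      have "norm x \<le> norm ?y + norm (sin t *\<^sub>R ?e)"
        using norm_triangle_ineq4[of ?y "sin t *\<^sub>R ?e"] by simp
      also have "norm (sin t *\<^sub>R ?e) \<le> 1" by (simp add: norm_axis_1)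
      \<comment> \<open>A shift by at most \<open>1\<close> changes \<open>1 + |x|\<close> by a factor of at most \<open>2\<close>.\<close>
      finally have "norm x \<le> norm ?y + 1" by simp
      moreover have "1 + a \<le> 2 * (1 + b)" if "a \<le> b + 1" "0 \<le> b" for a b :: real using that by simp
      ultimately have le: "1 + norm x \<le> 2 * (1 + norm ?y)" by (meson norm_ge_zero)
      have pos: "0 < (1 + norm x) ^ (CARD('n) + 1)" "0 < (1 + norm ?y) ^ (CARD('n) + 1)"
        by (auto intro!: zero_less_power add_pos_nonneg simp del: power_Suc)
      have "(1 + norm x) ^ (CARD('n) + 1) \<le> 2 ^ (CARD('n) + 1) * (1 + norm ?y) ^ (CARD('n) + 1)"
        unfolding power_mult_distrib[symmetric] by (intro power_mono le) auto
      then have "1 / (1 + norm ?y) ^ (CARD('n) + 1) \<le> 2 ^ (CARD('n) + 1) * (1 / (1 + norm x) ^ (CARD('n) + 1))"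
        using pos by (simp add: divide_simps mult.commute)
      then have "norm (f' ?y ?e) \<le> B * (2 ^ (CARD('n) + 1) * (1 / (1 + norm x) ^ (CARD('n) + 1)))"
        using B by (intro order_trans[OF bound] mult_left_mono)
      moreover have "norm (h' t x) \<le> norm (f' ?y ?e)"
        unfolding h'_def by (simp add: mult_left_le_one_le)
      ultimately show ?thesis by (simp only: mult_ac)
    qed
    show "integrable lborel (\<lambda>x::real^'n. 2 ^ (CARD('n) + 1) * B * (1 / (1 + norm x) ^ (CARD('n) + 1)))"
      by (intro integrable_mult_right integrable_inverse_power_norm)
    show "h' t \<in> borel_measurable lborel" for t
      unfolding h'_def by (simp add: measurable_compose[OF _ meas])
  qed
  moreover have "(\<lambda>t. LINT x|lborel. h t x) = (\<lambda>t. LINT x|lborel. f x)"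
    unfolding h_def by (rule ext) (rule integral_lborel_translate[OF int])
  ultimately have "((\<lambda>t::real. LINT x|lborel. f x) has_vector_derivative (LINT x|lborel. f' x ?e)) (at 0)"
    by (simp add: h'_def)
  then show ?thesis
    using vector_derivative_at by force
qed

text \<open>Integration by parts: apply the vanishing of integrals of partial derivatives to the product of
\<open>f\<close> with the character.\<close>

lemma fourier_partial:
  fixes f :: "real^'n::finite \<Rightarrow> complex"
  assumes f: "f \<in> schwartz"
  shows "fourier (partials [i] f) \<xi> = \<i> * complex_of_real (\<xi> $ i) * fourier f \<xi>"
proof -
  let ?E = "\<lambda>y. exp (- \<i> * complex_of_real (y \<bullet> \<xi>))"
  let ?D = "\<lambda>y h. (\<Sum>j\<in>UNIV. h $ j *\<^sub>R partials [j] f y)"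
  define f' where "f' y h = ?E y * ?D y h + (?E y * (- \<i> * complex_of_real (h \<bullet> \<xi>))) * f y" for y h
  have pf: "partials [i] f \<in> schwartz" by (rule schwartz_partials[OF f])
  have [measurable]: "f \<in> borel_measurable borel" using f by (rule schwartz_borel)
  have [measurable]: "partials [i] f \<in> borel_measurable borel" using pf by (rule schwartz_borel)
  have D: "?D y (axis i 1) = partials [i] f y" for y
    by (simp add: axis_def if_distrib if_distribR sum.delta cong: if_cong del: partials.simps)
  have f'e: "f' y (axis i 1) = ?E y * partials [i] f y + - \<i> * complex_of_real (\<xi> $ i) * (?E y * f y)" for y
    unfolding f'_def D by (simp add: inner_axis' mult_ac del: partials.simps)
  have int1: "integrable lborel (\<lambda>y. ?E y * partials [i] f y)"
    by (intro fourier_integrable schwartz_integrable pf)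
  have int2: "integrable lborel (\<lambda>y. ?E y * f y)"
    by (intro fourier_integrable schwartz_integrable f)
  have "(LINT y|lborel. f' y (axis i 1)) = 0"
  proof (rule integral_partial_zero[OF int2, where B="schwartz_seminorm (CARD('n) + 1) [] (partials [i] f) +
      \<bar>\<xi> $ i\<bar> * schwartz_seminorm (CARD('n) + 1) [] f"])
    show "((\<lambda>y. ?E y * f y) has_derivative f' y) (at y)" for y
    proof -
      have "(?E has_derivative (\<lambda>h. ?E y * (- \<i> * complex_of_real (h \<bullet> \<xi>)))) (at y)"
        using character_has_derivative[of \<xi> y] by (simp only: inner_commute[of \<xi>])
      from has_derivative_mult[OF this schwartz_has_derivative[OF f]] show ?thesis
        unfolding f'_def .
    qed
    show "(\<lambda>y. f' y (axis i 1)) \<in> borel_measurable borel" unfolding f'e by measurable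
    show "norm (f' y (axis i 1)) \<le> (schwartz_seminorm (CARD('n) + 1) [] (partials [i] f) +
        \<bar>\<xi> $ i\<bar> * schwartz_seminorm (CARD('n) + 1) [] f) * (1 / (1 + norm y) ^ (CARD('n) + 1))" for y
    proof -
      have "norm (f' y (axis i 1)) \<le> norm (?E y * partials [i] f y) +
          norm (- \<i> * complex_of_real (\<xi> $ i) * (?E y * f y))"
        unfolding f'e by (rule norm_triangle_ineq)
      also have "\<dots> = norm (partials [i] f y) + \<bar>\<xi> $ i\<bar> * norm (f y)"
        by (simp add: norm_mult del: partials.simps)
      also have "\<dots> \<le> schwartz_seminorm (CARD('n) + 1) [] (partials [i] f) * (1 / (1 + norm y) ^ (CARD('n) + 1)) +
          \<bar>\<xi> $ i\<bar> * (schwartz_seminorm (CARD('n) + 1) [] f * (1 / (1 + norm y) ^ (CARD('n) + 1)))"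
        by (intro add_mono mult_left_mono schwartz_norm_le f pf) auto
      finally show ?thesis by (simp only: distrib_right mult.assoc)
    qed
  qed
  then have "(LINT y|lborel. ?E y * partials [i] f y) + - \<i> * complex_of_real (\<xi> $ i) * (LINT y|lborel. ?E y * f y)
      = 0"
    unfolding f'e using int1 int2
    by (subst (asm) Bochner_Integration.integral_add) (auto simp del: partials.simps)
  then show ?thesis by (simp add: fourier_def del: partials.simps)
qed

lemma fourier_partials_replicate:
  "f \<in> schwartz \<Longrightarrow> fourier (partials (replicate m i) f) \<xi> = (\<i> * complex_of_real (\<xi> $ i)) ^ m * fourier f \<xi>"
proof (induction m)
  case (Suc m)
  have "partials (replicate (Suc m) i) f = partials [i] (partials (replicate m i) f)" by simp
  then show ?case using Suc fourier_partial[OF schwartz_partials[OF Suc.prems], of i "replicate m i" \<xi>]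
    by (simp del: partials.simps)
qed simp

text \<open>Only powers of a single coordinate appear on the right, and these correspond under the Fourier
transform to repeated derivatives in a single direction.\<close>

lemma power_one_plus_norm_le:
  fixes x :: "real^'n::finite"
  shows "(1 + norm x) ^ N \<le> real (CARD('n) + 1) ^ N * (1 + (\<Sum>i\<in>UNIV. \<bar>x $ i\<bar> ^ N))"
proof -
  obtain j where j: "\<And>i. \<bar>x $ i\<bar> \<le> \<bar>x $ j\<bar>"
  proof -
    have "Max (range (\<lambda>i. \<bar>x $ i\<bar>)) \<in> range (\<lambda>i. \<bar>x $ i\<bar>)" by (intro Max_in) auto
    then obtain j where "Max (range (\<lambda>i. \<bar>x $ i\<bar>)) = \<bar>x $ j\<bar>" by (rule rangeE)
    then have "\<bar>x $ i\<bar> \<le> \<bar>x $ j\<bar>" for i using Max_ge[of "range (\<lambda>i. \<bar>x $ i\<bar>)" "\<bar>x $ i\<bar>"] by auto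
    then show ?thesis by (rule that)
  qed
  \<comment> \<open>The maximum with \<open>1\<close> dominates both the constant and every coordinate.\<close>
  define a where "a = max 1 \<bar>x $ j\<bar>"
  have "1 + norm x \<le> 1 + (\<Sum>i\<in>UNIV. \<bar>x $ i\<bar>)" by (simp add: norm_le_l1_cart)
  also have "\<dots> \<le> a + (\<Sum>i\<in>(UNIV::'n set). a)"
  proof (intro add_mono sum_mono)
    show "\<bar>x $ i\<bar> \<le> a" for i using j[of i] unfolding a_def by linarith
  qed (simp add: a_def)
  also have "\<dots> = real (CARD('n) + 1) * a" by (simp add: algebra_simps)
  finally have "(1 + norm x) ^ N \<le> real (CARD('n) + 1) ^ N * a ^ N"
    unfolding power_mult_distrib[symmetric] by (intro power_mono) auto
  also have "a ^ N \<le> 1 + (\<Sum>i\<in>UNIV. \<bar>x $ i\<bar> ^ N)"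
  proof -
    have "a ^ N \<le> 1 + \<bar>x $ j\<bar> ^ N" by (auto simp: a_def max_def)
    also have "\<bar>x $ j\<bar> ^ N \<le> (\<Sum>i\<in>UNIV. \<bar>x $ i\<bar> ^ N)" by (rule member_le_sum) auto
    finally show ?thesis by simp
  qed
  finally show ?thesis by (simp add: mult_left_mono)
qed

lemma fourier_decay:
  fixes N :: nat
  obtains q :: "(real^'n::finite \<Rightarrow> complex) \<Rightarrow> real" where "seminorm_bounded q"
    "\<And>f \<xi>. f \<in> schwartz \<Longrightarrow> (1 + norm \<xi>) ^ N * norm (fourier f \<xi>) \<le> q f"
proof -
  define K where "K = (LINT x::real^'n|lborel. 1 / (1 + norm x) ^ (CARD('n) + 1))"
  have K: "0 \<le> K" unfolding K_def by (intro Bochner_Integration.integral_nonneg) auto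
  \<comment> \<open>The seminorm of order \<open>n + 1\<close> bounds the integral of the modulus, hence the Fourier transform;
  the derivatives of order \<open>N\<close> in one direction supply the \<open>N\<close>-th powers of the coordinates.\<close>
  define q where "q f = real (CARD('n) + 1) ^ N * (K * schwartz_seminorm (CARD('n) + 1) [] f
     + (\<Sum>i\<in>UNIV. K * schwartz_seminorm (CARD('n) + 1) (replicate N i) f))" for f :: "real^'n \<Rightarrow> complex"
  have F: "norm (fourier f \<xi>) \<le> K * schwartz_seminorm (CARD('n) + 1) [] f"
      if "f \<in> schwartz" for f :: "real^'n \<Rightarrow> complex" and \<xi>
    using order_trans[OF norm_fourier_le schwartz_integral_norm_le[OF that]] by (simp add: K_def mult.commute)
  show thesis
  proof
    show "seminorm_bounded q"
      unfolding q_def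
      by (intro seminorm_bounded_mult seminorm_bounded_add seminorm_bounded_sum seminorm_bounded_seminorm K) auto
    fix f \<xi> assume f: "f \<in> (schwartz :: (real^'n \<Rightarrow> complex) set)"
    have "(1 + norm \<xi>) ^ N * norm (fourier f \<xi>) \<le>
       real (CARD('n) + 1) ^ N * (1 + (\<Sum>i\<in>UNIV. \<bar>\<xi> $ i\<bar> ^ N)) * norm (fourier f \<xi>)"
      by (intro mult_right_mono power_one_plus_norm_le) auto
    also have "\<dots> = real (CARD('n) + 1) ^ N * (norm (fourier f \<xi>) +
        (\<Sum>i\<in>UNIV. norm (fourier (partials (replicate N i) f) \<xi>)))"
      by (simp add: fourier_partials_replicate[OF f] norm_mult norm_power distrib_right sum_distrib_right)
    also have "\<dots> \<le> q f"
      unfolding q_def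
    proof (intro mult_left_mono add_mono sum_mono F f)
      show "norm (fourier (partials (replicate N i) f) \<xi>) \<le> K * schwartz_seminorm (CARD('n) + 1) (replicate N i) f"
          for i
        using F[OF schwartz_partials[OF f], of "replicate N i" \<xi>] by (simp add: schwartz_seminorm_partials)
    qed auto
    finally show "(1 + norm \<xi>) ^ N * norm (fourier f \<xi>) \<le> q f" .
  qed
qed

text \<open>A derivative of \<open>F (L f)\<close> is \<open>F (- i y\<^sub>j L f)\<close>, so the maps of this form are closed under partial
derivatives, and their decay comes from the derivatives of \<open>L f\<close>.\<close>

lemma schwartz_op_fourier:
  fixes L :: "(real^'n::finite \<Rightarrow> complex) \<Rightarrow> real^'n \<Rightarrow> complex"
  assumes "schwartz_op L"
  shows "schwartz_op (\<lambda>f. fourier (L f))"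
proof -
  define X where "X = {\<lambda>f. fourier (L f) |L. schwartz_op (L :: (real^'n \<Rightarrow> complex) \<Rightarrow> real^'n \<Rightarrow> complex)}"
  have XE: thesis if "M \<in> X" "\<And>L. M = (\<lambda>f. fourier (L f)) \<Longrightarrow> schwartz_op L \<Longrightarrow> thesis" for M thesis
    using that unfolding X_def by blast
  have XI: "(\<lambda>f. fourier (L f)) \<in> X" if "schwartz_op L" for L
    using that unfolding X_def by blast
  show ?thesis
  proof (rule schwartz_op_coinduct[OF XI[OF assms]]; (erule XE, hypsubst))
    fix L :: "(real^'n \<Rightarrow> complex) \<Rightarrow> real^'n \<Rightarrow> complex"
    assume L: "schwartz_op L"
    show "fourier (L f) differentiable (at x)" if "f \<in> schwartz" for f x
      using fourier_has_derivative[OF schwartz_opD[OF L that]] by (auto simp: differentiable_def)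
    show "\<exists>L'\<in>X. \<forall>f\<in>schwartz. partials [i] (fourier (L f)) = L' f" for i
    proof (intro bexI ballI)
      show "partials [i] (fourier (L f)) = fourier (\<lambda>y. - \<i> * (complex_of_real (y $ i) * L f y))"
          if "f \<in> schwartz" for f
        by (rule partials_fourier[OF schwartz_opD[OF L that]])
      show "(\<lambda>f. fourier (\<lambda>y. - \<i> * (complex_of_real (y $ i) * L f y))) \<in> X"
        by (intro XI schwartz_op_cmult schwartz_op_coordinate L)
    qed
    show "\<exists>q. seminorm_bounded q \<and> (\<forall>f\<in>schwartz. \<forall>x. (1 + norm x) ^ N * norm (fourier (L f) x) \<le> q f)" for N
    proof -
      obtain q :: "(real^'n \<Rightarrow> complex) \<Rightarrow> real" where q: "seminorm_bounded q"
        "\<And>f \<xi>. f \<in> schwartz \<Longrightarrow> (1 + norm \<xi>) ^ N * norm (fourier f \<xi>) \<le> q f"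
        using fourier_decay by blast
      then show ?thesis
        using seminorm_bounded_compose[OF q(1) L] schwartz_opD[OF L] by (intro exI[of _ "\<lambda>f. q (L f)"]) auto
    qed
  qed
qed

lemma schwartz_fourier: "f \<in> schwartz \<Longrightarrow> fourier f \<in> schwartz"
  using schwartz_opD[OF schwartz_op_fourier[OF schwartz_op_id]] .

lemma fourier_fourier_schwartz:
  fixes g :: "real^'n::finite \<Rightarrow> complex"
  assumes "g \<in> schwartz"
  shows "fourier (fourier g) x = complex_of_real ((2 * pi) ^ CARD('n)) * g (- x)"
proof (rule fourier_fourier)
  show "norm (g x) \<le> schwartz_seminorm 0 [] g" for x
    using schwartz_norm_le[OF assms, of x 0] by simp
qed (use assms schwartz_integrable schwartz_continuous schwartz_fourier in auto)

lemma schwartz_polynomial: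
  "real_polynomial_function p \<Longrightarrow> f \<in> schwartz \<Longrightarrow> (\<lambda>x. complex_of_real (p x) * f x) \<in> schwartz"
  using schwartz_opD[OF schwartz_op_polynomial[OF _ schwartz_op_id]] by auto

text \<open>The Fourier inversion \<open>F F g (x) = (2 \<pi>)\<^sup>n g (-x)\<close> also expresses the reflection of a Schwartz function
by an iterated Fourier transform.  Thus with \<open>g = p F f\<close>, the function \<open>symbol_op p f\<close> is a multiple
of \<open>F F F g\<close>, and its Fourier transform is a multiple of \<open>F F F F g\<close>, that is, \<open>g\<close>.\<close>

lemma fourier_symbol_op:
  fixes p :: "real^'n::finite \<Rightarrow> real"
  assumes p: "real_polynomial_function p" and f: "f \<in> schwartz"
  shows "fourier (symbol_op p f) \<xi> = complex_of_real (p \<xi>) * fourier f \<xi>"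
proof -
  define C where "C = complex_of_real ((2 * pi) ^ CARD('n))"
  have C: "C \<noteq> 0" by (simp add: C_def)
  define g where "g = (\<lambda>\<xi>. complex_of_real (p \<xi>) * fourier f \<xi>)"
  have g: "g \<in> schwartz" unfolding g_def by (intro schwartz_polynomial p schwartz_fourier f)
  then have Fg: "fourier g \<in> schwartz" "fourier (fourier g) \<in> schwartz"
    by (auto intro: schwartz_fourier)
  have eq: "symbol_op p f = (\<lambda>x. inverse C * inverse C * fourier (fourier (fourier g)) x)"
  proof
    fix x
    have "symbol_op p f x = inverse C * fourier g (- x)"
      by (simp add: symbol_op_def fourier_def g_def C_def mult.assoc divide_inverse)
    also have "fourier g (- x) = inverse C * fourier (fourier (fourier g)) x"
      using C unfolding fourier_fourier_schwartz[OF Fg(1)] C_def[symmetric] by simp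
    finally show "symbol_op p f x = inverse C * inverse C * fourier (fourier (fourier g)) x" by simp
  qed
  have "fourier (symbol_op p f) \<xi> = g \<xi>"
    using C unfolding eq fourier_cmult fourier_fourier_schwartz[OF Fg(2)] fourier_fourier_schwartz[OF g]
        C_def[symmetric]
    by (simp add: field_simps)
  then show "fourier (symbol_op p f) \<xi> = complex_of_real (p \<xi>) * fourier f \<xi>" by (simp add: g_def)
qed

section \<open>Weighted spherical means\<close>

text \<open>Differentiating \<open>r\<^sup>m \<integral> w(\<theta>) \<partial>\<^sup>\<alpha>g(r \<theta>) d\<theta>\<close> in \<open>r\<close> gives a sum of expressions of the same kind, in
which the power of \<open>r\<close> drops or the weight acquires a factor \<open>\<theta>\<^sub>i\<close>.  The family of all such sums, regarded as
    functions of
\<open>g\<close> and \<open>r\<close>, therefore contains every radial derivative of the spherical average, and estimates for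
these derivatives that are uniform in \<open>g\<close> are proved by induction over the family.  The variable
\<open>r\<close> ranges over the whole line, which avoids one-sided derivatives at \<open>0\<close>.\<close>

inductive radial_family :: "((real^'n::finite \<Rightarrow> complex) \<Rightarrow> real \<Rightarrow> complex) \<Rightarrow> bool" where
  base: "w \<in> borel_measurable sphere_measure \<Longrightarrow> (\<And>\<theta>. \<theta> \<in> sphere 0 1 \<Longrightarrow> norm (w \<theta>) \<le> W) \<Longrightarrow>
    radial_family (\<lambda>g r. complex_of_real (r ^ m) * (LINT \<theta>|sphere_measure. w \<theta> * partials js g (r *\<^sub>R \<theta>)))"
| add: "radial_family \<Phi> \<Longrightarrow> radial_family \<Psi> \<Longrightarrow> radial_family (\<lambda>g r. \<Phi> g r + \<Psi> g r)"

lemma schwartz_sphere_measurable: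
  "f \<in> schwartz \<Longrightarrow> (\<lambda>\<theta>. f (r *\<^sub>R \<theta>)) \<in> borel_measurable sphere_measure"
  by (rule borel_measurable_sphere_measure) (intro measurable_compose[OF _ schwartz_borel], auto)

lemma sphere_integrable:
  fixes f :: "real^'n::finite \<Rightarrow> complex"
  assumes "w \<in> borel_measurable sphere_measure" "\<And>\<theta>. \<theta> \<in> sphere 0 1 \<Longrightarrow> norm (w \<theta>) \<le> W" "f \<in> schwartz"
  shows "integrable sphere_measure (\<lambda>\<theta>. w \<theta> * f (r *\<^sub>R \<theta>))"
proof (rule sphere_measure.integrable_const_bound[where B="W * schwartz_seminorm 0 [] f"])
  show "AE \<theta> in sphere_measure. norm (w \<theta> * f (r *\<^sub>R \<theta>)) \<le> W * schwartz_seminorm 0 [] f"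
  proof (rule AE_I2)
    fix \<theta> :: "real^'n" assume "\<theta> \<in> space sphere_measure"
    then have w: "norm (w \<theta>) \<le> W" using assms(2) by simp
    have "norm (f (r *\<^sub>R \<theta>)) \<le> schwartz_seminorm 0 [] f" using schwartz_norm_le[OF assms(3), of _ 0] by simp
    then show "norm (w \<theta> * f (r *\<^sub>R \<theta>)) \<le> W * schwartz_seminorm 0 [] f"
      unfolding norm_mult using w by (intro mult_mono) (auto intro: order_trans[OF norm_ge_zero])
  qed
qed (intro borel_measurable_times assms schwartz_sphere_measurable)

lemma radial_family_linear:
  assumes "radial_family \<Phi>"
  shows "f \<in> schwartz \<Longrightarrow> g \<in> schwartz \<Longrightarrow> \<Phi> (\<lambda>x. f x + g x) r = \<Phi> f r + \<Phi> g r"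
    and "f \<in> schwartz \<Longrightarrow> \<Phi> (\<lambda>x. c * f x) r = c * \<Phi> f r"
  using assms
proof (induction)
  case (base w W m js)
  {
    case 1
    then show ?case
      using sphere_integrable[OF base schwartz_partials]
      by (simp add: partials_add distrib_left)
  next
    case 2
    then show ?case
      by (simp add: partials_cmult mult.left_commute[of _ c])
  }
qed (simp_all add: algebra_simps)

lemma radial_family_cmult:
  assumes "radial_family \<Phi>"
  shows "radial_family (\<lambda>g r. c * \<Phi> g r)"
  using assms
proof induction
  case (base w W m js)
  have "radial_family (\<lambda>g r. complex_of_real (r ^ m) * (LINT \<theta>|sphere_measure. (c * w \<theta>) * partials js g (r *\<^sub>R \<theta>)))"
    using base by (intro radial_family.base[where W="norm c * W"]) (auto simp: norm_mult mult_left_mono)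
  moreover have "complex_of_real (r ^ m) * (LINT \<theta>|sphere_measure. (c * w \<theta>) * partials js g (r *\<^sub>R \<theta>)) =
    c * (complex_of_real (r ^ m) * (LINT \<theta>|sphere_measure. w \<theta> * partials js g (r *\<^sub>R \<theta>)))" for g r
    unfolding mult.assoc[of c] by (subst integral_mult_right_zero) (simp add: mult_ac)
  ultimately show ?case by (simp only:)
next
  case (add \<Phi> \<Psi>)
  then show ?case by (simp add: distrib_left radial_family.add)
qed

lemma radial_family_times_r:
  assumes "radial_family \<Phi>"
  shows "radial_family (\<lambda>g r. complex_of_real r * \<Phi> g r)"
  using assms
proof induction
  case (base w W m js)
  then have "radial_family (\<lambda>g r. complex_of_real (r ^ Suc m) * (LINT \<theta>|sphere_measure. w \<theta> * partials js g
      (r *\<^sub>R \<theta>)))"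
    by (rule radial_family.base)
  then show ?case by (simp add: mult.assoc)
next
  case (add \<Phi> \<Psi>)
  then show ?case by (simp add: distrib_left radial_family.add)
qed

lemma radial_family_zero: "radial_family (\<lambda>g r. 0)"
  using radial_family.base[of "\<lambda>_. 0" 0 0 "[]"] by simp

lemma radial_family_sum:
  "finite I \<Longrightarrow> (\<And>i. i \<in> I \<Longrightarrow> radial_family (\<Phi> i)) \<Longrightarrow> radial_family (\<lambda>g r. \<Sum>i\<in>I. \<Phi> i g r)"
  by (induction I rule: finite_induct) (auto intro: radial_family_zero radial_family.add)

lemma sphere_weight_coordinate:
  fixes w :: "real^'n::finite \<Rightarrow> complex"
  shows "w \<in> borel_measurable sphere_measure \<Longrightarrow>
      (\<lambda>\<theta>. w \<theta> * complex_of_real (\<theta> $ i)) \<in> borel_measurable sphere_measure"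
    and "(\<And>\<theta>. \<theta> \<in> sphere 0 1 \<Longrightarrow> norm (w \<theta>) \<le> W) \<Longrightarrow> \<theta> \<in> sphere 0 1 \<Longrightarrow>
      norm (w \<theta> * complex_of_real (\<theta> $ i)) \<le> W"
proof -
  have "(\<lambda>\<theta>::real^'n. complex_of_real (\<theta> $ i)) \<in> borel_measurable sphere_measure"
    by (intro borel_measurable_sphere_measure borel_measurable_continuous_onI continuous_intros)
  then show "w \<in> borel_measurable sphere_measure \<Longrightarrow>
      (\<lambda>\<theta>. w \<theta> * complex_of_real (\<theta> $ i)) \<in> borel_measurable sphere_measure"
    by (rule borel_measurable_times[rotated])
  assume "\<And>\<theta>. \<theta> \<in> sphere 0 1 \<Longrightarrow> norm (w \<theta>) \<le> W" "\<theta> \<in> sphere 0 1"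
  then have "norm (w \<theta>) * \<bar>\<theta> $ i\<bar> \<le> W * 1"
    using component_le_norm_cart[of \<theta> i] by (intro mult_mono) (auto intro: order_trans[OF norm_ge_zero])
  then show "norm (w \<theta> * complex_of_real (\<theta> $ i)) \<le> W" by (simp add: norm_mult)
qed

lemma spherical_mean_has_derivative:
  fixes f :: "real^'n::finite \<Rightarrow> complex"
  assumes w: "w \<in> borel_measurable sphere_measure" "\<And>\<theta>. \<theta> \<in> sphere 0 1 \<Longrightarrow> norm (w \<theta>) \<le> W" and f: "f \<in> schwartz"
  shows "((\<lambda>r. LINT \<theta>|sphere_measure. w \<theta> * f (r *\<^sub>R \<theta>)) has_vector_derivative
     (\<Sum>i\<in>UNIV. LINT \<theta>|sphere_measure. (w \<theta> * complex_of_real (\<theta> $ i)) * partials [i] f (r *\<^sub>R \<theta>))) (at r)"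
proof -
  define f' where "f' r \<theta> = (\<Sum>i\<in>UNIV. (w \<theta> * complex_of_real (\<theta> $ i)) * partials [i] f (r *\<^sub>R \<theta>))" for r \<theta>
  have pf: "partials [i] f \<in> schwartz" for i by (rule schwartz_partials[OF f])
  note wi = sphere_weight_coordinate(1)[OF w(1)] and Wi = sphere_weight_coordinate(2)[of w W, OF w(2)]
  have int: "integrable sphere_measure (\<lambda>\<theta>. (w \<theta> * complex_of_real (\<theta> $ i)) * partials [i] f (r *\<^sub>R \<theta>))" for i r
    by (rule sphere_integrable[OF wi Wi pf])
  have "((\<lambda>r. LINT \<theta>|sphere_measure. w \<theta> * f (r *\<^sub>R \<theta>)) has_vector_derivative (LINT \<theta>|sphere_measure. f' r \<theta>)) (at r)"
  proof (rule has_vector_derivative_integral[where g="\<lambda>_. \<Sum>i\<in>UNIV. W * schwartz_seminorm 0 [] (partials [i] f)"])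
    show "integrable sphere_measure (\<lambda>\<theta>. w \<theta> * f (r *\<^sub>R \<theta>))" for r
      by (rule sphere_integrable[OF w f])
    show "((\<lambda>r. w \<theta> * f (r *\<^sub>R \<theta>)) has_vector_derivative f' r \<theta>) (at r)" for r \<theta>
    proof -
      have "((\<lambda>r. r *\<^sub>R \<theta>) has_derivative (\<lambda>s. s *\<^sub>R \<theta>)) (at r)" by (auto intro!: derivative_eq_intros)
      from diff_chain_at[OF this schwartz_has_derivative[OF f]]
      have "((\<lambda>r. w \<theta> * f (r *\<^sub>R \<theta>)) has_derivative
         (\<lambda>s. w \<theta> * (\<Sum>i\<in>UNIV. (s *\<^sub>R \<theta>) $ i *\<^sub>R partials [i] f (r *\<^sub>R \<theta>)))) (at r)"
        unfolding o_def by (rule has_derivative_mult_right)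
      moreover have "w \<theta> * (\<Sum>i\<in>UNIV. (s *\<^sub>R \<theta>) $ i *\<^sub>R partials [i] f (r *\<^sub>R \<theta>)) = s *\<^sub>R f' r \<theta>" for s
        unfolding f'_def vector_scaleR_component
        by (simp add: scaleR_conv_of_real[where 'a=complex] sum_distrib_left mult_ac del: partials.simps)
      ultimately show ?thesis unfolding has_vector_derivative_def by (simp only:)
    qed
    show "norm (f' r \<theta>) \<le> (\<Sum>i\<in>UNIV. W * schwartz_seminorm 0 [] (partials [i] f))"
        if "\<theta> \<in> space sphere_measure" for r \<theta>
      unfolding f'_def
    proof (rule sum_norm_le)
      fix i
      have "norm (partials [i] f (r *\<^sub>R \<theta>)) \<le> schwartz_seminorm 0 [] (partials [i] f)"
        using schwartz_norm_le[OF pf, of _ _ 0] by simp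
      then show "norm (w \<theta> * complex_of_real (\<theta> $ i) * partials [i] f (r *\<^sub>R \<theta>)) \<le>
          W * schwartz_seminorm 0 [] (partials [i] f)"
        unfolding norm_mult[of "w \<theta> * complex_of_real (\<theta> $ i)"] using Wi[of \<theta> i] that
        by (intro mult_mono) (auto intro: order_trans[OF norm_ge_zero])
    qed
    show "f' r \<in> borel_measurable sphere_measure" for r
      unfolding f'_def by (intro borel_measurable_sum borel_measurable_integrable int)
  qed simp
  then show ?thesis
    unfolding f'_def by (subst (asm) Bochner_Integration.integral_sum) (auto intro: int simp del: partials.simps)
qed

lemma radial_family_derivative:
  assumes "radial_family (\<Phi> :: (real^'n::finite \<Rightarrow> complex) \<Rightarrow> real \<Rightarrow> complex)"
  shows "\<exists>\<Phi>'. radial_family \<Phi>' \<and> (\<forall>g\<in>schwartz. \<forall>r. (\<Phi> g has_vector_derivative \<Phi>' g r) (at r))"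
  using assms
proof induction
  case (base w W m js)
  let ?B = "\<lambda>w js g r. LINT \<theta>|sphere_measure. w \<theta> * partials js g (r *\<^sub>R (\<theta> :: real^'n))"
  \<comment> \<open>For \<open>m = 0\<close> the exponent \<open>m - 1\<close> is harmless because the summand has the factor \<open>m\<close>.\<close>
  let ?\<Phi>' = "\<lambda>g r. complex_of_real (real m) * (complex_of_real (r ^ (m - 1)) * ?B w js g r) +
     (\<Sum>i\<in>UNIV. complex_of_real (r ^ m) * ?B (\<lambda>\<theta>. w \<theta> * complex_of_real (\<theta> $ i)) (i # js) g r)"
  note wi = sphere_weight_coordinate(1)[OF base(1)] and Wi = sphere_weight_coordinate(2)[of w W, OF base(2)]
  show ?case
  proof (intro exI[of _ ?\<Phi>'] conjI ballI allI)
    show "radial_family ?\<Phi>'"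
      by (intro radial_family.add radial_family_cmult radial_family_sum radial_family.base[OF base]
          radial_family.base[OF wi Wi]) auto
    fix g r assume g: "g \<in> (schwartz :: (real^'n \<Rightarrow> complex) set)"
    have "((\<lambda>r. complex_of_real (r ^ m)) has_vector_derivative complex_of_real (real m * r ^ (m - 1))) (at r)"
      unfolding has_vector_derivative_def scaleR_conv_of_real[where 'a=complex]
      by (auto intro!: derivative_eq_intros simp: mult_ac)
    from has_vector_derivative_mult[OF this spherical_mean_has_derivative[OF base schwartz_partials[OF g, of js], of
        r]]
    show "((\<lambda>r. complex_of_real (r ^ m) * ?B w js g r) has_vector_derivative ?\<Phi>' g r) (at r)"
      by (simp add: sum_distrib_left add.commute mult.assoc)
  qed
next
  case (add \<Phi> \<Psi>)
  then obtain \<Phi>' \<Psi>' where "radial_family \<Phi>'" "\<forall>g\<in>schwartz. \<forall>r. (\<Phi> g has_vector_derivative \<Phi>' g r) (at r)"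
    "radial_family \<Psi>'" "\<forall>g\<in>schwartz. \<forall>r. (\<Psi> g has_vector_derivative \<Psi>' g r) (at r)" by blast
  then show ?case
    by (intro exI[of _ "\<lambda>g r. \<Phi>' g r + \<Psi>' g r"] conjI radial_family.add) (auto intro: has_vector_derivative_add)
qed

lemma radial_family_continuous:
  assumes "radial_family \<Phi>" "g \<in> schwartz"
  shows "continuous_on UNIV (\<Phi> g)"
proof -
  obtain \<Phi>' where "\<forall>r. (\<Phi> g has_vector_derivative \<Phi>' g r) (at r)"
    using radial_family_derivative[OF assms(1)] assms(2) by blast
  then show ?thesis
    by (intro continuous_at_imp_continuous_on ballI has_vector_derivative_continuous) blast
qed

lemma radial_family_decay:
  assumes "radial_family (\<Phi> :: (real^'n::finite \<Rightarrow> complex) \<Rightarrow> real \<Rightarrow> complex)"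
  shows "\<exists>q. seminorm_bounded q \<and> (\<forall>g\<in>schwartz. \<forall>r\<ge>0. (1 + r) ^ N * norm (\<Phi> g r) \<le> q g)"
  using assms
proof induction
  case (base w W m js)
  let ?B = "\<lambda>g r. LINT \<theta>|sphere_measure. w \<theta> * partials js g (r *\<^sub>R (\<theta> :: real^'n))"
  let ?S = "measure sphere_measure (sphere 0 1 :: (real^'n) set)"
  show ?case
  proof (intro exI conjI ballI allI impI)
    have W: "0 \<le> W" using base(2)[of "axis undefined 1"]
        by (auto simp: norm_axis_1 intro: order_trans[OF norm_ge_zero])
    show "seminorm_bounded (\<lambda>g. (?S * W) * schwartz_seminorm (N + m) js g)"
      using W by (intro seminorm_bounded_mult seminorm_bounded_seminorm) auto
    fix g :: "real^'n \<Rightarrow> complex" and r :: real assume g: "g \<in> schwartz" and r: "0 \<le> r"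
    let ?s = "schwartz_seminorm (N + m) js g"
    have pos: "0 < (1 + r) ^ (N + m)" using r by simp
    have "norm (?B g r) \<le> (LINT \<theta>|sphere_measure. norm (w \<theta> * partials js g (r *\<^sub>R \<theta>)))"
      by (rule integral_norm_bound)
    also have "\<dots> \<le> (LINT \<theta>|(sphere_measure :: (real^'n) measure). W * (?s / (1 + r) ^ (N + m)))"
    proof (rule integral_mono)
      show "integrable sphere_measure (\<lambda>\<theta>. norm (w \<theta> * partials js g (r *\<^sub>R \<theta>)))"
        by (intro integrable_norm sphere_integrable[OF base] schwartz_partials g)
      fix \<theta> :: "real^'n" assume \<theta>: "\<theta> \<in> space sphere_measure"
      then have "norm (r *\<^sub>R \<theta>) = r" using r by simp
      then have "norm (partials js g (r *\<^sub>R \<theta>)) \<le> ?s / (1 + r) ^ (N + m)"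
        using schwartz_seminorm_upper[OF g, of "r *\<^sub>R \<theta>" "N + m" js] pos by (simp add: field_simps)
      then show "norm (w \<theta> * partials js g (r *\<^sub>R \<theta>)) \<le> W * (?s / (1 + r) ^ (N + m))"
        unfolding norm_mult using base(2)[of \<theta>] \<theta> W by (intro mult_mono) auto
    qed simp
    also have "\<dots> = ?S * W * ?s / (1 + r) ^ (N + m)" by simp
    finally have "(1 + r) ^ (N + m) * norm (?B g r) \<le> ?S * W * ?s"
      using pos by (simp add: field_simps)
    moreover have "(1 + r) ^ N * norm (complex_of_real (r ^ m) * (?B g r))
      \<le> (1 + r) ^ N * ((1 + r) ^ m * norm (?B g r))"
      using r by (intro mult_left_mono) (auto simp: norm_mult norm_power intro!: mult_right_mono power_mono)
    ultimately show "(1 + r) ^ N * norm (complex_of_real (r ^ m) * (?B g r)) \<le> ?S * W * ?s"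
      by (simp add: power_add mult.assoc)
  qed
next
  case (add \<Phi> \<Psi>)
  then obtain q s where q: "seminorm_bounded q" "\<And>g r. g\<in>schwartz \<Longrightarrow> 0 \<le> r \<Longrightarrow> (1 + r) ^ N * norm (\<Phi> g r) \<le> q g"
    and s: "seminorm_bounded s" "\<And>g r. g\<in>schwartz \<Longrightarrow> 0 \<le> r \<Longrightarrow> (1 + r) ^ N * norm (\<Psi> g r) \<le> s g" by blast
  have "(1 + r) ^ N * norm (\<Phi> g r + \<Psi> g r) \<le> q g + s g" if "g \<in> schwartz" "0 \<le> r" for g r
  proof -
    have "(1 + r) ^ N * norm (\<Phi> g r + \<Psi> g r) \<le> (1 + r) ^ N * (norm (\<Phi> g r) + norm (\<Psi> g r))"
      using that by (intro mult_left_mono norm_triangle_ineq) auto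
    also have "\<dots> \<le> q g + s g" unfolding distrib_left by (intro add_mono q s that)
    finally show ?thesis .
  qed
  then show ?case
    using seminorm_bounded_add[OF q(1) s(1)] by (intro exI[of _ "\<lambda>g. q g + s g"]) auto
qed

section \<open>Iterated derivatives on the half-line\<close>

lemma at_within_halfline_nontrivial: "(r::real) \<ge> 0 \<Longrightarrow> at r within {0..} \<noteq> bot"
proof -
  assume r: "0 \<le> r"
  have ne: "{0::real..} \<noteq> {x}" for x
  proof
    assume eq: "{0..} = {x}"
    have "0 \<in> {x}" "1 \<in> {x}" unfolding eq[symmetric] by auto
    then show False by simp
  qed
  have "r islimpt {0..}" using r by (intro connected_imp_perfect ne) auto
  then show ?thesis by (simp add: trivial_limit_within)
qed

text \<open>The one-sided iterated derivatives are those of any two-sided chain of derivatives, because a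
derivative within the half-line is unique, also at its end point.\<close>

lemma halfline_deriv_eq:
  assumes "\<And>i r. i < j \<Longrightarrow> 0 \<le> r \<Longrightarrow> (h i has_vector_derivative h (Suc i) r) (at r)"
  shows "0 \<le> r \<Longrightarrow> halfline_deriv j (h 0) r = h j r"
  using assms
proof (induction j arbitrary: r)
  case 0
  then show ?case by (simp add: halfline_deriv_def)
next
  case (Suc j)
  have "(h j has_vector_derivative h (Suc j) r) (at r within {0..})"
    by (rule has_vector_derivative_at_within[OF Suc.prems(2)]) (use Suc.prems(1) in auto)
  moreover have "halfline_deriv j (h 0) s = h j s" if "0 \<le> s" for s
    by (rule Suc.IH[OF that Suc.prems(2)]) auto
  ultimately have "(halfline_deriv j (h 0) has_vector_derivative h (Suc j) r) (at r within {0..})"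
    using Suc.prems(1) by (intro has_vector_derivative_transform[of r "{0..}" "halfline_deriv j (h 0)" "h j"])
        simp_all
  then have "vector_derivative (halfline_deriv j (h 0)) (at r within {0..}) = h (Suc j) r"
    using at_within_halfline_nontrivial[OF Suc.prems(1)] by (rule vector_derivative_within[rotated])
  then show ?case by (simp add: halfline_deriv_def)
qed

lemma halfline_deriv_differentiable:
  assumes "\<And>i r. i \<le> j \<Longrightarrow> 0 \<le> r \<Longrightarrow> (h i has_vector_derivative h (Suc i) r) (at r)" "0 \<le> r"
  shows "halfline_deriv j (h 0) differentiable (at r within {0..})"
proof -
  have "(h j has_vector_derivative h (Suc j) r) (at r within {0..})"
    by (rule has_vector_derivative_at_within[OF assms(1)]) (use assms(2) in auto)
  moreover have "halfline_deriv j (h 0) s = h j s" if "0 \<le> s" for s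
    by (rule halfline_deriv_eq[where h=h and j=j]) (use assms(1) that in auto)
  ultimately have "(halfline_deriv j (h 0) has_vector_derivative h (Suc j) r) (at r within {0..})"
    using assms(2) by (intro has_vector_derivative_transform[of r "{0..}" "halfline_deriv j (h 0)" "h j"]) simp_all
  then show ?thesis by (auto simp: has_vector_derivative_def differentiable_def)
qed

lemma radial_family_derivatives:
  assumes "radial_family (\<Phi> :: (real^'n::finite \<Rightarrow> complex) \<Rightarrow> real \<Rightarrow> complex)"
  obtains P where "P 0 = \<Phi>" "\<And>j. radial_family (P j)"
    "\<And>j g r. g \<in> schwartz \<Longrightarrow> (P j g has_vector_derivative P (Suc j) g r) (at r)"
proof -
  have "\<exists>P. \<forall>j. (radial_family (P j) \<and> (j = 0 \<longrightarrow> P j = \<Phi>)) \<and>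
     (\<forall>g\<in>schwartz. \<forall>r. (P j g has_vector_derivative P (Suc j) g r) (at r))"
    by (rule dependent_nat_choice[where P="\<lambda>j \<Psi>. radial_family \<Psi> \<and> (j = 0 \<longrightarrow> \<Psi> = \<Phi>)"
      and Q="\<lambda>j \<Psi> \<Psi>'. \<forall>g\<in>schwartz. \<forall>r. (\<Psi> g has_vector_derivative \<Psi>' g r) (at r)"])
      (use assms radial_family_derivative in auto)
  then show ?thesis using that by blast
qed

text \<open>If \<open>h = r\<^sup>m \<Phi>\<close>, then for \<open>j \<le> m\<close> the \<open>j\<close>-th derivative of \<open>h\<close> is \<open>r\<^sup>m\<^sup>-\<^sup>j C\<^sub>j\<close> where
\<open>C\<^sub>j\<^sub>+\<^sub>1 = (m - j) C\<^sub>j + r C\<^sub>j'\<close> is again in the family.  The explicit power of \<open>r\<close> is what kills the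
boundary terms at \<open>0\<close> in the integration by parts.\<close>

lemma radial_family_vanishing_derivatives:
  assumes "radial_family (\<Phi> :: (real^'n::finite \<Rightarrow> complex) \<Rightarrow> real \<Rightarrow> complex)"
  obtains C where "C 0 = \<Phi>" "\<And>j. radial_family (C j)"
    "\<And>j g r. j < m \<Longrightarrow> g \<in> schwartz \<Longrightarrow>
      ((\<lambda>r. complex_of_real (r ^ (m - j)) * C j g r) has_vector_derivative complex_of_real (r ^ (m - Suc j)) * C
          (Suc j) g r) (at r)"
proof -
  let ?Q = "\<lambda>j \<Psi> \<Psi>'. j < m \<longrightarrow> (\<forall>g\<in>schwartz. \<forall>r. ((\<lambda>r. complex_of_real (r ^ (m - j)) * \<Psi> g r) has_vector_derivative
      complex_of_real (r ^ (m - Suc j)) * \<Psi>' g r) (at r))"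
  have step: "\<exists>\<Psi>'. radial_family \<Psi>' \<and> ?Q j \<Psi> \<Psi>'" if \<Psi>: "radial_family \<Psi>" for j and
      \<Psi> :: "(real^'n \<Rightarrow> complex) \<Rightarrow> real \<Rightarrow> complex"
  proof -
    obtain D where D: "radial_family D" "\<forall>g\<in>schwartz. \<forall>r. (\<Psi> g has_vector_derivative D g r) (at r)"
      using radial_family_derivative[OF \<Psi>] by blast
    \<comment> \<open>the product rule for \<open>r\<^sup>m\<^sup>-\<^sup>j \<Psi>\<close>, divided by \<open>r\<^sup>m\<^sup>-\<^sup>j\<^sup>-\<^sup>1\<close>\<close>
    let ?\<Psi>' = "\<lambda>g r. complex_of_real (real (m - j)) * \<Psi> g r + complex_of_real r * D g r"
    have "radial_family ?\<Psi>'" by (intro radial_family.add radial_family_cmult radial_family_times_r \<Psi> D)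
    moreover have "?Q j \<Psi> ?\<Psi>'"
    proof (intro impI ballI allI)
      fix g r assume j: "j < m" and g: "g \<in> (schwartz :: (real^'n \<Rightarrow> complex) set)"
      obtain l where l: "m - j = Suc l" "m - Suc j = l" using j by (metis Suc_diff_Suc)
      have "((\<lambda>r. complex_of_real (r ^ Suc l)) has_vector_derivative complex_of_real (real (Suc l) * r ^ l)) (at r)"
        unfolding has_vector_derivative_def scaleR_conv_of_real[where 'a=complex]
        by (auto intro!: derivative_eq_intros simp: mult_ac simp del: power_Suc of_nat_Suc)
      from has_vector_derivative_mult[OF this D(2)[rule_format, OF g, of r]]
      show "((\<lambda>r. complex_of_real (r ^ (m - j)) * \<Psi> g r) has_vector_derivative
          complex_of_real (r ^ (m - Suc j)) * ?\<Psi>' g r) (at r)"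
        unfolding l by (simp add: algebra_simps)
    qed
    ultimately show ?thesis by blast
  qed
  have "\<exists>C. \<forall>j. (radial_family (C j) \<and> (j = 0 \<longrightarrow> C j = \<Phi>)) \<and> ?Q j (C j) (C (Suc j))"
    by (rule dependent_nat_choice[where P="\<lambda>j \<Psi>. radial_family \<Psi> \<and> (j = 0 \<longrightarrow> \<Psi> = \<Phi>)" and Q="?Q"])
      (use assms step in auto)
  then show ?thesis using that by blast
qed

section \<open>Integration against the logarithm\<close>

lemma set_integrable_neg_ln: "set_integrable lborel {0<..<1} (\<lambda>u::real. - ln u)"
proof -
  have "set_integrable lborel (einterval 0 1) (\<lambda>u::real. - ln u)"
  proof (rule interval_integral_FTC_nonneg(1)[where F="\<lambda>u. u - u * ln u" and A=0 and B=1])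
    show "DERIV (\<lambda>u. u - u * ln u) u :> - ln u" if "0 < ereal u" "ereal u < 1" for u :: real
      using that by (auto intro!: derivative_eq_intros)
    show "isCont (\<lambda>u. - ln u) u" if "0 < ereal u" "ereal u < 1" for u :: real
      using that by (intro continuous_intros) auto
    show "AE u in lborel. 0 < ereal u \<longrightarrow> ereal u < 1 \<longrightarrow> 0 \<le> - ln u"
      by (intro AE_I2) (auto simp: one_ereal_def)
    have "((\<lambda>u::real. u - u * ln u) \<longlongrightarrow> 0) (at_right 0)" by real_asymp
    then show "(((\<lambda>u. u - u * ln u) \<circ> real_of_ereal) \<longlongrightarrow> 0) (at_right 0)"
      by (simp add: ereal_tendsto_simps zero_ereal_def)
    have "((\<lambda>u::real. u - u * ln u) \<longlongrightarrow> 1) (at_left 1)"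
      by real_asymp
    then show "(((\<lambda>u. u - u * ln u) \<circ> real_of_ereal) \<longlongrightarrow> 1) (at_left 1)"
      by (simp add: ereal_tendsto_simps one_ereal_def)
  qed auto
  then show ?thesis by (simp add: einterval_def greaterThanLessThan_def greaterThan_def lessThan_def Int_def
      zero_ereal_def one_ereal_def)
qed

lemma set_integrable_inverse_square: "set_integrable lborel {0<..} (\<lambda>u::real. 1 / (1 + u)\<^sup>2)"
proof -
  have "set_integrable lborel {0..} (\<lambda>u::real. 1 / (1 + u)\<^sup>2)"
    using integrable_halfline_inverse_square unfolding set_integrable_def
    by (subst (asm) integrable_restrict_space) auto
  then show ?thesis by (rule set_integrable_subset) auto
qed

lemma set_integrable_ln_inverse_cube: "set_integrable lborel {0<..} (\<lambda>u::real. ln u / (1 + u) ^ 3)"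
proof -
  have "set_integrable lborel {0<..<1} (\<lambda>u::real. ln u / (1 + u) ^ 3)"
  proof (rule set_integrable_bound[OF set_integrable_neg_ln])
    show "AE u in (lborel :: real measure). u \<in> {0<..<1} \<longrightarrow> norm (ln u / (1 + u) ^ 3) \<le> norm (- ln u)"
    proof (intro AE_I2 impI)
      fix u :: real assume u: "u \<in> {0<..<1}"
      then have "1 \<le> (1 + u) ^ 3" by (intro one_le_power) auto
      then have "\<bar>ln u\<bar> / (1 + u) ^ 3 \<le> \<bar>ln u\<bar> / 1" using u by (intro divide_left_mono) auto
      then show "norm (ln u / (1 + u) ^ 3) \<le> norm (- ln u)" using u by simp
    qed
  qed (simp add: set_borel_measurable_def)
  moreover have "set_integrable lborel {1..} (\<lambda>u::real. ln u / (1 + u) ^ 3)"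
  proof (rule set_integrable_bound[OF set_integrable_subset[OF set_integrable_inverse_square]])
    show "AE u in (lborel :: real measure). u \<in> {1..} \<longrightarrow> norm (ln u / (1 + u) ^ 3) \<le> norm (1 / (1 + u)\<^sup>2)"
    proof (intro AE_I2 impI)
      fix u :: real assume u: "u \<in> {1..}"
      then have "ln u \<le> 1 + u" "0 \<le> ln u" using ln_bound[of u] by auto
      then have "ln u / (1 + u) ^ 3 \<le> (1 + u) / (1 + u) ^ 3" using u by (intro divide_right_mono) auto
      also have "\<dots> = 1 / (1 + u)\<^sup>2" using u by (simp add: power2_eq_square power3_eq_cube)
      finally show "norm (ln u / (1 + u) ^ 3) \<le> norm (1 / (1 + u)\<^sup>2)" using u by simp
    qed
  qed (auto simp: set_borel_measurable_def)
  ultimately have "set_integrable lborel ({0<..<1} \<union> {1..}) (\<lambda>u::real. ln u / (1 + u) ^ 3)"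
    by (rule set_integrable_Un) auto
  moreover have "{0<..<1} \<union> {1..} = {0::real<..}" by auto
  ultimately show ?thesis by simp
qed

text \<open>The decay of \<open>h\<close> reduces both claims to the weight \<open>|ln u| / (1 + u)\<^sup>3\<close>, which is integrable at \<open>0\<close>
because \<open>ln\<close> is, and at infinity because it is \<open>O(u\<^sup>-\<^sup>2)\<close>.\<close>

lemma decaying_times_ln:
  fixes h :: "real \<Rightarrow> complex"
  assumes cont: "continuous_on {0<..} h" and bound: "\<And>u. 0 < u \<Longrightarrow> (1 + u) ^ 3 * norm (h u) \<le> B"
  shows "set_integrable lborel {0<..} (\<lambda>u. complex_of_real (ln u) * h u)"
    and "norm (LBINT u:{0<..}. complex_of_real (ln u) * h u) \<le> B * (LBINT u:{0<..}. \<bar>ln u / (1 + u) ^ 3\<bar>)"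
proof -
  let ?l = "\<lambda>u::real. \<bar>ln u / (1 + u) ^ 3\<bar>"
  have l: "set_integrable lborel {0<..} ?l"
    using set_integrable_abs[OF set_integrable_ln_inverse_cube] .
  have le: "norm (complex_of_real (ln u) * h u) \<le> B * ?l u" if "0 < u" for u
  proof -
    have "norm (h u) \<le> B / (1 + u) ^ 3"
      using bound[OF that] that by (simp add: pos_le_divide_eq mult.commute)
    from mult_left_mono[OF this, of "\<bar>ln u\<bar>"] show ?thesis
      using that by (simp add: norm_mult abs_mult mult.commute)
  qed
  have meas: "set_borel_measurable lborel {0<..} (\<lambda>u. complex_of_real (ln u) * h u)"
    unfolding set_borel_measurable_def
    using cont by (subst measurable_lborel2, intro borel_measurable_continuous_on_indicator continuous_intros) auto
  have Bl: "set_integrable lborel {0<..} (\<lambda>u. B * ?l u)" by (intro set_integrable_mult_right l)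
  show int: "set_integrable lborel {0<..} (\<lambda>u. complex_of_real (ln u) * h u)"
  proof (rule set_integrable_bound[OF Bl meas], intro AE_I2 impI)
    fix u :: real assume "u \<in> {0<..}"
    then show "norm (complex_of_real (ln u) * h u) \<le> norm (B * ?l u)"
      using le[of u] abs_ge_self[of "B * ?l u"] unfolding real_norm_def by simp
  qed
  have "norm (LBINT u:{0<..}. complex_of_real (ln u) * h u) \<le> (LBINT u:{0<..}. norm (complex_of_real (ln u) * h u))"
    by (rule set_integral_norm_bound[OF int])
  also have "\<dots> \<le> (LBINT u:{0<..}. B * ?l u)"
    by (rule set_integral_mono[OF set_integrable_norm[OF int] Bl]) (use le in auto)
  also have "\<dots> = B * (LBINT u:{0<..}. ?l u)" by (rule set_integral_mult_right)
  finally show "norm (LBINT u:{0<..}. complex_of_real (ln u) * h u) \<le> B * (LBINT u:{0<..}. ?l u)" .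
qed

lemma decaying_set_integrable:
  fixes h :: "real \<Rightarrow> complex"
  assumes cont: "continuous_on {0<..} h" and bound: "\<And>u. 0 < u \<Longrightarrow> (1 + u) ^ 2 * norm (h u) \<le> B"
  shows "set_integrable lborel {0<..} h"
proof (rule set_integrable_bound[OF set_integrable_mult_right[OF set_integrable_inverse_square, of B]])
  show "set_borel_measurable lborel {0<..} h"
    unfolding set_borel_measurable_def
    using cont by (subst measurable_lborel2, intro borel_measurable_continuous_on_indicator) auto
  have "norm (h u) \<le> B * (1 / (1 + u)\<^sup>2)" if "0 < u" for u
    using bound[OF that] that by (simp add: field_simps)
  then have "norm (h u) \<le> norm (B * (1 / (1 + u)\<^sup>2))" if "0 < u" for u
    unfolding real_norm_def using that by (meson abs_ge_self order_trans)
  then show "AE u in lborel. u \<in> {0<..} \<longrightarrow> norm (h u) \<le> norm (B * (1 / (1 + u)\<^sup>2))"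
    by (intro AE_I2) simp
qed

fun ln_deriv :: "nat \<Rightarrow> real \<Rightarrow> real" where
  "ln_deriv 0 u = ln u"
| "ln_deriv (Suc j) u = (-1) ^ j * fact j / u ^ Suc j"

lemma ln_deriv_has_derivative:
  assumes "0 < u"
  shows "((\<lambda>u. complex_of_real (ln_deriv j u)) has_vector_derivative complex_of_real (ln_deriv (Suc j) u)) (at u)"
proof -
  have "DERIV (ln_deriv j) u :> ln_deriv (Suc j) u"
  proof (cases j)
    case 0
    have "ln_deriv 0 = ln" by (rule ext) simp
    then show ?thesis using assms 0 by (auto intro!: derivative_eq_intros)
  next
    case (Suc i)
    have e: "ln_deriv (Suc i) = (\<lambda>u. (-1) ^ i * fact i * inverse u ^ Suc i)"
      by (rule ext) (simp add: field_simps)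
    have "DERIV (\<lambda>u. (-1) ^ i * fact i * inverse u ^ Suc i) u :>
        (-1) ^ i * fact i * (real (Suc i) * (- (inverse u * 1 * inverse u) * inverse u ^ (Suc i - Suc 0)))"
      using assms by (intro DERIV_cmult DERIV_power DERIV_inverse' DERIV_ident) auto
    also have "(-1) ^ i * fact i * (real (Suc i) * (- (inverse u * 1 * inverse u) * inverse u ^ (Suc i - Suc 0)))
       = ln_deriv (Suc (Suc i)) u"
      using assms by (simp add: field_simps)
    finally show ?thesis unfolding Suc e .
  qed
  then have "(ln_deriv j has_vector_derivative ln_deriv (Suc j) u) (at u)"
    by (simp add: has_real_derivative_iff_has_vector_derivative)
  then show ?thesis by (rule bounded_linear.has_vector_derivative[OF bounded_linear_of_real])
qed

lemma ln_deriv_at_zero: "((\<lambda>u. ln_deriv j u * u ^ Suc j) \<longlongrightarrow> 0) (at_right 0)"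
proof (cases j)
  case 0
  have "((\<lambda>u::real. ln u * u) \<longlongrightarrow> 0) (at_right 0)" by real_asymp
  then show ?thesis using 0 by simp
next
  case (Suc i)
  have "((\<lambda>u::real. (-1) ^ i * fact i * u) \<longlongrightarrow> (-1) ^ i * fact i * 0) (at_right 0)"
    by (intro tendsto_intros)
  moreover have "\<forall>\<^sub>F u in at_right (0::real). (-1) ^ i * fact i * u = ln_deriv j u * u ^ Suc j"
    unfolding eventually_at_right_field using Suc by (intro exI[of _ 1]) auto
  ultimately show ?thesis by (simp add: tendsto_cong)
qed

lemma ln_deriv_at_infinity: "((\<lambda>u. ln_deriv j u / (1 + u)\<^sup>2) \<longlongrightarrow> 0) at_top"
proof (cases j)
  case 0
  have "((\<lambda>u::real. ln u / (1 + u)\<^sup>2) \<longlongrightarrow> 0) at_top" by real_asymp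
  then show ?thesis using 0 by simp
next
  case (Suc i)
  have "((\<lambda>u::real. fact i / (1 + u)\<^sup>2) \<longlongrightarrow> 0) at_top" by real_asymp
  moreover have "\<forall>\<^sub>F u in at_top. norm (ln_deriv j u / (1 + u)\<^sup>2) \<le> fact i / (1 + u)\<^sup>2"
    using eventually_ge_at_top[of 1]
  proof eventually_elim
    case (elim u)
    have "fact i / u ^ Suc i \<le> fact i / 1"
      using elim one_le_power[of u "Suc i"] by (intro divide_left_mono) auto
    from divide_right_mono[OF this, of "(1 + u)\<^sup>2"] show ?case
      unfolding Suc using elim by (simp add: abs_mult power_abs)
  qed
  ultimately show ?thesis by (rule Lim_null_comparison[rotated])
qed

text \<open>Integrating by parts \<open>k\<close> times moves all derivatives from \<open>h\<close> to the logarithm, whose \<open>k\<close>-th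
derivative is \<open>(-1)\<^sup>k\<^sup>-\<^sup>1 (k-1)! u\<^sup>-\<^sup>k\<close>; together with the sign \<open>(-1)\<^sup>k\<close> of the integrations this gives
\<open>- (k-1)! u\<^sup>-\<^sup>k h\<close>.  All steps are done at once: the alternating sum \<open>H\<close> of products of derivatives
is a primitive of \<open>ln u h\<^sup>(\<^sup>k\<^sup>) + (k-1)! u\<^sup>-\<^sup>k h\<close> and tends to \<open>0\<close> at both ends.\<close>

lemma integral_ln_derivative:
  fixes h :: "nat \<Rightarrow> real \<Rightarrow> complex" and C :: "nat \<Rightarrow> real \<Rightarrow> complex"
  assumes k: "0 < k" "k \<le> m"
    and h: "\<And>j u. j \<le> k \<Longrightarrow> h j u = complex_of_real (u ^ (m - j)) * C j u"
    and C: "\<And>j. continuous_on UNIV (C j)"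
    and der: "\<And>j u. j < k \<Longrightarrow> (h j has_vector_derivative h (Suc j) u) (at u)"
    and decay: "\<And>j N. \<exists>B. \<forall>u\<ge>0. (1 + u) ^ N * norm (C j u) \<le> B"
  shows "(LBINT u:{0<..}. complex_of_real (ln u) * h k u) =
    - (fact (k - 1)) * (LBINT u:{0<..}. complex_of_real (u ^ (m - k)) * C 0 u)"
proof -
  let ?t = "\<lambda>j u. (-1) ^ j * complex_of_real (ln_deriv j u) * h (k - 1 - j) u"
  define H where "H u = (\<Sum>j<k. ?t j u)" for u
  define I where "I u = complex_of_real (ln u) * h k u + fact (k - 1) * (complex_of_real (u ^ (m - k)) * C 0 u)" for u
  have hcont: "continuous_on UNIV (h j)" if "j \<le> k" for j
  proof -
    have "h j = (\<lambda>u. complex_of_real (u ^ (m - j)) * C j u)" using h[OF that] by auto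
    then show ?thesis by (simp add: continuous_intros C)
  qed
  have hdecay: "\<exists>B. \<forall>u\<ge>0. (1 + u) ^ N * norm (complex_of_real (u ^ l) * C j u) \<le> B" for j N l
  proof -
    obtain B where B: "\<forall>u\<ge>0. (1 + u) ^ (N + l) * norm (C j u) \<le> B" using decay by blast
    have "(1 + u) ^ N * norm (complex_of_real (u ^ l) * C j u) \<le> B" if "0 \<le> u" for u
    proof -
      have "(1 + u) ^ N * norm (complex_of_real (u ^ l) * C j u) = (1 + u) ^ N * (u ^ l * norm (C j u))"
        using that by (simp add: norm_mult norm_power)
      also have "\<dots> \<le> (1 + u) ^ N * ((1 + u) ^ l * norm (C j u))"
        using that by (intro mult_left_mono mult_right_mono power_mono) auto
      also have "\<dots> = (1 + u) ^ (N + l) * norm (C j u)" by (simp add: power_add)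
      also have "\<dots> \<le> B" using B that by blast
      finally show ?thesis .
    qed
    then show ?thesis by blast
  qed
  have Hder: "(H has_vector_derivative I u) (at u)" if "0 < u" for u
  proof -
    \<comment> \<open>Each summand of \<open>H\<close> has derivative \<open>a j - a (j + 1)\<close>, so the derivative of \<open>H\<close> telescopes.\<close>
    define a where "a j = (-1) ^ j * complex_of_real (ln_deriv j u) * h (k - j) u" for j
    have "((\<lambda>u. ?t j u) has_vector_derivative a j - a (Suc j)) (at u)"
      if j: "j < k" for j
    proof -
      have s: "Suc (k - 1 - j) = k - j" "k - Suc j = k - 1 - j" using j by auto
      have "((\<lambda>u. ((-1) ^ j * complex_of_real (ln_deriv j u)) * h (k - 1 - j) u) has_vector_derivative
          ((-1) ^ j * complex_of_real (ln_deriv j u)) * h (Suc (k - 1 - j)) u +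
          ((-1) ^ j * complex_of_real (ln_deriv (Suc j) u)) * h (k - 1 - j) u) (at u)"
        using j by (intro has_vector_derivative_mult has_vector_derivative_mult_right ln_deriv_has_derivative \<open>0 <
            u\<close> der) auto
      then show ?thesis unfolding a_def s by (simp del: ln_deriv.simps)
    qed
    then have "(H has_vector_derivative (\<Sum>j<k. a j - a (Suc j))) (at u)"
      unfolding H_def by (intro has_vector_derivative_sum) auto
    also have "(\<Sum>j<k. a j - a (Suc j)) = a 0 - a k" by (rule sum_lessThan_telescope')
    also have "a 0 - a k = I u"
    proof -
      obtain l where l: "k = Suc l" using k(1) by (cases k) auto
      have "(-1::complex) ^ k * complex_of_real (ln_deriv k u) = - (fact l / complex_of_real (u ^ k))"
        unfolding l by (simp add: power_mult_distrib[symmetric] flip: power_add)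
      then have "a k = - (fact l / complex_of_real (u ^ k)) * (complex_of_real (u ^ m) * C 0 u)"
        unfolding a_def using h[of 0 u] by simp
      also have "complex_of_real (u ^ m) = complex_of_real (u ^ k) * complex_of_real (u ^ (m - k))"
        using k(2) by (simp flip: of_real_mult power_add)
      finally show ?thesis using \<open>0 < u\<close> unfolding a_def I_def l by simp
    qed
    finally show ?thesis .
  qed
  have int1: "set_integrable lborel {0<..} (\<lambda>u. complex_of_real (ln u) * h k u)"
  proof -
    obtain B where "\<forall>u\<ge>0. (1 + u) ^ 3 * norm (complex_of_real (u ^ (m - k)) * C k u) \<le> B"
      using hdecay by blast
    then show ?thesis
      using h[of k] continuous_on_subset[OF hcont[of k]] by (intro decaying_times_ln(1)[where B=B]) auto
  qed
  have int2: "set_integrable lborel {0<..} (\<lambda>u. complex_of_real (u ^ (m - k)) * C 0 u)"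
  proof -
    obtain B where "\<forall>u\<ge>0. (1 + u) ^ 2 * norm (complex_of_real (u ^ (m - k)) * C 0 u) \<le> B"
      using hdecay by blast
    then show ?thesis
      by (intro decaying_set_integrable[where B=B] continuous_intros continuous_on_subset[OF C]) auto
  qed
  have intI: "set_integrable lborel {0<..} I"
    unfolding I_def by (intro set_integral_add int1 set_integrable_mult_right int2)
  have H0: "(H \<longlongrightarrow> 0) (at_right 0)"
    unfolding H_def
  proof (rule tendsto_null_sum)
    fix j assume "j \<in> {..<k}"
    then have j: "j < k" by simp
    define i where "i = k - 1 - j"
    have i: "i \<le> k" "m - i = (m - k) + Suc j" using j k by (auto simp: i_def)
    \<comment> \<open>The factor \<open>u\<^sup>j\<^sup>+\<^sup>1\<close> of \<open>h i\<close> beats the singularity of the \<open>j\<close>-th derivative of \<open>ln\<close>.\<close>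
    have hi: "h i = (\<lambda>u. complex_of_real (u ^ (m - k)) * complex_of_real (u ^ Suc j) * C i u)"
      using h[OF i(1)] unfolding i(2) by (intro ext) (simp add: power_add)
    have "((\<lambda>u. (-1) ^ j * complex_of_real (ln_deriv j u * u ^ Suc j) * (complex_of_real (u ^ (m - k)) * C i u)) \<longlongrightarrow>
       (-1) ^ j * complex_of_real 0 * (complex_of_real (0 ^ (m - k)) * C i 0)) (at_right 0)"
      using C[of i]
      by (intro tendsto_mult tendsto_const tendsto_of_real ln_deriv_at_zero tendsto_power tendsto_ident_at)
        (auto simp: continuous_on_eq_continuous_at isCont_def intro: tendsto_within_subset)
    then show "((\<lambda>u. ?t j u) \<longlongrightarrow> 0) (at_right 0)"
      unfolding i_def[symmetric] hi by (simp add: mult_ac del: ln_deriv.simps)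
  qed
  have Hinf: "(H \<longlongrightarrow> 0) at_top"
    unfolding H_def
  proof (rule tendsto_null_sum)
    fix j assume "j \<in> {..<k}"
    obtain B where B: "\<forall>u\<ge>0. (1 + u) ^ 2 * norm (complex_of_real (u ^ (m - (k - 1 - j))) * C (k - 1 - j) u) \<le> B"
      using hdecay by blast
    show "((\<lambda>u. ?t j u) \<longlongrightarrow> 0) at_top"
    proof (rule Lim_null_comparison)
      show "((\<lambda>u. B * \<bar>ln_deriv j u / (1 + u)\<^sup>2\<bar>) \<longlongrightarrow> 0) at_top"
        by (intro tendsto_mult_right_zero tendsto_rabs_zero ln_deriv_at_infinity)
      show "\<forall>\<^sub>F u in at_top. norm (?t j u) \<le> B * \<bar>ln_deriv j u / (1 + u)\<^sup>2\<bar>"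
        using eventually_ge_at_top[of 0]
      proof eventually_elim
        case (elim u)
        have "norm (h (k - 1 - j) u) \<le> B / (1 + u)\<^sup>2"
          using B elim h[of "k - 1 - j" u] by (simp add: pos_le_divide_eq mult.commute)
        from mult_left_mono[OF this, of "\<bar>ln_deriv j u\<bar>"] show ?case
          by (simp add: norm_mult norm_power mult.commute del: ln_deriv.simps)
      qed
    qed
  qed
  have "(LBINT u=ereal 0..\<infinity>. I u) = 0 - 0"
  proof (rule interval_integral_FTC_integrable[where F=H])
    show "(H has_vector_derivative I u) (at u)" if "ereal 0 < ereal u" for u
      using Hder that by simp
    show "isCont I u" if "ereal 0 < ereal u" for u
    proof -
      have "continuous_on {0<..} I"
        unfolding I_def by (intro continuous_intros continuous_on_subset[OF C] continuous_on_subset[OF hcont]) auto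
      then show ?thesis using that by (simp add: continuous_on_eq_continuous_at)
    qed
    show "set_integrable lborel (einterval (ereal 0) \<infinity>) I"
      using intI by (simp add: einterval_def greaterThan_def)
  qed (use H0 Hinf in \<open>simp_all add: ereal_tendsto_simps\<close>)
  then have "(LBINT u:{0<..}. I u) = 0" by (simp add: interval_integral_to_infinity_eq)
  then have "(LBINT u:{0<..}. complex_of_real (ln u) * h k u) +
      fact (k - 1) * (LBINT u:{0<..}. complex_of_real (u ^ (m - k)) * C 0 u) = 0"
    unfolding I_def using int1 int2 by (subst (asm) set_integral_add(2)) auto
  then show ?thesis by (simp add: eq_neg_iff_add_eq_0)
qed

section \<open>Fundamental solutions\<close>

text \<open>On a line through the origin the symbol is a polynomial in \<open>t\<close> that equals \<open>c t\<^sup>k\<close> for all \<open>t > 0\<close>,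
hence for all \<open>t\<close>; comparing at \<open>t = -1\<close> gives \<open>c = (-1)\<^sup>k c\<close>.\<close>

lemma symbol_degree_even:
  fixes p :: "real^'n::finite \<Rightarrow> real"
  assumes "real_polynomial_function p" "\<And>\<xi>. \<xi> \<noteq> 0 \<Longrightarrow> p \<xi> > 0"
    and hom: "\<And>t \<xi>. p (t *\<^sub>R \<xi>) = \<bar>t\<bar> ^ k * p \<xi>"
  shows "even k"
proof -
  obtain i :: 'n where True by simp
  define e where "e = (axis i 1 :: real^'n)"
  have c: "p e > 0" by (intro assms(2)) (simp add: e_def axis_eq_0_iff)
  have "polynomial_function (\<lambda>t::real. t *\<^sub>R e)" by (intro polynomial_function_bounded_linear
      bounded_linear_scaleR_left)
  then have "real_polynomial_function (p \<circ> (\<lambda>t. t *\<^sub>R e))"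
    by (rule real_polynomial_function_compose[OF _ assms(1)])
  then obtain a N where "p \<circ> (\<lambda>t. t *\<^sub>R e) = (\<lambda>t. \<Sum>i\<le>N. a i * t ^ i)"
    using real_polynomial_function_imp_sum by blast
  then have a: "p (t *\<^sub>R e) = (\<Sum>i\<le>N. a i * t ^ i)" for t by (metis comp_apply)
  define q where "q = (\<Sum>i\<le>N. monom (a i) i) - monom (p e) k"
  have q: "poly q t = (\<bar>t\<bar> ^ k - t ^ k) * p e" for t
    using a[of t] hom[of t e] by (simp add: q_def poly_sum poly_monom left_diff_distrib)
  have "q = 0"
  proof (rule ccontr)
    assume "q \<noteq> 0"
    then have "finite {t. poly q t = 0}" by (rule poly_roots_finite)
    moreover have "{0<..} \<subseteq> {t. poly q t = 0}" by (auto simp: q)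
    ultimately show False using infinite_Ioi[of "0::real"] finite_subset by blast
  qed
  then have "(-1 :: real) ^ k = 1" using q[of "-1"] c by simp
  then show ?thesis by (cases "even k") auto
qed

lemma sphere_inverse_symbol:
  fixes p :: "real^'n::finite \<Rightarrow> real"
  assumes "real_polynomial_function p" "\<And>\<xi>. \<xi> \<noteq> 0 \<Longrightarrow> p \<xi> > 0"
  shows "(\<lambda>\<theta>. complex_of_real (inverse (p \<theta>))) \<in> borel_measurable borel"
    and "\<exists>W. \<forall>\<theta>\<in>sphere 0 1. norm (complex_of_real (inverse (p \<theta>))) \<le> W"
proof -
  have cont: "continuous_on S p" for S
    using assms(1) by (simp add: continuous_on_polymonial_function real_polynomial_function_eq)
  then have [measurable]: "p \<in> borel_measurable borel" by (intro borel_measurable_continuous_onI)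
  show "(\<lambda>\<theta>. complex_of_real (inverse (p \<theta>))) \<in> borel_measurable borel" by simp
  have "p \<theta> \<noteq> 0" if "\<theta> \<in> sphere 0 1" for \<theta>
    using assms(2)[of \<theta>] that by force
  then have "continuous_on (sphere 0 1) (\<lambda>\<theta>. inverse (p \<theta>))"
    by (intro continuous_on_inverse cont) auto
  then have "bounded ((\<lambda>\<theta>. inverse (p \<theta>)) ` sphere 0 1)"
    by (intro compact_imp_bounded compact_continuous_image) auto
  then show "\<exists>W. \<forall>\<theta>\<in>sphere 0 1. norm (complex_of_real (inverse (p \<theta>))) \<le> W"
    unfolding bounded_iff by (simp add: norm_inverse)
qed

lemma integral_fourier:
  fixes f :: "real^'n::finite \<Rightarrow> complex"
  assumes "f \<in> schwartz"
  shows "(LINT \<xi>|lborel. fourier f \<xi>) = complex_of_real ((2 * pi) ^ CARD('n)) * f 0"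
  using fourier_fourier_schwartz[OF assms, of 0] unfolding fourier_def[of "fourier f"] by simp

text \<open>Since \<open>m \<le> n - 1\<close>, a bound of \<open>|g|\<close> by \<open>(1 + r)\<^sup>-\<^sup>n\<^sup>-\<^sup>1\<close> leaves the integrable weight \<open>(1 + r)\<^sup>-\<^sup>2\<close>.  The
constant depends on \<open>g\<close> only through a seminorm, so the same estimate gives the continuity of the
functional.\<close>

lemma polar_pairing:
  fixes w :: "real^'n::finite \<Rightarrow> complex" and g :: "real^'n \<Rightarrow> complex"
  assumes w: "w \<in> borel_measurable borel" "\<And>\<theta>. \<theta> \<in> sphere 0 1 \<Longrightarrow> norm (w \<theta>) \<le> W"
    and g: "g \<in> schwartz" and m: "m \<le> CARD('n) - 1"
  shows "integrable polar_measure (\<lambda>(r, \<theta>). w \<theta> * g (r *\<^sub>R \<theta>) * complex_of_real (r ^ m))"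
    and "norm (LINT (r, \<theta>)|polar_measure. w \<theta> * g (r *\<^sub>R \<theta>) * complex_of_real (r ^ m)) \<le>
      (W * (LINT z::real \<times> (real^'n)|polar_measure. 1 / (1 + fst z)\<^sup>2)) * schwartz_seminorm (CARD('n) + 1) [] g"
proof -
  let ?F = "\<lambda>z. w (snd z) * g (fst z *\<^sub>R snd z) * complex_of_real (fst z ^ m)"
  let ?s = "schwartz_seminorm (CARD('n) + 1) [] g"
  let ?d = "\<lambda>z::real \<times> (real^'n). W * ?s * (1 / (1 + fst z)\<^sup>2)"
  have meas: "?F \<in> borel_measurable polar_measure"
  proof (intro borel_measurable_times)
    show "(\<lambda>z. w (snd z)) \<in> borel_measurable (polar_measure :: (real \<times> (real^'n)) measure)"
      by (rule measurable_compose[OF measurable_snd borel_measurable_sphere_measure[OF w(1)]])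
    show "(\<lambda>z. g (fst z *\<^sub>R snd z)) \<in> borel_measurable polar_measure"
      using measurable_compose[OF measurable_polar_map schwartz_borel[OF g]] by (simp add: split_beta')
  qed simp
  have d: "integrable polar_measure ?d"
    by (intro integrable_mult_right integrable_polar_inverse_square)
  have le: "norm (?F z) \<le> ?d z" if z: "z \<in> space polar_measure" for z
  proof -
    have r: "0 \<le> fst z" and \<theta>: "snd z \<in> sphere 0 1"
      using z by (auto simp: space_pair_measure space_restrict_space)
    let ?r = "fst z"
    have n: "norm (?r *\<^sub>R snd z) = ?r" using r \<theta> by simp
    have "norm (g (?r *\<^sub>R snd z)) * ?r ^ m \<le> (?s * (1 / (1 + ?r) ^ (CARD('n) + 1))) * (1 + ?r) ^ (CARD('n) - 1)"
    proof (rule mult_mono)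
      show "norm (g (?r *\<^sub>R snd z)) \<le> ?s * (1 / (1 + ?r) ^ (CARD('n) + 1))"
        using schwartz_norm_le[OF g, of "?r *\<^sub>R snd z" "CARD('n) + 1"] unfolding n .
      have "?r ^ m \<le> (1 + ?r) ^ m" using r by (intro power_mono) auto
      also have "\<dots> \<le> (1 + ?r) ^ (CARD('n) - 1)" using r m by (intro power_increasing) auto
      finally show "?r ^ m \<le> (1 + ?r) ^ (CARD('n) - 1)" .
    qed (use r schwartz_seminorm_nonneg[OF g, of "CARD('n) + 1" "[]"] in auto)
    also have "\<dots> = ?s * (1 / (1 + ?r)\<^sup>2)"
    proof -
      have "(1 + ?r) ^ (CARD('n) + 1) = (1 + ?r) ^ (CARD('n) - 1) * (1 + ?r)\<^sup>2"
        by (simp flip: power_add)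
      then show ?thesis using r by (simp add: field_simps)
    qed
    finally have gs: "norm (g (?r *\<^sub>R snd z)) * ?r ^ m \<le> ?s * (1 / (1 + ?r)\<^sup>2)" .
    have "norm (w (snd z)) * (norm (g (?r *\<^sub>R snd z)) * ?r ^ m) \<le> W * (?s * (1 / (1 + ?r)\<^sup>2))"
      using r by (intro mult_mono[OF w(2)[OF \<theta>] gs]) (auto intro: order_trans[OF norm_ge_zero w(2)[OF \<theta>]])
    then show ?thesis using r by (simp add: norm_mult norm_power mult.assoc)
  qed
  have int: "integrable polar_measure ?F"
    by (rule Bochner_Integration.integrable_bound[OF d meas], rule AE_I2, rule order_trans[OF le])
      (simp_all only: real_norm_def abs_ge_self)
  then show "integrable polar_measure (\<lambda>(r, \<theta>). w \<theta> * g (r *\<^sub>R \<theta>) * complex_of_real (r ^ m))"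
    by (simp add: split_beta')
  have "norm (integral\<^sup>L polar_measure ?F) \<le> (LINT z|polar_measure. norm (?F z))"
    by (rule integral_norm_bound)
  also have "\<dots> \<le> integral\<^sup>L polar_measure ?d"
    by (rule integral_mono[OF integrable_norm[OF int] d le])
  also have "\<dots> = (W * (LINT z::real \<times> (real^'n)|polar_measure. 1 / (1 + fst z)\<^sup>2)) * ?s"
    by (subst integral_mult_right_zero) (simp add: mult_ac)
  finally show "norm (LINT (r, \<theta>)|polar_measure. w \<theta> * g (r *\<^sub>R \<theta>) * complex_of_real (r ^ m)) \<le>
      (W * (LINT z::real \<times> (real^'n)|polar_measure. 1 / (1 + fst z)\<^sup>2)) * ?s"
    by (simp add: split_beta')
qed

lemma fourier_schwartz_add:
  "f \<in> schwartz \<Longrightarrow> g \<in> schwartz \<Longrightarrow> fourier (\<lambda>x. f x + g x) = (\<lambda>\<xi>. fourier f \<xi> + fourier g \<xi>)"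
  by (rule ext) (intro fourier_add schwartz_integrable)

text \<open>Applying the functional to \<open>P f\<close> replaces \<open>F f\<close> by \<open>p F f\<close>.  By homogeneity the factor
\<open>p(r \<theta>) = r\<^sup>k p(\<theta>)\<close> cancels the weights, which leaves the integral of \<open>F f\<close> in polar coordinates.\<close>

lemma fundamental_solution_low_degree:
  fixes p :: "real^'n::finite \<Rightarrow> real"
  assumes p: "real_polynomial_function p" "\<And>\<xi>. \<xi> \<noteq> 0 \<Longrightarrow> p \<xi> > 0"
    and hom: "\<And>t \<xi>. p (t *\<^sub>R \<xi>) = \<bar>t\<bar> ^ k * p \<xi>" and k: "k < CARD('n)"
  shows "fundamental_solution p (\<lambda>f. complex_of_real (1 / (2 * pi) ^ CARD('n)) *
     (LINT (r, \<theta>)|polar_measure. complex_of_real (inverse (p \<theta>)) * fourier f (r *\<^sub>R \<theta>)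
        * complex_of_real (r ^ (CARD('n) - 1 - k))))"
proof -
  define I where "I g = (LINT (r, \<theta>)|polar_measure. complex_of_real (inverse (p \<theta>)) * g (r *\<^sub>R \<theta>)
        * complex_of_real (r ^ (CARD('n) - 1 - k)))" for g
  obtain W where W: "\<And>\<theta>. \<theta> \<in> sphere 0 1 \<Longrightarrow> norm (complex_of_real (inverse (p \<theta>))) \<le> W"
    using sphere_inverse_symbol(2)[of p] p by blast
  have w: "(\<lambda>\<theta>. complex_of_real (inverse (p \<theta>))) \<in> borel_measurable borel"
    by (rule sphere_inverse_symbol(1)) (use p in auto)
  let ?K = "W * (LINT z::real \<times> (real^'n)|polar_measure. 1 / (1 + fst z)\<^sup>2)"
  have int: "integrable polar_measure (\<lambda>(r, \<theta>). complex_of_real (inverse (p \<theta>)) * g (r *\<^sub>R \<theta>) * complex_of_real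
      (r ^ (CARD('n) - 1 - k)))"
    if "g \<in> schwartz" for g
    by (rule polar_pairing(1)[OF w W that]) auto
  have bound: "norm (I g) \<le> ?K * schwartz_seminorm (CARD('n) + 1) [] g" if "g \<in> schwartz" for g
    unfolding I_def by (rule polar_pairing(2)[OF w W that]) auto
  have W0: "0 \<le> W" using order_trans[OF norm_ge_zero W[of "axis undefined 1"]] by (simp add: norm_axis_1)
  let ?c = "complex_of_real (1 / (2 * pi) ^ CARD('n))"
  have "tempered_distribution (\<lambda>f. ?c * I (fourier f))"
  proof (rule tempered_distributionI)
    show "?c * I (fourier (\<lambda>x. f x + g x)) = ?c * I (fourier f) + ?c * I (fourier g)"
      if "f \<in> schwartz" "g \<in> schwartz" for f g
    proof -
      have "I (\<lambda>\<xi>. fourier f \<xi> + fourier g \<xi>) = I (fourier f) + I (fourier g)"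
        unfolding I_def using that[THEN schwartz_fourier, THEN int]
        by (simp add: split_beta' distrib_left distrib_right)
      then show ?thesis by (simp add: fourier_schwartz_add that distrib_left)
    qed
    show "?c * I (fourier (\<lambda>x. c * f x)) = c * (?c * I (fourier f))" for c f
    proof -
      have "I (\<lambda>\<xi>. c * fourier f \<xi>) = c * I (fourier f)"
        unfolding I_def by (subst integral_mult_right_zero[symmetric]) (simp add: split_beta' mult_ac)
      moreover have "fourier (\<lambda>x. c * f x) = (\<lambda>\<xi>. c * fourier f \<xi>)" by (rule ext) (rule fourier_cmult)
      ultimately show ?thesis by simp
    qed
    show "seminorm_bounded (\<lambda>f. norm (?c * I (fourier f)))"
    proof (rule seminorm_bounded_mono)
      have "0 \<le> ?K" using W0 by (intro mult_nonneg_nonneg Bochner_Integration.integral_nonneg) auto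
      then show "seminorm_bounded (\<lambda>f. norm ?c * (?K * schwartz_seminorm (CARD('n) + 1) [] (fourier f)))"
        by (intro seminorm_bounded_mult seminorm_bounded_compose[OF seminorm_bounded_seminorm
            schwartz_op_fourier[OF schwartz_op_id]]) auto
      show "norm (?c * I (fourier f)) \<le> norm ?c * (?K * schwartz_seminorm (CARD('n) + 1) [] (fourier f))"
          if "f \<in> schwartz" for f
        unfolding norm_mult by (intro mult_left_mono bound schwartz_fourier that) auto
    qed
  qed
  moreover have "?c * I (fourier (symbol_op (\<lambda>\<xi>. p (- \<xi>)) f)) = dirac f" if f: "f \<in> schwartz" for f
  proof -
    have "p (- \<xi>) = p \<xi>" for \<xi> using hom[of "-1" \<xi>] by simp
    then have "fourier (symbol_op (\<lambda>\<xi>. p (- \<xi>)) f) = (\<lambda>\<xi>. complex_of_real (p \<xi>) * fourier f \<xi>)"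
      using fourier_symbol_op[OF p(1) f] by auto
    then have "I (fourier (symbol_op (\<lambda>\<xi>. p (- \<xi>)) f)) =
       (LINT (r, \<theta>)|polar_measure. (r ^ (CARD('n) - 1)) *\<^sub>R fourier f (r *\<^sub>R \<theta>))"
      unfolding I_def
    proof (simp only:, intro Bochner_Integration.integral_cong refl, clarify)
      fix r and \<theta> :: "real^'n" assume "(r, \<theta>) \<in> space polar_measure"
      then have r: "0 \<le> r" and \<theta>: "\<theta> \<noteq> 0" by (auto simp: space_pair_measure space_restrict_space)
      have "r ^ (CARD('n) - 1) = r ^ k * r ^ (CARD('n) - 1 - k)" using k by (simp flip: power_add)
      then have "inverse (p \<theta>) * p (r *\<^sub>R \<theta>) * r ^ (CARD('n) - 1 - k) = r ^ (CARD('n) - 1)"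
        using p(2)[OF \<theta>] r by (simp add: hom)
      then have "complex_of_real (r ^ (CARD('n) - 1)) = complex_of_real (inverse (p \<theta>)) * complex_of_real
          (p (r *\<^sub>R \<theta>)) * complex_of_real (r ^ (CARD('n) - 1 - k))"
        by (simp only: of_real_mult[symmetric])
      then show "complex_of_real (inverse (p \<theta>)) * (complex_of_real (p (r *\<^sub>R \<theta>)) * fourier f (r *\<^sub>R \<theta>)) *
          complex_of_real (r ^ (CARD('n) - 1 - k))
          = (r ^ (CARD('n) - 1)) *\<^sub>R fourier f (r *\<^sub>R \<theta>)"
        unfolding scaleR_conv_of_real[where 'a=complex] by (simp only: mult_ac)
    qed
    also have "\<dots> = (LINT \<xi>|lborel. fourier f \<xi>)"
      by (intro integral_polar schwartz_integrable schwartz_fourier f)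
    finally show ?thesis by (simp add: integral_fourier[OF f] dirac_def)
  qed
  ultimately show ?thesis
    unfolding fundamental_solution_def symbol_op_dist_def I_def by blast
qed

lemma radial_family_spherical_average:
  fixes p :: "real^'n::finite \<Rightarrow> real"
  assumes "real_polynomial_function p" "\<And>\<xi>. \<xi> \<noteq> 0 \<Longrightarrow> p \<xi> > 0"
  shows "radial_family (spherical_average p)"
proof -
  obtain W where W: "\<And>\<theta>. \<theta> \<in> sphere 0 1 \<Longrightarrow> norm (complex_of_real (inverse (p \<theta>))) \<le> W"
    using sphere_inverse_symbol(2)[of p] assms by blast
  have eq: "spherical_average p = (\<lambda>g r. complex_of_real (r ^ (CARD('n) - 1)) *
      (LINT \<theta>|sphere_measure. complex_of_real (inverse (p \<theta>)) * partials [] g (r *\<^sub>R \<theta>)))"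
    by (intro ext) (simp add: spherical_average_def mult.commute)
  have meas: "(\<lambda>\<theta>. complex_of_real (inverse (p \<theta>))) \<in> borel_measurable sphere_measure"
    by (intro borel_measurable_sphere_measure sphere_inverse_symbol(1)) (use assms in auto)
  show ?thesis unfolding eq by (rule radial_family.base[OF meas W])
qed

lemma spherical_average_symbol:
  fixes p :: "real^'n::finite \<Rightarrow> real"
  assumes p: "\<And>\<xi>. \<xi> \<noteq> 0 \<Longrightarrow> p \<xi> > 0" and hom: "\<And>t \<xi>. p (t *\<^sub>R \<xi>) = \<bar>t\<bar> ^ k * p \<xi>" and "even k"
  shows "spherical_average p (\<lambda>\<xi>. complex_of_real (p \<xi>) * g \<xi>) r =
    complex_of_real (r ^ (CARD('n) - 1 + k)) * (LINT \<theta>|sphere_measure. g (r *\<^sub>R \<theta>))"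
proof -
  have "(LINT \<theta>|sphere_measure. complex_of_real (p (r *\<^sub>R \<theta>)) * g (r *\<^sub>R \<theta>) * complex_of_real (inverse (p \<theta>)))
    = (LINT \<theta>|sphere_measure. complex_of_real (r ^ k) * g (r *\<^sub>R \<theta>))"
  proof (intro Bochner_Integration.integral_cong refl)
    fix \<theta> :: "real^'n" assume "\<theta> \<in> space sphere_measure"
    then have "p \<theta> \<noteq> 0" using p[of \<theta>] by force
    then show "complex_of_real (p (r *\<^sub>R \<theta>)) * g (r *\<^sub>R \<theta>) * complex_of_real (inverse (p \<theta>)) =
        complex_of_real (r ^ k) * g (r *\<^sub>R \<theta>)"
      using \<open>even k\<close> by (simp add: hom power_even_abs)
  qed
  also have "\<dots> = complex_of_real (r ^ k) * (LINT \<theta>|sphere_measure. g (r *\<^sub>R \<theta>))"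
    by (rule integral_mult_right_zero)
  finally show ?thesis by (simp only: spherical_average_def power_add of_real_mult mult.assoc)
qed

lemma integral_radial:
  fixes g :: "real^'n::finite \<Rightarrow> complex"
  assumes "g \<in> schwartz"
  shows "(LBINT u:{0<..}. complex_of_real (u ^ (CARD('n) - 1)) * (LINT \<theta>|sphere_measure. g (u *\<^sub>R \<theta>))) =
      (LINT x|lborel. g x)"
proof -
  let ?A = "\<lambda>u. complex_of_real (u ^ (CARD('n) - 1)) * (LINT \<theta>|sphere_measure. g (u *\<^sub>R \<theta>))"
  have int: "integrable polar_measure (\<lambda>(r, \<theta>). (r ^ (CARD('n) - 1)) *\<^sub>R g (r *\<^sub>R \<theta>))"
    by (rule integrable_polar[OF schwartz_integrable[OF assms]])
  have "(LINT x|lborel. g x) = (LINT (r, \<theta>)|polar_measure. (r ^ (CARD('n) - 1)) *\<^sub>R g (r *\<^sub>R \<theta>))"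
    by (rule integral_polar[symmetric, OF schwartz_integrable[OF assms]])
  also have "\<dots> = (LINT r|restrict_space lborel {0..}. LINT \<theta>|sphere_measure. (r ^ (CARD('n) - 1)) *\<^sub>R g (r *\<^sub>R \<theta>))"
    by (rule polar.integral_fst[symmetric, OF int])
  also have "\<dots> = (LINT r|restrict_space lborel {0..}. ?A r)"
    by (simp add: scaleR_conv_of_real[where 'a=complex])
  also have "\<dots> = (LBINT r. indicator {0..} r *\<^sub>R ?A r)"
    by (rule integral_restrict_space) simp
  also have "\<dots> = (LBINT u:{0<..}. ?A u)"
    unfolding set_lebesgue_integral_def
  proof (rule integral_cong_AE)
    have A: "continuous_on UNIV ?A"
      using radial_family_continuous[OF radial_family.base[of "\<lambda>_. 1" 1 "CARD('n) - 1" "[]"] assms] by simp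
    then show "(\<lambda>r. indicator {0..} r *\<^sub>R ?A r) \<in> borel_measurable lborel"
        "(\<lambda>r. indicator {0<..} r *\<^sub>R ?A r) \<in> borel_measurable lborel"
      by (auto simp: intro!: borel_measurable_continuous_on_indicator intro: continuous_on_subset)
    show "AE r in lborel. indicator {0..} r *\<^sub>R ?A r = indicator {0<..} r *\<^sub>R ?A r"
      using AE_lborel_singleton[of "0::real"] by eventually_elim (auto simp: indicator_def)
  qed
  finally show ?thesis ..
qed

text \<open>Applied to \<open>P f\<close>, the spherical average becomes \<open>h = r\<^sup>n\<^sup>-\<^sup>1\<^sup>+\<^sup>k\<close> times the integral of
\<open>F f (r \<theta>)\<close> over the unit sphere.  It vanishes at \<open>0\<close> to an order that makes the derivative of order \<open>k - 1\<close> vanish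
there, and the logarithmic integral reduces, by \<open>k\<close> integrations by parts, to
\<open>- (k-1)!\<close> times the integral of \<open>u\<^sup>-\<^sup>k h(u)\<close>, which is the integral of \<open>F f\<close>.\<close>

lemma
  fixes p :: "real^'n::finite \<Rightarrow> real"
  assumes p: "real_polynomial_function p" "\<And>\<xi>. \<xi> \<noteq> 0 \<Longrightarrow> p \<xi> > 0"
    and hom: "\<And>t \<xi>. p (t *\<^sub>R \<xi>) = \<bar>t\<bar> ^ k * p \<xi>" and k: "0 < k"
  defines "d \<equiv> \<lambda>j f. halfline_deriv j (spherical_average p (fourier f))"
  shows spherical_average_differentiable:
      "f \<in> schwartz \<Longrightarrow> 0 \<le> r \<Longrightarrow> d j f differentiable (at r within {0..})"
    and spherical_average_set_integrable:
      "f \<in> schwartz \<Longrightarrow> set_integrable lborel {0<..} (\<lambda>u. complex_of_real (ln u) * d k f u)"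
    and fundamental_solution_high_degree: "fundamental_solution p (\<lambda>f.
         - complex_of_real (C_const k CARD('n)) * d (k - 1) f 0
         + complex_of_real (D_const k CARD('n)) * (LBINT u:{0<..}. complex_of_real (ln u) * d k f u))"
proof -
  obtain P where P0: "P 0 = spherical_average p" and P: "\<And>j. radial_family (P j)"
    and Pder: "\<And>j g r. g \<in> schwartz \<Longrightarrow> (P j g has_vector_derivative P (Suc j) g r) (at r)"
  proof -
    have "radial_family (spherical_average p)"
      by (rule radial_family_spherical_average) (use p in auto)
    then show ?thesis by (rule radial_family_derivatives) (rule that)
  qed
  have d: "d j f r = P j (fourier f) r" if "f \<in> schwartz" "0 \<le> r" for j f r
    unfolding d_def P0[symmetric]
    by (rule halfline_deriv_eq[where h="\<lambda>j. P j (fourier f)"]) (use that Pder schwartz_fourier in auto)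
  show "d j f differentiable (at r within {0..})" if "f \<in> schwartz" "0 \<le> r" for f j r
    unfolding d_def P0[symmetric]
    by (rule halfline_deriv_differentiable[where h="\<lambda>j. P j (fourier f)"]) (use that Pder schwartz_fourier in auto)
  obtain q where q: "seminorm_bounded q" "\<forall>g\<in>schwartz. \<forall>r\<ge>0. (1 + r) ^ 3 * norm (P k g r) \<le> q g"
    using radial_family_decay[OF P] by blast
  obtain q0 where q0: "seminorm_bounded q0" "\<forall>g\<in>schwartz. \<forall>r\<ge>0. (1 + r) ^ 0 * norm (P (k - 1) g r) \<le> q0 g"
    using radial_family_decay[OF P] by blast
  have Pint: "set_integrable lborel {0<..} (\<lambda>u. complex_of_real (ln u) * P k g u)"
    and Pbound: "norm (LBINT u:{0<..}. complex_of_real (ln u) * P k g u) \<le>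
        q g * (LBINT u:{0<..}. \<bar>ln u / (1 + u) ^ 3\<bar>)"
    if "g \<in> schwartz" for g
    using decaying_times_ln[of "P k g" "q g"] q(2) that continuous_on_subset[OF radial_family_continuous[OF P that]]
        by auto
  show dint: "set_integrable lborel {0<..} (\<lambda>u. complex_of_real (ln u) * d k f u)" if "f \<in> schwartz" for f
    using Pint[OF schwartz_fourier[OF that]] d[OF that]
    by (subst set_integrable_cong[where f'="\<lambda>u. complex_of_real (ln u) * P k (fourier f) u"]) auto
  define J where "J g = (LBINT u:{0<..}. complex_of_real (ln u) * P k g u)" for g
  let ?C = "complex_of_real (C_const k CARD('n))" and ?D = "complex_of_real (D_const k CARD('n))"
  define T where "T f = - ?C * d (k - 1) f 0 + ?D * (LBINT u:{0<..}. complex_of_real (ln u) * d k f u)" for f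
  have T: "T f = - ?C * P (k - 1) (fourier f) 0 + ?D * J (fourier f)" if "f \<in> schwartz" for f
  proof -
    have "(LBINT u:{0<..}. complex_of_real (ln u) * d k f u) = J (fourier f)"
      unfolding J_def using d[OF that] by (intro set_lebesgue_integral_cong) auto
    then show ?thesis unfolding T_def using d[OF that] by simp
  qed
  have "tempered_distribution T"
  proof (rule tempered_distributionI)
    show "T (\<lambda>x. f x + g x) = T f + T g" if fg: "f \<in> schwartz" "g \<in> schwartz" for f g
    proof -
      note F = fg[THEN schwartz_fourier]
      have "J (\<lambda>\<xi>. fourier f \<xi> + fourier g \<xi>) = J (fourier f) + J (fourier g)"
        unfolding J_def radial_family_linear(1)[OF P F] distrib_left by (intro set_integral_add Pint F)
      then show ?thesis
        unfolding T[OF fg(1)] T[OF fg(2)] T[OF schwartz_add[OF fg]] fourier_schwartz_add[OF fg]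
            radial_family_linear(1)[OF P F]
        by (simp add: algebra_simps)
    qed
    show "T (\<lambda>x. c * f x) = c * T f" if f: "f \<in> schwartz" for c f
    proof -
      note F = schwartz_fourier[OF f]
      have "J (\<lambda>\<xi>. c * fourier f \<xi>) = c * J (fourier f)"
        unfolding J_def radial_family_linear(2)[OF P F]
        by (subst set_integral_mult_right[symmetric]) (simp add: mult.left_commute)
      moreover have "fourier (\<lambda>x. c * f x) = (\<lambda>\<xi>. c * fourier f \<xi>)" by (rule ext) (rule fourier_cmult)
      ultimately show ?thesis
        unfolding T[OF f] T[OF schwartz_cmult[OF f]]
        by (simp add: radial_family_linear(2)[OF P F] algebra_simps)
    qed
    let ?K = "LBINT (u::real):{0<..}. \<bar>ln u / (1 + u) ^ 3\<bar>"
    show "seminorm_bounded (\<lambda>f. norm (T f))"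
    proof (rule seminorm_bounded_mono)
      have "0 \<le> ?K" unfolding set_lebesgue_integral_def by (intro Bochner_Integration.integral_nonneg) auto
      then show "seminorm_bounded (\<lambda>f. norm ?C * q0 (fourier f) + norm ?D * (?K * q (fourier f)))"
        by (intro seminorm_bounded_add seminorm_bounded_mult
            seminorm_bounded_compose[OF q(1) schwartz_op_fourier[OF schwartz_op_id]]
          seminorm_bounded_compose[OF q0(1) schwartz_op_fourier[OF schwartz_op_id]]) auto
      fix f :: "real^'n \<Rightarrow> complex" assume f: "f \<in> schwartz"
      have "norm (T f) \<le> norm (?C * P (k - 1) (fourier f) 0) + norm (?D * J (fourier f))"
        unfolding T[OF f] by (rule order_trans[OF norm_triangle_ineq]) simp
      also have "\<dots> \<le> norm ?C * q0 (fourier f) + norm ?D * (?K * q (fourier f))"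
        unfolding norm_mult
        using q0(2) schwartz_fourier[OF f] Pbound[OF schwartz_fourier[OF f]]
        by (intro add_mono mult_left_mono) (auto simp: J_def mult.commute)
      finally show "norm (T f) \<le> norm ?C * q0 (fourier f) + norm ?D * (?K * q (fourier f))" .
    qed
  qed
  moreover have "T (symbol_op (\<lambda>\<xi>. p (- \<xi>)) f) = dirac f" if f: "f \<in> schwartz" for f
  proof -
    define m where "m = CARD('n) - 1 + k"
    have m: "k \<le> m" "m - k = CARD('n) - 1" unfolding m_def by linarith+
    have ev: "even k" by (rule symbol_degree_even) (use p hom in auto)
    define B where "B = (\<lambda>g r. LINT \<theta>|sphere_measure. g (r *\<^sub>R (\<theta> :: real^'n)) :: complex)"
    have B: "radial_family B"
      using radial_family.base[of "\<lambda>_. 1" 1 0 "[]"] by (simp add: B_def)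
    obtain C where C0: "C 0 = B" and C: "\<And>j. radial_family (C j)"
      and Cder: "\<And>j g r. j < m \<Longrightarrow> g \<in> schwartz \<Longrightarrow>
        ((\<lambda>r. complex_of_real (r ^ (m - j)) * C j g r) has_vector_derivative complex_of_real (r ^ (m - Suc j)) * C
            (Suc j) g r) (at r)"
      by (rule radial_family_vanishing_derivatives[where m=m, OF B]) (rule that)
    have F: "fourier f \<in> schwartz" by (rule schwartz_fourier[OF f])
    define h where "h j u = complex_of_real (u ^ (m - j)) * C j (fourier f) u" for j u
    have "p (- \<xi>) = p \<xi>" for \<xi> using hom[of "-1" \<xi>] by simp
    then have Pf: "symbol_op (\<lambda>\<xi>. p (- \<xi>)) f = symbol_op p f" by simp
    have "fourier (symbol_op p f) = (\<lambda>\<xi>. complex_of_real (p \<xi>) * fourier f \<xi>)"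
      by (rule ext) (rule fourier_symbol_op[OF p(1) f])
    note fPf = this
    have avg: "spherical_average p (fourier (symbol_op p f)) = h 0"
      unfolding fPf h_def[abs_def] C0 B_def m_def diff_zero
      by (rule ext) (rule spherical_average_symbol, use p hom ev in auto)
    have hder: "(h j has_vector_derivative h (Suc j) r) (at r)" if "j < k" for j r
      unfolding h_def[abs_def] using that m(1) by (intro Cder F) auto
    have dh: "d j (symbol_op p f) r = h j r" if "j \<le> k" "0 \<le> r" for j r
      unfolding d_def avg by (rule halfline_deriv_eq) (use that hder in auto)
    have "(LBINT u:{0<..}. complex_of_real (ln u) * d k (symbol_op p f) u) =
        (LBINT u:{0<..}. complex_of_real (ln u) * h k u)"
      using dh by (intro set_lebesgue_integral_cong) auto
    also have "\<dots> = - (fact (k - 1)) * (LBINT u:{0<..}. complex_of_real (u ^ (m - k)) * C 0 (fourier f) u)"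
    proof (rule integral_ln_derivative[OF k m(1)])
      show "\<exists>Bd. \<forall>u\<ge>0. (1 + u) ^ N * norm (C j (fourier f) u) \<le> Bd" for j N
        using radial_family_decay[OF C, of N j] F by blast
      show "h j u = complex_of_real (u ^ (m - j)) * C j (fourier f) u" for j u
        by (rule h_def)
    qed (intro hder radial_family_continuous[OF C F], assumption?)+
    also have "(LBINT u:{0<..}. complex_of_real (u ^ (m - k)) * C 0 (fourier f) u) =
        complex_of_real ((2 * pi) ^ CARD('n)) * f 0"
      unfolding m C0 B_def integral_radial[OF F] by (rule integral_fourier[OF f])
    finally have int: "(LBINT u:{0<..}. complex_of_real (ln u) * d k (symbol_op p f) u) =
       - (fact (k - 1)) * (complex_of_real ((2 * pi) ^ CARD('n)) * f 0)" .
    have "d (k - 1) (symbol_op p f) 0 = 0"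
      using dh[of "k - 1" 0] k m(1) by (simp add: h_def)
    \<comment> \<open>Here the parity of \<open>k\<close> fixes the sign of the constant.\<close>
    moreover have "D_const k CARD('n) * (fact (k - 1) * (2 * pi) ^ CARD('n)) = -1"
      using k ev by (simp add: D_const_def uminus_power_if)
    then have "?D * (fact (k - 1) * complex_of_real ((2 * pi) ^ CARD('n))) = -1"
      by (metis of_real_1 of_real_fact of_real_minus of_real_mult)
    ultimately show ?thesis
      unfolding T_def Pf int dirac_def by (simp add: mult.assoc[symmetric])
  qed
  ultimately show "fundamental_solution p (\<lambda>f. - ?C * d (k - 1) f 0 +
      ?D * (LBINT u:{0<..}. complex_of_real (ln u) * d k f u))"
    unfolding fundamental_solution_def symbol_op_dist_def T_def by blast
qed

theorem theorem1:
  fixes p :: "real^'n::finite \<Rightarrow> real" and k :: nat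
  assumes "k \<ge> 1"
    and "real_polynomial_function p"
    and "\<And>\<xi>. \<xi> \<noteq> 0 \<Longrightarrow> p \<xi> > 0"
    and "\<And>t \<xi>. p (t *\<^sub>R \<xi>) = \<bar>t\<bar> ^ k * p \<xi>"
  shows "(k < CARD('n) \<longrightarrow>
      (\<forall>f\<in>schwartz. integrable (restrict_space lborel {0..} \<Otimes>\<^sub>M sphere_measure)
         (\<lambda>(r, \<theta>). complex_of_real (inverse (p \<theta>)) * fourier f (r *\<^sub>R \<theta>)
            * complex_of_real (r ^ (CARD('n) - 1 - k)))) \<and>
      fundamental_solution p (\<lambda>f. complex_of_real (1 / (2 * pi) ^ CARD('n)) *
         (LINT (r, \<theta>)|(restrict_space lborel {0..} \<Otimes>\<^sub>M sphere_measure).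
            complex_of_real (inverse (p \<theta>)) * fourier f (r *\<^sub>R \<theta>)
            * complex_of_real (r ^ (CARD('n) - 1 - k))))) \<and>
    (k \<ge> CARD('n) \<longrightarrow>
      (\<forall>f\<in>schwartz.
         (\<forall>j<k. \<forall>r\<ge>0. halfline_deriv j (spherical_average p (fourier f))
            differentiable (at r within {0..})) \<and>
         set_integrable lborel {0<..} (\<lambda>u. complex_of_real (ln u)
            * halfline_deriv k (spherical_average p (fourier f)) u)) \<and>
      fundamental_solution p (\<lambda>f.
         - complex_of_real (C_const k CARD('n))
            * halfline_deriv (k - 1) (spherical_average p (fourier f)) 0
         + complex_of_real (D_const k CARD('n))
            * (LBINT u:{0<..}. complex_of_real (ln u)
                * halfline_deriv k (spherical_average p (fourier f)) u)))"
proof -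
  obtain W where W: "\<And>\<theta>. \<theta> \<in> sphere 0 1 \<Longrightarrow> norm (complex_of_real (inverse (p \<theta>))) \<le> W"
    using sphere_inverse_symbol(2)[of p] assms by blast
  have w: "(\<lambda>\<theta>. complex_of_real (inverse (p \<theta>))) \<in> borel_measurable borel"
    by (rule sphere_inverse_symbol(1)) (use assms in auto)
  show ?thesis
    by (intro conjI impI ballI allI polar_pairing(1)[OF w W] schwartz_fourier fundamental_solution_low_degree
      spherical_average_differentiable[where k=k] spherical_average_set_integrable fundamental_solution_high_degree assms)
      (use assms(1) in auto)
qed

end
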